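(* Let $(R_t,t\ge 0)$ be a Bessel process with index $\nu>-1$ and drift $c\ge 0$ started from $x$ (law $\mathbb{P}^{(\nu,c)}_x$), and let $f(t)=\sqrt{at^2+bt}$ with $b>0$ and $\sqrt{a}>c$. Then the density of the last passage time $G_f$ is given, for every $x\ge 0$, by $$\mathbb{P}^{(\nu,c)}_x(G_f\in dt)=\varphi\left(\ln\left(1+\frac{b}{at}\right)\right)\frac{b}{ct}\,\frac{1}{\sqrt{at^2+bt}}\,\frac{\exp\left(-\frac{x^2}{2t}\right)}{I_\nu(cx)}\,I_\nu\left(\frac{x\sqrt{at^2+bt}}{t}\right)dt,$$ where the function $\varphi$ has Laplace transform $$\int_0^{+\infty}e^{-\lambda t}\varphi(t)\,dt=\frac{\exp\left(\frac{c^2b}{4a}\right)M_{-\lambda,\nu/2}\left(\frac{c^2b}{2a}\right)}{\exp\left(\frac{b}{4}\right)M_{-\lambda,\nu/2}\left(\frac{b}{2}\right)}.$$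
   Context: The Bessel process with index $\nu$ and drift $c$ is the diffusion on the nonnegative half-line with generator $$\mathcal{G}^{(\nu,c)}=\frac12\frac{\partial^2}{\partial x^2}+\left(\frac{2\nu+1}{2x}+c\,\frac{I_{\nu+1}(cx)}{I_\nu(cx)}\right)\frac{\partial}{\partial x},$$ speed measure $m^{(\nu,c)}(dx)=2(\Gamma(\nu+1))^2\left(\frac{2}{c}\right)^{2\nu}x\,I_\nu^2(cx)\,dx$ and transition density with respect to $m^{(\nu,c)}$ $$q^{(\nu,c)}(t,z,y)=\frac{1}{2t(\Gamma(\nu+1))^2}\left(\frac{c}{2}\right)^{2\nu}\frac{\exp\left(-\frac{c^2t}{2}\right)}{I_\nu(cz)I_\nu(cy)}\exp\left(-\frac{z^2+y^2}{2t}\right)I_\nu\left(\frac{zy}{t}\right),$$ where $I_\nu$ is the modified Bessel function; for $c=0$ it is the ordinary Bessel process of index $\nu$, with transition density $\frac{1}{2t}(zy)^{-\nu}\exp\left(-\frac{z^2+y^2}{2t}\right)I_\nu\left(\frac{zy}{t}\right)$ with respect to $2y^{2\nu+1}dy$. $M_{-\lambda,\nu/2}$ denotes the Whittaker function $M_{\kappa,\mu}$ with $\kappa=-\lambda$, $\mu=\nu/2$. $G_f:=\sup\{t\ge 0: R_t=f(t)\}$, with $G_f=0$ if this set is empty.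
   Formalization: For c=0 the printed formula is 0/0; it is read as its limit c→0+ after extracting c^{ν+1}, with φ having Laplace transform the limit of the stated one divided by c^{ν+1}. At x=0 the quotient of Bessel functions is read as its limit x→0+. *)

theory Defs
  imports "HOL-Probability.Probability"
begin

text \<open>The special functions below are only used at positive arguments \<open>z\<close> and for
  \<open>\<nu> > -1\<close>, where the series converge and the real power is the usual one.\<close>

definition bessel_I :: "real \<Rightarrow> real \<Rightarrow> real" where
  "bessel_I \<nu> z = (\<Sum>k. (z / 2) powr (\<nu> + 2 * real k) / (fact k * Gamma (\<nu> + real k + 1)))"

text \<open>Kummer's confluent hypergeometric function \<open>1F1(\<alpha>; \<beta>; z)\<close>.\<close>

definition kummer_M :: "real \<Rightarrow> real \<Rightarrow> real \<Rightarrow> real" where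
  "kummer_M \<alpha> \<beta> z = (\<Sum>k. pochhammer \<alpha> k / (pochhammer \<beta> k * fact k) * z ^ k)"

definition whittaker_M :: "real \<Rightarrow> real \<Rightarrow> real \<Rightarrow> real" where
  "whittaker_M \<kappa> \<mu> z =
     exp (- z / 2) * z powr (\<mu> + 1 / 2) * kummer_M (\<mu> - \<kappa> + 1 / 2) (1 + 2 * \<mu>) z"

text \<open>Lebesgue density, on \<open>{0<..}\<close>, of the speed measure.\<close>

definition bessel_speed_density :: "real \<Rightarrow> real \<Rightarrow> real \<Rightarrow> real" where
  "bessel_speed_density \<nu> c y =
     (if c = 0 then 2 * y powr (2 * \<nu> + 1)
      else 2 * (Gamma (\<nu> + 1))\<^sup>2 * (2 / c) powr (2 * \<nu>) * y * (bessel_I \<nu> (c * y))\<^sup>2)"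

text \<open>Transition density with respect to the speed measure, for \<open>z > 0\<close> and \<open>y > 0\<close>.\<close>

definition bessel_q_interior :: "real \<Rightarrow> real \<Rightarrow> real \<Rightarrow> real \<Rightarrow> real \<Rightarrow> real" where
  "bessel_q_interior \<nu> c t z y =
     (if c = 0
      then 1 / (2 * t) * (z * y) powr (- \<nu>) * exp (- (z\<^sup>2 + y\<^sup>2) / (2 * t)) * bessel_I \<nu> (z * y / t)
      else 1 / (2 * t * (Gamma (\<nu> + 1))\<^sup>2) * (c / 2) powr (2 * \<nu>)
             * (exp (- (c\<^sup>2 * t / 2)) / (bessel_I \<nu> (c * z) * bessel_I \<nu> (c * y)))
             * exp (- (z\<^sup>2 + y\<^sup>2) / (2 * t)) * bessel_I \<nu> (z * y / t))"

text \<open>The formula is \<open>0/0\<close> (or \<open>\<infinity>/\<infinity>\<close>) at the starting point \<open>z = 0\<close>, where it is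
  extended by continuity. The end point \<open>y = 0\<close> carries no mass.\<close>

definition bessel_q :: "real \<Rightarrow> real \<Rightarrow> real \<Rightarrow> real \<Rightarrow> real \<Rightarrow> real" where
  "bessel_q \<nu> c t z y =
     (if z = 0 then Lim (at_right 0) (\<lambda>z'. bessel_q_interior \<nu> c t z' y)
      else bessel_q_interior \<nu> c t z y)"

definition bessel_kernel :: "real \<Rightarrow> real \<Rightarrow> real \<Rightarrow> real \<Rightarrow> real measure" where
  "bessel_kernel \<nu> c t z =
     density lborel
       (\<lambda>y. ennreal (indicator {0<..} y * (bessel_q \<nu> c t z y * bessel_speed_density \<nu> c y)))"

text \<open>A Bessel process with index \<open>\<nu>\<close> and drift \<open>c\<close> started from \<open>x\<close>: the continuous
  \<open>{0..}\<close>-valued process, indexed by \<open>t \<ge> 0\<close>, that is Markov for its own filtration with the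
  above transition kernels. The kernels also fix the behaviour at 0 (reflection for
  \<open>-1 < \<nu> < 0\<close>), which the differential expression of the generator alone does not.\<close>

locale bessel_process = prob_space M
  for M :: "'w measure" and R :: "real \<Rightarrow> 'w \<Rightarrow> real" and \<nu> c x :: real +
  assumes measurable_R: "0 \<le> t \<Longrightarrow> R t \<in> borel_measurable M"
    and continuous_R: "\<omega> \<in> space M \<Longrightarrow> continuous_on {0..} (\<lambda>t. R t \<omega>)"
    and nonneg_R: "\<omega> \<in> space M \<Longrightarrow> 0 \<le> t \<Longrightarrow> 0 \<le> R t \<omega>"
    and start_R: "AE \<omega> in M. R 0 \<omega> = x"
    and markov_R: "0 \<le> s \<Longrightarrow> 0 < t
       \<Longrightarrow> B \<in> sigma_sets (space M) (\<Union>u\<in>{0..s}. {R u -` A \<inter> space M | A. A \<in> sets borel})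
       \<Longrightarrow> A \<in> sets borel
       \<Longrightarrow> emeasure M (B \<inter> R (s + t) -` A)
             = (\<integral>\<^sup>+\<omega>\<in>B. emeasure (bessel_kernel \<nu> c t (R s \<omega>)) A \<partial>M)"

text \<open>On an unbounded set the real \<open>Sup\<close> is one fixed unspecified value, so a law without atoms
  for this variable entails that the set is almost surely bounded.\<close>

definition last_passage_time :: "(real \<Rightarrow> 'w \<Rightarrow> real) \<Rightarrow> (real \<Rightarrow> real) \<Rightarrow> 'w \<Rightarrow> real" where
  "last_passage_time R f \<omega> =
     (let S = {t. 0 \<le> t \<and> R t \<omega> = f t} in if S = {} then 0 else Sup S)"

definition has_laplace_transform :: "(real \<Rightarrow> real) \<Rightarrow> (real \<Rightarrow> real) \<Rightarrow> bool" where
  "has_laplace_transform \<phi> L \<longleftrightarrow>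
     (\<forall>l\<ge>0. set_integrable lborel {0..} (\<lambda>t. exp (- l * t) * \<phi> t) \<and>
            (LBINT t:{0..}. exp (- l * t) * \<phi> t) = L l)"

definition phi_laplace :: "real \<Rightarrow> real \<Rightarrow> real \<Rightarrow> real \<Rightarrow> real \<Rightarrow> real" where
  "phi_laplace \<nu> a b c l =
     (exp (c\<^sup>2 * b / (4 * a)) * whittaker_M (- l) (\<nu> / 2) (c\<^sup>2 * b / (2 * a)))
     / (exp (b / 4) * whittaker_M (- l) (\<nu> / 2) (b / 2))"

definition passage_density_interior ::
    "real \<Rightarrow> real \<Rightarrow> real \<Rightarrow> real \<Rightarrow> (real \<Rightarrow> real) \<Rightarrow> real \<Rightarrow> real \<Rightarrow> real" where
  "passage_density_interior \<nu> a b c \<phi> x t =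
     \<phi> (ln (1 + b / (a * t))) * (b / (c * t)) * (1 / sqrt (a * t\<^sup>2 + b * t))
       * (exp (- x\<^sup>2 / (2 * t)) / bessel_I \<nu> (c * x))
       * bessel_I \<nu> (x * sqrt (a * t\<^sup>2 + b * t) / t)"

text \<open>At \<open>x = 0\<close> the quotient of Bessel functions is read as its limit.\<close>

definition passage_density ::
    "real \<Rightarrow> real \<Rightarrow> real \<Rightarrow> real \<Rightarrow> (real \<Rightarrow> real) \<Rightarrow> real \<Rightarrow> real \<Rightarrow> real" where
  "passage_density \<nu> a b c \<phi> x t =
     (if x = 0 then Lim (at_right 0) (\<lambda>x'. passage_density_interior \<nu> a b c \<phi> x' t)
      else passage_density_interior \<nu> a b c \<phi> x t)"

text \<open>For \<open>c = 0\<close> the formula for the density is of the form \<open>0/0\<close> as well: as \<open>c \<rightarrow> 0\<close>, the Laplace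
  transform \<open>phi_laplace \<nu> a b c\<close> vanishes like \<open>c powr (\<nu> + 1)\<close>, and so does the denominator
  \<open>c * bessel_I \<nu> (c * x)\<close>. Both definitions below take the limit after extracting this power,
  i.e. at \<open>c = 0\<close> the argument \<open>\<phi>\<close> stands for the limit of \<open>\<phi>\<^sub>c / c powr (\<nu> + 1)\<close>, where \<open>\<phi>\<^sub>c\<close>
  is the function with Laplace transform \<open>phi_laplace \<nu> a b c\<close>.\<close>

definition phi_laplace_driftless :: "real \<Rightarrow> real \<Rightarrow> real \<Rightarrow> real \<Rightarrow> real" where
  "phi_laplace_driftless \<nu> a b l =
     Lim (at_right 0) (\<lambda>c. phi_laplace \<nu> a b c l / c powr (\<nu> + 1))"

definition passage_density_driftless ::
    "real \<Rightarrow> real \<Rightarrow> real \<Rightarrow> (real \<Rightarrow> real) \<Rightarrow> real \<Rightarrow> real \<Rightarrow> real" where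
  "passage_density_driftless \<nu> a b \<phi> x t =
     Lim (at_right 0) (\<lambda>c. passage_density \<nu> a b c (\<lambda>u. c powr (\<nu> + 1) * \<phi> u) x t)"

end

theory Submission
  imports Defs
begin

text \<open>Write \<open>J\<close> for the entire function with \<open>I\<^sub>\<nu>(z) = (z / 2)\<^sup>\<nu> J(z\<^sup>2 / 4)\<close>. The ratio of the transition
  densities of the processes started from \<open>\<xi>\<close> and from \<open>x\<close>, evaluated at \<open>(t, R\<^sub>t)\<close>, is a martingale in
  reversed time, and the last passage time \<open>G\<close> is a stopping time for the reversed filtration. Optional
  stopping evaluates the ratio on the curve, which gives, with \<open>W\<close> a positive function of \<open>G\<close>,
  \<open>E[W exp(-\<xi>\<^sup>2 / (2 G)) J(\<xi>\<^sup>2 (a + b / G) / 4)] = J(c\<^sup>2 \<xi>\<^sup>2 / 4)\<close> for every \<open>\<xi> > 0\<close>.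
  Integrating against \<open>\<eta>\<^bsup>\<lambda>-1\<^esup> exp(-a \<eta> / b)\<close>, \<open>\<eta> = \<xi>\<^sup>2 / 2\<close>, turns both sides into Kummer functions, so
  that the \<open>W\<close>-weighted law of \<open>ln (1 + b / (a G))\<close> has as Laplace transform the ratio of the Kummer
  functions \<open>M(\<lambda>, \<nu> + 1, \<cdot>)\<close> at \<open>c\<^sup>2 b / (2 a)\<close> and \<open>b / 2\<close>. Along vertical lines this ratio decays quadratically, by
  Kummer's differential equation, so the weighted law has a density. It is identified with
  a multiple of \<open>exp((\<nu> + 1) u / 2) \<phi>(u)\<close> by uniqueness of Laplace transforms, and the law of \<open>G\<close> follows by a
  change of variables.\<close>

section \<open>Bessel functions and Gaussian integrals\<close>

text \<open>The shape of the curve makes everything computable: on it R^2 / t^2 = a + b / t, and the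
  factor exp (- a \<eta> / b) completes the exponent, so that t and \<eta> occur only in the product
  (a + b / t) \<eta>. A Mellin integral in \<eta> then leaves a power of a + b / t, which is a
  Laplace kernel in ln (1 + b / (a t)). Optional stopping gives an identity of total mass 1 only if
  nothing is lost at either end of the time axis. The condition sqrt a > c keeps the process below
  the curve at large times, and \<xi> > 0 keeps the process started from \<xi> above it at small
  times. The function \<phi> is not found by analytic inversion, since nothing tells in advance that
  the quotient of Whittaker functions is a Laplace transform. It is read off from the law of G once
  that law is known to have a density, and the decay along vertical lines serves this purpose. The
  function J is finite and positive at 0, unlike the Bessel function itself, so x = 0 and c = 0 are
  treated together with the general case.\<close>

lemma nn_integral_change_of_variables:
  fixes g g' :: "real \<Rightarrow> real" and F :: "real \<Rightarrow> ennreal"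
  assumes S: "S \<in> sets borel" and gS: "g ` S \<in> sets borel"
    and der: "\<And>x. x \<in> S \<Longrightarrow> (g has_field_derivative g' x) (at x within S)"
    and inj: "inj_on g S"
    and [measurable]: "g \<in> borel_measurable borel" "g' \<in> borel_measurable borel" "F \<in> borel_measurable borel"
  shows "(\<integral>\<^sup>+y. F y * indicator (g ` S) y \<partial>lborel) = (\<integral>\<^sup>+x. ennreal \<bar>g' x\<bar> * F (g x) * indicator S x \<partial>lborel)"
proof -
  note S[measurable] gS[measurable]
  \<comment> \<open>Both sides are integrals of F, so it is enough that these two measures agree. On
    sets of finite measure this is the change of variables for absolutely integrable functions,
    applied to the constant 1; bounded intervals then exhaust the line.\<close>
  let ?N1 = "distr (density lborel (\<lambda>x. ennreal \<bar>g' x\<bar> * indicator S x)) borel g"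
  let ?N2 = "density lborel (indicator (g ` S) :: real \<Rightarrow> ennreal)"
  have N1: "emeasure ?N1 A = (\<integral>\<^sup>+x. ennreal \<bar>g' x\<bar> * indicator (S \<inter> g -` A) x \<partial>lborel)"
    if [measurable]: "A \<in> sets borel" for A
  proof -
    have "g -` A \<in> sets borel" by (rule measurable_sets_borel[OF _ that]) simp
    then show ?thesis
      by (auto simp: emeasure_distr emeasure_density intro!: nn_integral_cong split: split_indicator)
  qed
  have N2: "emeasure ?N2 A = emeasure lborel (g ` S \<inter> A)" if [measurable]: "A \<in> sets borel" for A
    by (simp add: emeasure_density indicator_inter_arith[symmetric])
  have fin: "emeasure ?N1 A = emeasure ?N2 A"
    if A[measurable]: "A \<in> sets borel" and f: "emeasure lborel A < \<infinity>" for A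
  proof -
    define T where "T = S \<inter> g -` A"
    have T[measurable]: "T \<in> sets borel" unfolding T_def
      by (rule sets.Int[OF S measurable_sets_borel[OF _ A]]) simp
    have gT: "g ` T = g ` S \<inter> A" unfolding T_def by auto
    have fT: "emeasure lborel (g ` T) < \<infinity>"
      unfolding gT by (rule le_less_trans[OF emeasure_mono f]) auto
    have lT: "g ` T \<in> lmeasurable"
      using fT by (auto simp: fmeasurable_def gT)
    define m where "m = measure lebesgue (g ` T)"
    have "(\<lambda>x. \<bar>g' x\<bar> * 1) absolutely_integrable_on T \<and> integral T (\<lambda>x. \<bar>g' x\<bar> * 1) = m"
    proof (subst has_absolute_integral_change_of_variables_1'[where g=g and f="\<lambda>_. 1"])
      show "T \<in> sets lebesgue" using T by auto
      show "(g has_real_derivative g' x) (at x within T)" if "x \<in> T" for x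
        using der[of x] that by (auto simp: T_def intro: DERIV_subset)
      show "inj_on g T" using inj by (auto simp: T_def inj_on_def)
      show "(\<lambda>_. 1::real) absolutely_integrable_on g ` T \<and> integral (g ` T) (\<lambda>_. 1) = m"
        using lT by (auto simp: m_def lmeasure_integral absolutely_integrable_on_const)
    qed
    then have "((\<lambda>x. \<bar>g' x\<bar>) has_integral m) T"
      by (simp add: has_integral_iff absolutely_integrable_on_def)
    then have "(\<integral>\<^sup>+x. ennreal (indicator T x * \<bar>g' x\<bar>) \<partial>lborel) = ennreal m"
      by (intro nn_integral_has_integral_lebesgue) auto
    moreover have "ennreal m = emeasure lborel (g ` T)"
      unfolding m_def using fT T gT
      by (subst measure_completion) (auto simp: emeasure_eq_ennreal_measure less_top[symmetric])
    moreover have "emeasure ?N1 A = (\<integral>\<^sup>+x. ennreal (indicator T x * \<bar>g' x\<bar>) \<partial>lborel)"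
      unfolding N1[OF A] T_def[symmetric] by (intro nn_integral_cong) (auto split: split_indicator)
    ultimately show ?thesis using N2[OF A] gT by simp
  qed
  have "?N1 = ?N2"
  proof (rule measure_eqI)
    fix A assume "A \<in> sets ?N1"
    then have A[measurable]: "A \<in> sets borel" by simp
    have un: "(\<Union>n. A \<inter> {- real n..real n}) = A"
    proof -
      have "\<exists>n. -real n \<le> x \<and> x \<le> real n" for x :: real
        using real_arch_simple[of "\<bar>x\<bar>"] by (auto simp: abs_le_iff) (metis minus_le_iff)
      then show ?thesis by auto
    qed
    have inc: "incseq (\<lambda>n. A \<inter> {- real n..real n})" by (auto simp: incseq_def)
    have "emeasure ?N1 A = (SUP n. emeasure ?N1 (A \<inter> {- real n..real n}))"
      by (subst SUP_emeasure_incseq[OF _ inc]) (auto simp del: UN_simps simp add: un)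
    also have "\<dots> = (SUP n. emeasure ?N2 (A \<inter> {- real n..real n}))"
    proof (intro SUP_cong refl fin)
      show "emeasure lborel (A \<inter> {- real n..real n}) < \<infinity>" for n
        by (rule le_less_trans[OF emeasure_mono[of _ "{- real n..real n}"]]) auto
    qed auto
    also have "\<dots> = emeasure ?N2 A"
      by (subst SUP_emeasure_incseq[OF _ inc]) (auto simp del: UN_simps simp add: un)
    finally show "emeasure ?N1 A = emeasure ?N2 A" .
  qed simp
  then have "nn_integral ?N1 F = nn_integral ?N2 F" by simp
  then show ?thesis
    by (simp add: nn_integral_distr nn_integral_density mult_ac)
qed

section \<open>The entire part of the modified Bessel function (Bessel-Clifford function)\<close>

definition bessel_clifford :: "real \<Rightarrow> real \<Rightarrow> real" where
  "bessel_clifford \<nu> w = (\<Sum>k. 1 / (fact k * Gamma (\<nu> + real k + 1)) * w ^ k)"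

context
  fixes \<nu> :: real
  assumes nu: "\<nu> > -1"
begin

lemma Gamma_shift_pos: "Gamma (\<nu> + real k + 1) > 0"
  using nu by (intro Gamma_real_pos) (simp add: add_pos_nonneg algebra_simps)

lemma Gamma_shift_Suc: "Gamma (\<nu> + real (Suc k) + 1) = (\<nu> + real k + 1) * Gamma (\<nu> + real k + 1)"
proof -
  have "\<nu> + real k + 1 > 0" using nu by (simp add: algebra_simps)
  then have "\<nu> + real k + 1 \<notin> \<int>\<^sub>\<le>\<^sub>0" by (auto elim!: nonpos_Ints_cases)
  then show ?thesis using Gamma_plus1[of "\<nu> + real k + 1"] by (simp add: add_ac)
qed

text \<open>Dropping the factorial leaves a convergent series that does two jobs: it dominates the
  series of \<open>bessel_clifford\<close>, and its sum is the constant in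
  \<open>bessel_clifford_exp_bound\<close>.\<close>

lemma summable_power_over_Gamma: "summable (\<lambda>k. \<kappa> ^ k / Gamma (\<nu> + real k + 1))"
proof (rule summable_ratio_test[where c = "1/2" and N = "nat \<lceil>2 * \<bar>\<kappa>\<bar>\<rceil> + 1"])
  fix k assume "nat \<lceil>2 * \<bar>\<kappa>\<bar>\<rceil> + 1 \<le> k"
  then have k: "2 * \<bar>\<kappa>\<bar> + 1 \<le> real k" by linarith
  then have pos: "\<nu> + real k + 1 > 0" and "\<bar>\<kappa>\<bar> / (\<nu> + real k + 1) \<le> 1/2"
    using nu by (auto simp: divide_simps)
  moreover have "norm (\<kappa> ^ Suc k / Gamma (\<nu> + real (Suc k) + 1))
     = \<bar>\<kappa>\<bar> / (\<nu> + real k + 1) * norm (\<kappa> ^ k / Gamma (\<nu> + real k + 1))"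
    unfolding Gamma_shift_Suc using pos Gamma_shift_pos[of k] by (simp add: abs_mult power_abs)
  ultimately show "norm (\<kappa> ^ Suc k / Gamma (\<nu> + real (Suc k) + 1))
     \<le> 1/2 * norm (\<kappa> ^ k / Gamma (\<nu> + real k + 1))"
    by (metis mult_right_mono norm_ge_zero)
qed simp

lemma summable_bessel_clifford: "summable (\<lambda>k. 1 / (fact k * Gamma (\<nu> + real k + 1)) * w ^ k)"
proof (rule summable_comparison_test[OF _ summable_power_over_Gamma[of "\<bar>w\<bar>"]], intro exI allI impI)
  fix n :: nat
  have "\<bar>w\<bar> ^ n / (fact n * Gamma (\<nu> + real n + 1)) \<le> \<bar>w\<bar> ^ n / (1 * Gamma (\<nu> + real n + 1))"
    using Gamma_shift_pos[of n] by (intro divide_left_mono mult_right_mono mult_pos_pos) auto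
  then show "norm (1 / (fact n * Gamma (\<nu> + real n + 1)) * w ^ n) \<le> \<bar>w\<bar> ^ n / Gamma (\<nu> + real n + 1)"
    using Gamma_shift_pos[of n] by (simp add: abs_mult power_abs)
qed

lemma continuous_bessel_clifford: "continuous_on UNIV (bessel_clifford \<nu>)"
  unfolding bessel_clifford_def[abs_def]
  by (intro continuous_at_imp_continuous_on ballI isCont_powser_converges_everywhere summable_bessel_clifford)

lemma measurable_bessel_clifford[measurable]: "bessel_clifford \<nu> \<in> borel_measurable borel"
  by (rule borel_measurable_continuous_onI[OF continuous_bessel_clifford])

lemma bessel_clifford_0: "bessel_clifford \<nu> 0 = 1 / Gamma (\<nu> + 1)"
  unfolding bessel_clifford_def by (subst powser_zero) simp

lemma bessel_clifford_mono:
  assumes "0 \<le> v" "v \<le> w" shows "bessel_clifford \<nu> v \<le> bessel_clifford \<nu> w"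
  unfolding bessel_clifford_def using assms Gamma_shift_pos
  by (intro suminf_le summable_bessel_clifford mult_left_mono power_mono) (auto simp: less_imp_le)

lemma bessel_clifford_pos: assumes "0 \<le> w" shows "0 < bessel_clifford \<nu> w"
proof -
  have "0 < 1 / Gamma (\<nu> + 1)" using Gamma_shift_pos[of 0] by simp
  then show ?thesis
    using bessel_clifford_mono[OF order.refl assms] unfolding bessel_clifford_0 by linarith
qed

lemma tendsto_bessel_clifford [tendsto_intros]:
  "(f \<longlongrightarrow> l) F \<Longrightarrow> ((\<lambda>x. bessel_clifford \<nu> (f x)) \<longlongrightarrow> bessel_clifford \<nu> l) F"
  using continuous_bessel_clifford by (auto simp: continuous_on_eq_continuous_at intro: isCont_tendsto_compose)

lemma continuous_on_bessel_clifford [continuous_intros]: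
  "continuous_on A f \<Longrightarrow> continuous_on A (\<lambda>x. bessel_clifford \<nu> (f x))"
  by (rule continuous_on_compose2[OF continuous_bessel_clifford]) auto

text \<open>Each of the numbers \<open>\<kappa> ^ k / Gamma (\<nu> + real k + 1)\<close> is at most
  their sum, so the series is dominated by a multiple of that of exp v. The bound is crude, but it
  makes exp (- v) J(\<kappa> v) bounded, which is what the passage to the limit in
  \<open>emeasure_log_law\<close> uses.\<close>

lemma bessel_clifford_exp_bound:
  assumes "0 \<le> \<kappa>"
  obtains B where "\<And>v. 0 \<le> v \<Longrightarrow> bessel_clifford \<nu> (\<kappa> * v) \<le> B * exp v"
proof -
  let ?d = "\<lambda>k. \<kappa> ^ k / Gamma (\<nu> + real k + 1)"
  have d0: "?d k \<ge> 0" for k using assms Gamma_shift_pos[of k] by (simp add: less_imp_le)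
  have "bessel_clifford \<nu> (\<kappa> * v) \<le> suminf ?d * exp v" if v: "0 \<le> v" for v
  proof -
    have ex: "(\<lambda>k. v ^ k / fact k) sums exp v" using exp_converges[of v] by (simp add: field_simps)
    have "bessel_clifford \<nu> (\<kappa> * v) = (\<Sum>k. ?d k * (v ^ k / fact k))"
      unfolding bessel_clifford_def by (simp add: field_simps power_mult_distrib)
    also have "\<dots> \<le> (\<Sum>k. suminf ?d * (v ^ k / fact k))"
    proof (intro suminf_le)
      show "?d n * (v ^ n / fact n) \<le> suminf ?d * (v ^ n / fact n)" for n
        using sum_le_suminf[OF summable_power_over_Gamma[of \<kappa>], of "{n}"] d0 v
        by (intro mult_right_mono) auto
      show "summable (\<lambda>k. ?d k * (v ^ k / fact k))"
        using summable_bessel_clifford[of "\<kappa> * v"] by (simp add: field_simps power_mult_distrib)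
      show "summable (\<lambda>k. suminf ?d * (v ^ k / fact k))"
        using ex by (intro summable_mult) (auto simp: sums_iff)
    qed
    also have "\<dots> = suminf ?d * exp v" using ex by (subst suminf_mult) (auto simp: sums_iff)
    finally show ?thesis .
  qed
  then show ?thesis by (rule that)
qed

lemma bessel_I_eq_clifford:
  assumes "0 < z"
  shows "bessel_I \<nu> z = (z / 2) powr \<nu> * bessel_clifford \<nu> (z\<^sup>2 / 4)"
proof -
  have "(z / 2) powr (\<nu> + 2 * real k) / (fact k * Gamma (\<nu> + real k + 1))
      = (z / 2) powr \<nu> * (1 / (fact k * Gamma (\<nu> + real k + 1)) * (z\<^sup>2 / 4) ^ k)" for k
  proof -
    have "(z / 2) powr (2 * real k) = (z\<^sup>2 / 4) ^ k"
      using assms powr_realpow[of "z / 2" "2 * k"] by (simp add: power_mult power_divide)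
    then show ?thesis by (simp add: powr_add)
  qed
  then have "bessel_I \<nu> z = (\<Sum>k. (z / 2) powr \<nu> * (1 / (fact k * Gamma (\<nu> + real k + 1)) * (z\<^sup>2 / 4) ^ k))"
    unfolding bessel_I_def by (intro arg_cong[where f = suminf] ext)
  also have "\<dots> = (z / 2) powr \<nu> * bessel_clifford \<nu> (z\<^sup>2 / 4)"
    unfolding bessel_clifford_def by (rule suminf_mult[OF summable_bessel_clifford])
  finally show ?thesis .
qed

end

section \<open>Gaussian moments and Weber's second exponential integral\<close>

lemma nn_integral_gaussian_moment:
  fixes \<mu> p :: real
  assumes mu: "0 < \<mu>" and p: "0 < p"
  shows "(\<integral>\<^sup>+y. ennreal (y powr (2 * \<mu> - 1) * exp (- p * y\<^sup>2)) * indicator {0<..} y \<partial>lborel)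
    = ennreal (Gamma \<mu> / (2 * p powr \<mu>))"
proof -
  have img: "(\<lambda>y. p * y\<^sup>2) ` {0<..} = {0<..}"
  proof
    show "{0<..} \<subseteq> (\<lambda>y. p * y\<^sup>2) ` {0<..}"
    proof
      fix t :: real assume "t \<in> {0<..}"
      then have "t = p * (sqrt (t / p))\<^sup>2" "sqrt (t / p) \<in> {0<..}" using p by auto
      then show "t \<in> (\<lambda>y. p * y\<^sup>2) ` {0<..}" by blast
    qed
  qed (use p in auto)
  have "ennreal (Gamma \<mu>) = (\<integral>\<^sup>+t. ennreal (indicator {0..} t * t powr (\<mu> - 1) / exp t) \<partial>lborel)"
    by (rule Gamma_conv_nn_integral_real[OF mu])
  also have "\<dots> = (\<integral>\<^sup>+t. ennreal (t powr (\<mu> - 1) * exp (- t)) * indicator {0<..} t \<partial>lborel)"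
    by (intro nn_integral_cong) (auto split: split_indicator simp: exp_minus field_simps)
  also have "\<dots> = (\<integral>\<^sup>+y. ennreal \<bar>2 * p * y\<bar> * ennreal ((p * y\<^sup>2) powr (\<mu> - 1) * exp (- (p * y\<^sup>2))) * indicator {0<..} y \<partial>lborel)"
    by (rule nn_integral_change_of_variables[of "{0<..}" "\<lambda>y. p * y\<^sup>2" "\<lambda>y. 2 * p * y"
          "\<lambda>t. ennreal (t powr (\<mu> - 1) * exp (- t))", unfolded img])
       (use p in \<open>auto intro!: derivative_eq_intros simp: inj_on_def power2_eq_iff\<close>)
  also have "\<dots> = (\<integral>\<^sup>+y. ennreal (2 * p powr \<mu>) * (ennreal (y powr (2 * \<mu> - 1) * exp (- p * y\<^sup>2)) * indicator {0<..} y) \<partial>lborel)"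
  proof (intro nn_integral_cong)
    fix y :: real
    have "2 * p * y * ((p * y\<^sup>2) powr (\<mu> - 1) * exp (- (p * y\<^sup>2))) = 2 * p powr \<mu> * (y powr (2 * \<mu> - 1) * exp (- p * y\<^sup>2))"
      if y: "0 < y"
    proof -
      have "y\<^sup>2 = y powr 2" using y by simp
      then have 1: "(p * y\<^sup>2) powr (\<mu> - 1) = p powr (\<mu> - 1) * y powr (2 * (\<mu> - 1))"
        using y p by (simp only: powr_mult powr_powr)
      have 2: "p * p powr (\<mu> - 1) = p powr \<mu>" using powr_mult_base[of p "\<mu> - 1"] p by simp
      have 3: "y * y powr (2 * (\<mu> - 1)) = y powr (2 * \<mu> - 1)"
        using powr_mult_base[of y "2 * (\<mu> - 1)"] y by (simp add: algebra_simps)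
      show ?thesis unfolding 1 2[symmetric] 3[symmetric] by simp
    qed
    then show "ennreal \<bar>2 * p * y\<bar> * ennreal ((p * y\<^sup>2) powr (\<mu> - 1) * exp (- (p * y\<^sup>2))) * indicator {0<..} y
      = ennreal (2 * p powr \<mu>) * (ennreal (y powr (2 * \<mu> - 1) * exp (- p * y\<^sup>2)) * indicator {0<..} y)"
      using p by (simp split: split_indicator add: ennreal_mult[symmetric])
  qed
  also have "\<dots> = ennreal (2 * p powr \<mu>) * (\<integral>\<^sup>+y. ennreal (y powr (2 * \<mu> - 1) * exp (- p * y\<^sup>2)) * indicator {0<..} y \<partial>lborel)"
    by (rule nn_integral_cmult) measurable
  finally have *: "ennreal (Gamma \<mu>) = ennreal (2 * p powr \<mu>) * (\<integral>\<^sup>+y. ennreal (y powr (2 * \<mu> - 1) * exp (- p * y\<^sup>2)) * indicator {0<..} y \<partial>lborel)" .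
  have "ennreal (Gamma \<mu> / (2 * p powr \<mu>)) = ennreal (Gamma \<mu>) / ennreal (2 * p powr \<mu>)"
    using mu p by (subst divide_ennreal) auto
  also have "\<dots> = (\<integral>\<^sup>+y. ennreal (y powr (2 * \<mu> - 1) * exp (- p * y\<^sup>2)) * indicator {0<..} y \<partial>lborel)"
    unfolding * using p by (subst mult.commute, intro ennreal_mult_divide_eq) auto
  finally show ?thesis ..
qed

context
  fixes \<nu> :: real
  assumes nu: "\<nu> > -1"
begin

lemma gbinomial_Gamma_shift:
  "((\<nu> + real (n + m)) gchoose m) = Gamma (\<nu> + real (n + m) + 1) / (fact m * Gamma (\<nu> + real n + 1))"
proof -
  have "\<nu> + real n + 1 \<notin> \<int>\<^sub>\<le>\<^sub>0" using nu by (auto elim!: nonpos_Ints_cases)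
  then have "pochhammer (\<nu> + real n + 1) m = Gamma (\<nu> + real n + 1 + real m) / Gamma (\<nu> + real n + 1)"
    by (rule pochhammer_Gamma)
  moreover have "((\<nu> + real (n + m)) gchoose m) = pochhammer (\<nu> + real (n + m) - real m + 1) m / fact m"
    by (rule gbinomial_pochhammer')
  ultimately show ?thesis by (simp add: add_ac)
qed

text \<open>Vandermonde's identity for the binomial coefficient of j + (\<nu> + k) over k. On the
  left stands what Gaussian moments make of the product of two Clifford series, on the right the
  coefficient of A^j B^k in exp (A + B) J(A B).\<close>

lemma bessel_clifford_product_coeff:
  "Gamma (\<nu> + real (j + k) + 1) / (fact j * Gamma (\<nu> + real j + 1)) / (fact k * Gamma (\<nu> + real k + 1))
   = (\<Sum>n\<le>k. if n \<le> j then 1 / (fact n * fact (j - n) * fact (k - n) * Gamma (\<nu> + real n + 1)) else 0)"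
proof -
  have "Gamma (\<nu> + real (j + k) + 1) / (fact k * Gamma (\<nu> + real j + 1)) = ((\<nu> + real (j + k)) gchoose k)"
    by (rule gbinomial_Gamma_shift[symmetric])
  also have "\<dots> = (real j + (\<nu> + real k)) gchoose k" by (simp add: add_ac)
  also have "\<dots> = (\<Sum>n\<le>k. (real j gchoose n) * ((\<nu> + real k) gchoose (k - n)))"
    unfolding gbinomial_Vandermonde[symmetric] by (simp add: atMost_atLeast0)
  also have "\<dots> = (\<Sum>n\<le>k. if n \<le> j then fact j / (fact n * fact (j - n)) *
      (Gamma (\<nu> + real k + 1) / (fact (k - n) * Gamma (\<nu> + real n + 1))) else 0)"
  proof (intro sum.cong refl)
    fix n assume n: "n \<in> {..k}"
    have "(real j gchoose n) = (if n \<le> j then fact j / (fact n * fact (j - n)) else 0)"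
      by (auto simp: binomial_gbinomial[symmetric] binomial_fact)
    moreover have "((\<nu> + real k) gchoose (k - n)) = Gamma (\<nu> + real k + 1) / (fact (k - n) * Gamma (\<nu> + real n + 1))"
      using gbinomial_Gamma_shift[of n "k - n"] n by simp
    ultimately show "(real j gchoose n) * ((\<nu> + real k) gchoose (k - n)) = (if n \<le> j then fact j / (fact n * fact (j - n)) *
      (Gamma (\<nu> + real k + 1) / (fact (k - n) * Gamma (\<nu> + real n + 1))) else 0)" by simp
  qed
  finally have *: "Gamma (\<nu> + real (j + k) + 1) / (fact k * Gamma (\<nu> + real j + 1)) = \<dots>" .
  have "Gamma (\<nu> + real (j + k) + 1) / (fact j * Gamma (\<nu> + real j + 1)) / (fact k * Gamma (\<nu> + real k + 1))
    = Gamma (\<nu> + real (j + k) + 1) / (fact k * Gamma (\<nu> + real j + 1)) / (fact j * Gamma (\<nu> + real k + 1))"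
    by simp
  also have "\<dots> = (\<Sum>n\<le>k. if n \<le> j then 1 / (fact n * fact (j - n) * fact (k - n) * Gamma (\<nu> + real n + 1)) else 0)"
    unfolding * sum_divide_distrib using Gamma_shift_pos[OF nu, of k]
    by (intro sum.cong refl) (auto simp: field_simps)
  finally show ?thesis .
qed

lemma ennreal_bessel_clifford:
  assumes "0 \<le> w"
  shows "ennreal (bessel_clifford \<nu> w) = (\<Sum>k. ennreal (1 / (fact k * Gamma (\<nu> + real k + 1)) * w ^ k))"
  unfolding bessel_clifford_def using assms Gamma_shift_pos[OF nu]
  by (intro suminf_ennreal2[symmetric] summable_bessel_clifford[OF nu]) (auto simp: less_imp_le)

lemma ennreal_exp: "0 \<le> w \<Longrightarrow> ennreal (exp w) = (\<Sum>k. ennreal (w ^ k / fact k))"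
  using exp_converges[of w] by (subst suminf_ennreal2) (auto simp: sums_iff field_simps)

lemma suminf_ennreal_guard: "(\<Sum>k. if n \<le> k then f (k - n) else 0) = (\<Sum>k. f k :: ennreal)"
  using suminf_offset[of "\<lambda>k. if n \<le> k then f (k - n) else 0" n] by simp

lemma suminf_ennreal_swap: "(\<Sum>i. \<Sum>j. f i j) = (\<Sum>j. \<Sum>i. f i j :: ennreal)"
  using nn_integral_suminf[of "\<lambda>j i. f i j" "count_space UNIV"]
  by (simp add: nn_integral_count_space_nat)

text \<open>The triple series of J(A B) exp A exp B is regrouped by the total exponents j = n + i of
  A and k = n + l of B. All terms are nonnegative, so in \<open>ennreal\<close> every interchange of
  summations is free.\<close>

lemma bessel_clifford_convolution:
  assumes A: "0 \<le> A" and B: "0 \<le> B"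
  shows "(\<Sum>j. \<Sum>k. ennreal (Gamma (\<nu> + real (j + k) + 1) / (fact j * Gamma (\<nu> + real j + 1)) / (fact k * Gamma (\<nu> + real k + 1)) * (A ^ j * B ^ k)))
    = ennreal (exp (A + B) * bessel_clifford \<nu> (A * B))"
proof -
  define G where "G n i l = ennreal ((A * B) ^ n / (fact n * Gamma (\<nu> + real n + 1)) * (A ^ i / fact i) * (B ^ l / fact l))" for n i l
  have "ennreal (Gamma (\<nu> + real (j + k) + 1) / (fact j * Gamma (\<nu> + real j + 1)) / (fact k * Gamma (\<nu> + real k + 1)) * (A ^ j * B ^ k))
    = (\<Sum>n. if n \<le> j then if n \<le> k then G n (j - n) (k - n) else 0 else 0)" for j k
  proof -
    have "(\<Sum>n. if n \<le> j then if n \<le> k then G n (j - n) (k - n) else 0 else 0)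
      = (\<Sum>n\<le>k. if n \<le> j then if n \<le> k then G n (j - n) (k - n) else 0 else 0)"
      by (rule suminf_finite) auto
    also have "\<dots> = (\<Sum>n\<le>k. ennreal ((if n \<le> j then 1 / (fact n * fact (j - n) * fact (k - n) * Gamma (\<nu> + real n + 1)) else 0) * (A ^ j * B ^ k)))"
    proof (intro sum.cong refl)
      fix n assume n: "n \<in> {..k}"
      have "A ^ j * B ^ k = (A * B) ^ n * A ^ (j - n) * B ^ (k - n)" if "n \<le> j"
      proof -
        have "A ^ j = A ^ n * A ^ (j - n)" "B ^ k = B ^ n * B ^ (k - n)"
          using n that by (auto simp flip: power_add)
        then show ?thesis by (simp add: power_mult_distrib)
      qed
      then show "(if n \<le> j then if n \<le> k then G n (j - n) (k - n) else 0 else 0) =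
        ennreal ((if n \<le> j then 1 / (fact n * fact (j - n) * fact (k - n) * Gamma (\<nu> + real n + 1)) else 0) * (A ^ j * B ^ k))"
        using n by (auto simp: G_def intro!: arg_cong[where f = ennreal])
    qed
    also have "\<dots> = ennreal ((\<Sum>n\<le>k. if n \<le> j then 1 / (fact n * fact (j - n) * fact (k - n) * Gamma (\<nu> + real n + 1)) else 0) * (A ^ j * B ^ k))"
      unfolding sum_distrib_right using A B Gamma_shift_pos[OF nu]
      by (intro sum_ennreal) (auto simp: less_imp_le)
    finally show ?thesis unfolding bessel_clifford_product_coeff by simp
  qed
  then have "(\<Sum>j. \<Sum>k. ennreal (Gamma (\<nu> + real (j + k) + 1) / (fact j * Gamma (\<nu> + real j + 1)) / (fact k * Gamma (\<nu> + real k + 1)) * (A ^ j * B ^ k)))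
    = (\<Sum>j. \<Sum>k. \<Sum>n. if n \<le> j then if n \<le> k then G n (j - n) (k - n) else 0 else 0)"
    by simp
  also have "\<dots> = (\<Sum>j. \<Sum>n. \<Sum>k. if n \<le> j then if n \<le> k then G n (j - n) (k - n) else 0 else 0)"
    by (intro arg_cong[where f = suminf] ext suminf_ennreal_swap)
  also have "\<dots> = (\<Sum>n. \<Sum>j. \<Sum>k. if n \<le> j then if n \<le> k then G n (j - n) (k - n) else 0 else 0)"
    by (rule suminf_ennreal_swap)
  also have "\<dots> = (\<Sum>n. \<Sum>j. if n \<le> j then (\<Sum>l. G n (j - n) l) else 0)"
    by (intro arg_cong[where f = suminf] ext) (simp add: suminf_ennreal_guard)
  also have "\<dots> = (\<Sum>n. \<Sum>i. \<Sum>l. G n i l)"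
    by (simp add: suminf_ennreal_guard[where f = "\<lambda>i. \<Sum>l. G _ i l"])
  also have "\<dots> = (\<Sum>n. \<Sum>i. \<Sum>l. ennreal (1 / (fact n * Gamma (\<nu> + real n + 1)) * (A * B) ^ n) * (ennreal (A ^ i / fact i) * ennreal (B ^ l / fact l)))"
    unfolding G_def using A B Gamma_shift_pos[OF nu]
    by (intro arg_cong[where f = suminf] ext) (auto simp: ennreal_mult[symmetric] less_imp_le)
  also have "\<dots> = ennreal (bessel_clifford \<nu> (A * B)) * (ennreal (exp A) * ennreal (exp B))"
    using A B by (simp add: ennreal_bessel_clifford ennreal_exp del: ennreal_suminf_cmult add: ennreal_suminf_cmult ennreal_suminf_multc)
  finally show ?thesis
    using A B bessel_clifford_pos[OF nu, of "A * B"] by (simp add: exp_add ennreal_mult mult_ac less_imp_le)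
qed

text \<open>Weber's second exponential integral: both Clifford series are expanded, integrated term
  by term and resummed by \<open>bessel_clifford_convolution\<close>. This one integral gives the
  normalisation, the exponential moments and the semigroup property of the transition
  densities.\<close>

lemma nn_integral_weber:
  assumes p: "0 < p" and al: "0 \<le> \<alpha>" and ga: "0 \<le> \<gamma>"
  shows "(\<integral>\<^sup>+y. ennreal (y powr (2 * \<nu> + 1) * exp (- p * y\<^sup>2) * bessel_clifford \<nu> (\<alpha> * y\<^sup>2) * bessel_clifford \<nu> (\<gamma> * y\<^sup>2)) * indicator {0<..} y \<partial>lborel)
    = ennreal (exp ((\<alpha> + \<gamma>) / p) * bessel_clifford \<nu> (\<alpha> * \<gamma> / p\<^sup>2) / (2 * p powr (\<nu> + 1)))"
proof -
  define d where "d k = 1 / (fact k * Gamma (\<nu> + real k + 1))" for k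
  have d: "0 \<le> d k" for k using Gamma_shift_pos[OF nu, of k] by (simp add: d_def less_imp_le)
  have "(\<integral>\<^sup>+y. ennreal (y powr (2 * \<nu> + 1) * exp (- p * y\<^sup>2) * bessel_clifford \<nu> (\<alpha> * y\<^sup>2) * bessel_clifford \<nu> (\<gamma> * y\<^sup>2)) * indicator {0<..} y \<partial>lborel)
     = (\<integral>\<^sup>+y. (\<Sum>j. \<Sum>k. ennreal (d j * d k * (\<alpha> ^ j * \<gamma> ^ k)) * (ennreal (y powr (2 * (\<nu> + real (j + k) + 1) - 1) * exp (- p * y\<^sup>2)) * indicator {0<..} y)) \<partial>lborel)"
  proof (intro nn_integral_cong)
    fix y :: real
    show "ennreal (y powr (2 * \<nu> + 1) * exp (- p * y\<^sup>2) * bessel_clifford \<nu> (\<alpha> * y\<^sup>2) * bessel_clifford \<nu> (\<gamma> * y\<^sup>2)) * indicator {0<..} y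
      = (\<Sum>j. \<Sum>k. ennreal (d j * d k * (\<alpha> ^ j * \<gamma> ^ k)) * (ennreal (y powr (2 * (\<nu> + real (j + k) + 1) - 1) * exp (- p * y\<^sup>2)) * indicator {0<..} y))"
    proof (cases "0 < y")
      case y: True
      have pw: "y powr (2 * (\<nu> + real (j + k) + 1) - 1) = y powr (2 * \<nu> + 1) * ((y\<^sup>2) ^ j * (y\<^sup>2) ^ k)" for j k
      proof -
        have "y powr (2 * (\<nu> + real (j + k) + 1) - 1) = y powr (2 * \<nu> + 1 + real (2 * (j + k)))"
          by (rule arg_cong) (simp add: algebra_simps)
        also have "\<dots> = y powr (2 * \<nu> + 1) * y ^ (2 * (j + k))"
          using y by (subst powr_add) (simp add: powr_realpow del: of_nat_mult of_nat_add)
        finally show ?thesis by (simp add: power_mult power_add)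
      qed
      have "ennreal (y powr (2 * \<nu> + 1) * exp (- p * y\<^sup>2) * bessel_clifford \<nu> (\<alpha> * y\<^sup>2) * bessel_clifford \<nu> (\<gamma> * y\<^sup>2))
        = ennreal (y powr (2 * \<nu> + 1) * exp (- p * y\<^sup>2)) * (ennreal (bessel_clifford \<nu> (\<alpha> * y\<^sup>2)) * ennreal (bessel_clifford \<nu> (\<gamma> * y\<^sup>2)))"
        using bessel_clifford_pos[OF nu, of "\<alpha> * y\<^sup>2"] bessel_clifford_pos[OF nu, of "\<gamma> * y\<^sup>2"] al ga
        by (simp add: ennreal_mult mult_ac less_imp_le)
      also have "\<dots> = (\<Sum>j. \<Sum>k. ennreal (y powr (2 * \<nu> + 1) * exp (- p * y\<^sup>2)) * (ennreal (d j * (\<alpha> * y\<^sup>2) ^ j) * ennreal (d k * (\<gamma> * y\<^sup>2) ^ k)))"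
        using al ga by (simp add: ennreal_bessel_clifford d_def[symmetric])
      also have "\<dots> = (\<Sum>j. \<Sum>k. ennreal (d j * d k * (\<alpha> ^ j * \<gamma> ^ k)) * (ennreal (y powr (2 * (\<nu> + real (j + k) + 1) - 1) * exp (- p * y\<^sup>2))))"
        unfolding pw using al ga d by (intro arg_cong[where f = suminf] ext)
          (simp add: ennreal_mult[symmetric] power_mult_distrib mult_ac)
      finally show ?thesis using y by simp
    qed simp
  qed
  also have "\<dots> = (\<Sum>j. \<Sum>k. ennreal (d j * d k * (\<alpha> ^ j * \<gamma> ^ k)) * ennreal (Gamma (\<nu> + real (j + k) + 1) / (2 * p powr (\<nu> + real (j + k) + 1))))"
  proof -
    have "\<nu> + real (j + k) + 1 > 0" for j k using nu by (simp add: algebra_simps)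
    note m = nn_integral_gaussian_moment[OF this p]
    have "(\<integral>\<^sup>+y. ennreal (d j * d k * (\<alpha> ^ j * \<gamma> ^ k)) * (ennreal (y powr (2 * (\<nu> + real (j + k) + 1) - 1) * exp (- p * y\<^sup>2)) * indicator {0<..} y) \<partial>lborel)
      = ennreal (d j * d k * (\<alpha> ^ j * \<gamma> ^ k)) * ennreal (Gamma (\<nu> + real (j + k) + 1) / (2 * p powr (\<nu> + real (j + k) + 1)))" for j k
      unfolding m[of j k, symmetric] by (rule nn_integral_cmult) measurable
    then show ?thesis
      by (subst nn_integral_suminf, measurable, subst nn_integral_suminf, measurable)
  qed
  also have "\<dots> = (\<Sum>j. \<Sum>k. ennreal (1 / (2 * p powr (\<nu> + 1))) * ennreal (Gamma (\<nu> + real (j + k) + 1) / (fact j * Gamma (\<nu> + real j + 1)) / (fact k * Gamma (\<nu> + real k + 1)) * ((\<alpha> / p) ^ j * (\<gamma> / p) ^ k)))"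
  proof (intro arg_cong[where f = suminf] ext)
    fix j k
    have "p powr (\<nu> + real (j + k) + 1) = p powr (\<nu> + 1) * (p ^ j * p ^ k)"
    proof -
      have "p powr (\<nu> + real (j + k) + 1) = p powr ((\<nu> + 1) + real (j + k))" by (simp add: add_ac)
      also have "\<dots> = p powr (\<nu> + 1) * p ^ (j + k)"
        using p by (subst powr_add) (simp add: powr_realpow del: of_nat_add)
      finally show ?thesis by (simp add: power_add)
    qed
    then have eq: "d j * d k * (\<alpha> ^ j * \<gamma> ^ k) * (Gamma (\<nu> + real (j + k) + 1) / (2 * p powr (\<nu> + real (j + k) + 1)))
      = 1 / (2 * p powr (\<nu> + 1)) * (Gamma (\<nu> + real (j + k) + 1) / (fact j * Gamma (\<nu> + real j + 1)) / (fact k * Gamma (\<nu> + real k + 1)) * ((\<alpha> / p) ^ j * (\<gamma> / p) ^ k))"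
      by (simp only: d_def power_divide times_divide_times_eq mult_1 times_divide_eq_left times_divide_eq_right divide_divide_eq_left mult_ac)
    show "ennreal (d j * d k * (\<alpha> ^ j * \<gamma> ^ k)) * ennreal (Gamma (\<nu> + real (j + k) + 1) / (2 * p powr (\<nu> + real (j + k) + 1)))
      = ennreal (1 / (2 * p powr (\<nu> + 1))) * ennreal (Gamma (\<nu> + real (j + k) + 1) / (fact j * Gamma (\<nu> + real j + 1)) / (fact k * Gamma (\<nu> + real k + 1)) * ((\<alpha> / p) ^ j * (\<gamma> / p) ^ k))"
    proof (subst (1 2) ennreal_mult[symmetric])
      have G: "0 \<le> Gamma (\<nu> + real i + 1)" for i using Gamma_shift_pos[OF nu, of i] by simp
      show "0 \<le> Gamma (\<nu> + real (j + k) + 1) / (fact j * Gamma (\<nu> + real j + 1)) / (fact k * Gamma (\<nu> + real k + 1)) * ((\<alpha> / p) ^ j * (\<gamma> / p) ^ k)"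
        "0 \<le> Gamma (\<nu> + real (j + k) + 1) / (2 * p powr (\<nu> + real (j + k) + 1))"
        using al ga p by (intro mult_nonneg_nonneg divide_nonneg_nonneg G zero_le_power; simp)+
    qed (use al ga p d eq in simp_all)
  qed
  also have "\<dots> = ennreal (1 / (2 * p powr (\<nu> + 1))) * (\<Sum>j. \<Sum>k. ennreal (Gamma (\<nu> + real (j + k) + 1) / (fact j * Gamma (\<nu> + real j + 1)) / (fact k * Gamma (\<nu> + real k + 1)) * ((\<alpha> / p) ^ j * (\<gamma> / p) ^ k)))"
    by simp
  also have "\<dots> = ennreal (1 / (2 * p powr (\<nu> + 1))) * ennreal (exp (\<alpha> / p + \<gamma> / p) * bessel_clifford \<nu> (\<alpha> / p * (\<gamma> / p)))"
    using al ga p by (subst bessel_clifford_convolution) auto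
  also have "\<dots> = ennreal (exp ((\<alpha> + \<gamma>) / p) * bessel_clifford \<nu> (\<alpha> * \<gamma> / p\<^sup>2) / (2 * p powr (\<nu> + 1)))"
    using p bessel_clifford_pos[OF nu, of "\<alpha> / p * (\<gamma> / p)"] al ga
    by (subst ennreal_mult[symmetric]) (auto simp: add_divide_distrib power2_eq_square less_imp_le)
  finally show ?thesis .
qed

end

section \<open>The transition densities\<close>

text \<open>The product of \<open>bessel_q\<close> and \<open>bessel_speed_density\<close>. All
  powers of z and of c have cancelled, so the expression has no singularity at z = 0 or c = 0. It is
  the driftless density transformed by the space-time harmonic function exp (- c^2 t / 2) J(c^2 y^2
  / 4).\<close>

definition bessel_density :: "real \<Rightarrow> real \<Rightarrow> real \<Rightarrow> real \<Rightarrow> real \<Rightarrow> real" where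
  "bessel_density \<nu> c t z y =
     y powr (2 * \<nu> + 1) * exp (- (c\<^sup>2 * t / 2) - (z\<^sup>2 + y\<^sup>2) / (2 * t))
     * bessel_clifford \<nu> (z\<^sup>2 * y\<^sup>2 / (4 * t\<^sup>2)) * bessel_clifford \<nu> (c\<^sup>2 * y\<^sup>2 / 4)
     / (t * (2 * t) powr \<nu> * bessel_clifford \<nu> (c\<^sup>2 * z\<^sup>2 / 4))"

context
  fixes \<nu> :: real
  assumes nu: "\<nu> > -1"
begin

lemma measurable_bessel_density:
  assumes [measurable]: "f \<in> borel_measurable N" "g \<in> borel_measurable N"
  shows "(\<lambda>x. bessel_density \<nu> c t (f x) (g x)) \<in> borel_measurable N"
proof -
  note [measurable] = measurable_bessel_clifford[OF nu]
  show ?thesis unfolding bessel_density_def by measurable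
qed

lemma bessel_density_nonneg: "0 < t \<Longrightarrow> 0 \<le> bessel_density \<nu> c t z y"
  unfolding bessel_density_def by (simp add: bessel_clifford_pos[OF nu] less_imp_le)

lemma bessel_q_interior_speed:
  assumes t: "0 < t" and c: "0 \<le> c" and z: "0 < z" and y: "0 < y"
  shows "bessel_q_interior \<nu> c t z y * bessel_speed_density \<nu> c y = bessel_density \<nu> c t z y"
proof -
  have y2: "y * (y powr \<nu> * y powr \<nu>) = y powr (2 * \<nu> + 1)"
    using powr_mult_base[of y "2 * \<nu>"] y by (simp add: powr_add[symmetric] add.commute[of 1])
  have I3: "bessel_I \<nu> (z * y / t) = z powr \<nu> * y powr \<nu> / (2 * t) powr \<nu> * bessel_clifford \<nu> (z\<^sup>2 * y\<^sup>2 / (4 * t\<^sup>2))"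
  proof -
    have 1: "z * y / t / 2 = z * y / (2 * t)" and 2: "(z * y / t)\<^sup>2 / 4 = z\<^sup>2 * y\<^sup>2 / (4 * t\<^sup>2)"
      by (simp_all add: power_mult_distrib power_divide)
    show ?thesis
      using t z y by (subst bessel_I_eq_clifford[OF nu]) (simp, simp only: 1 2 powr_divide powr_mult)
  qed
  have e: "exp (- (c\<^sup>2 * t / 2)) * exp (- (z\<^sup>2 + y\<^sup>2) / (2 * t)) = exp (- (c\<^sup>2 * t / 2) - (z\<^sup>2 + y\<^sup>2) / (2 * t))"
    unfolding minus_divide_left[symmetric] exp_add[symmetric] by (simp only: diff_conv_add_uminus)
  show ?thesis
  proof (cases "c = 0")
    case True
    have 1: "(z * y) powr (- \<nu>) * (z powr \<nu> * y powr \<nu>) = 1"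
      using z y by (simp add: powr_mult[symmetric] powr_add[symmetric])
    have 2: "2 * y powr (2 * \<nu> + 1) / (2 * t) = y powr (2 * \<nu> + 1) / t" by simp
    have J: "bessel_clifford \<nu> 0 \<noteq> 0" using bessel_clifford_pos[OF nu, of 0] by simp
    have "bessel_q_interior \<nu> c t z y * bessel_speed_density \<nu> c y
      = ((z * y) powr (- \<nu>) * (z powr \<nu> * y powr \<nu>)) * (2 * y powr (2 * \<nu> + 1) / (2 * t))
        * exp (- (z\<^sup>2 + y\<^sup>2) / (2 * t)) * bessel_clifford \<nu> (z\<^sup>2 * y\<^sup>2 / (4 * t\<^sup>2)) / (2 * t) powr \<nu>"
      unfolding bessel_q_interior_def bessel_speed_density_def I3 using True by simp
    also have "\<dots> = bessel_density \<nu> c t z y"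
    proof -
      have E: "exp (- (z\<^sup>2 + y\<^sup>2) / (2 * t)) = exp (- (c\<^sup>2 * t / 2) - (z\<^sup>2 + y\<^sup>2) / (2 * t))"
        unfolding e[symmetric] using True by simp
      show ?thesis unfolding 1 2 E bessel_density_def using True J by simp
    qed
    finally show ?thesis .
  next
    case False
    then have c0: "0 < c" using c by simp
    define Jz where "Jz = bessel_clifford \<nu> (c\<^sup>2 * z\<^sup>2 / 4)"
    define Jy where "Jy = bessel_clifford \<nu> (c\<^sup>2 * y\<^sup>2 / 4)"
    define Cn where "Cn = (c / 2) powr \<nu>"
    have nz: "Jz \<noteq> 0" "Jy \<noteq> 0" "Cn \<noteq> 0" "Gamma (\<nu> + 1) \<noteq> 0" "z powr \<nu> \<noteq> 0" "y powr \<nu> \<noteq> 0"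
      using bessel_clifford_pos[OF nu, of "c\<^sup>2 * z\<^sup>2 / 4"] bessel_clifford_pos[OF nu, of "c\<^sup>2 * y\<^sup>2 / 4"]
        Gamma_shift_pos[OF nu, of 0] c0 z y by (auto simp: Jz_def Jy_def Cn_def)
    have Iz: "bessel_I \<nu> (c * z) = Cn * z powr \<nu> * Jz"
      using c0 z by (subst bessel_I_eq_clifford[OF nu])
        (auto simp: Jz_def Cn_def powr_mult powr_divide power_mult_distrib)
    have Iy: "bessel_I \<nu> (c * y) = Cn * y powr \<nu> * Jy"
      using c0 y by (subst bessel_I_eq_clifford[OF nu])
        (auto simp: Jy_def Cn_def powr_mult powr_divide power_mult_distrib)
    have C2: "(c / 2) powr (2 * \<nu>) * (2 / c) powr (2 * \<nu>) = 1"
      using c0 by (simp add: powr_mult[symmetric])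
    have alg: "1 / (2 * t * G2) * C * (e1 / (Cn * zn * Jz * (Cn * yn * Jy))) * e2 * (zn * yn / T * J3) * (2 * G2 * C' * y * (Cn * yn * Jy)\<^sup>2)
      = (y * (yn * yn)) * (e1 * e2) * J3 * Jy / (t * T * Jz)"
      if "C * C' = 1" "zn \<noteq> 0" "yn \<noteq> 0" "G2 \<noteq> 0" "T \<noteq> 0" for C C' G2 e1 e2 zn yn T J3 :: real
    proof -
      have "C \<noteq> 0" using that(1) by auto
      then have C': "C' = 1 / C" using that(1) by (simp add: eq_divide_eq mult.commute)
      note \<open>C \<noteq> 0\<close>
      then show ?thesis unfolding C' using that nz t by (simp add: divide_simps power2_eq_square)
    qed
    have "bessel_q_interior \<nu> c t z y * bessel_speed_density \<nu> c y
      = (y * (y powr \<nu> * y powr \<nu>)) * (exp (- (c\<^sup>2 * t / 2)) * exp (- (z\<^sup>2 + y\<^sup>2) / (2 * t)))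
        * bessel_clifford \<nu> (z\<^sup>2 * y\<^sup>2 / (4 * t\<^sup>2)) * Jy / (t * (2 * t) powr \<nu> * Jz)"
      unfolding bessel_q_interior_def bessel_speed_density_def I3 Iz Iy if_not_P[OF False]
      by (rule alg) (use nz t C2 in auto)
    also have "\<dots> = bessel_density \<nu> c t z y"
      unfolding e y2 bessel_density_def Jz_def Jy_def ..
    finally show ?thesis .
  qed
qed

lemma bessel_speed_density_pos:
  assumes "0 \<le> c" "0 < y" shows "0 < bessel_speed_density \<nu> c y"
proof (cases "c = 0")
  case True
  then show ?thesis using assms by (simp add: bessel_speed_density_def)
next
  case False
  then have c: "0 < c" "0 < c * y" using assms by auto
  have "0 < bessel_I \<nu> (c * y)"
    unfolding bessel_I_eq_clifford[OF nu c(2)] using c assms by (intro mult_pos_pos bessel_clifford_pos[OF nu]) simp_all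
  moreover have "Gamma (\<nu> + 1) > 0" using Gamma_shift_pos[OF nu, of 0] by simp
  ultimately show ?thesis unfolding bessel_speed_density_def if_not_P[OF False]
    using c assms by (intro mult_pos_pos zero_less_power) simp_all
qed

lemma continuous_on_bessel_density:
  assumes t: "0 < t" shows "continuous_on UNIV (\<lambda>z. bessel_density \<nu> c t z y)"
proof -
  have "t * (2 * t) powr \<nu> * bessel_clifford \<nu> (c\<^sup>2 * z\<^sup>2 / 4) \<noteq> 0" for z
    using t bessel_clifford_pos[OF nu, of "c\<^sup>2 * z\<^sup>2 / 4"] by simp
  then show ?thesis unfolding bessel_density_def using t
    by (intro continuous_on_divide continuous_on_mult continuous_on_const continuous_on_exp continuous_on_diff
        continuous_on_add continuous_on_power continuous_on_id continuous_on_bessel_clifford[OF nu] ballI) simp_all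
qed

text \<open>At z = 0 \<open>bessel_q\<close> is a limit, which the continuity of
  \<open>bessel_density\<close> in z evaluates; the positive speed density can be divided
  out.\<close>

lemma bessel_q_speed:
  assumes t: "0 < t" and c: "0 \<le> c" and z: "0 \<le> z" and y: "0 < y"
  shows "bessel_q \<nu> c t z y * bessel_speed_density \<nu> c y = bessel_density \<nu> c t z y"
proof (cases "z = 0")
  case False
  then show ?thesis using bessel_q_interior_speed[of t c z y] assms by (simp add: bessel_q_def)
next
  case True
  let ?m = "bessel_speed_density \<nu> c y"
  have m: "?m > 0" using c y by (rule bessel_speed_density_pos)
  have "continuous_on UNIV (\<lambda>z'. bessel_density \<nu> c t z' y)"
    by (rule continuous_on_bessel_density[OF t])
  then have "((\<lambda>z'. bessel_density \<nu> c t z' y) \<longlongrightarrow> bessel_density \<nu> c t 0 y) (at_right 0)"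
    by (metis UNIV_I continuous_on_def tendsto_within_subset top_greatest)
  then have "((\<lambda>z'. bessel_density \<nu> c t z' y / ?m) \<longlongrightarrow> bessel_density \<nu> c t 0 y / ?m) (at_right 0)"
    using m by (intro tendsto_divide tendsto_const) auto
  moreover have "\<forall>\<^sub>F z' in at_right 0. bessel_density \<nu> c t z' y / ?m = bessel_q_interior \<nu> c t z' y"
    using eventually_at_right_less[of 0]
  proof eventually_elim
    case (elim z')
    show ?case unfolding bessel_q_interior_speed[OF t c elim y, symmetric] using m by simp
  qed
  ultimately have "((\<lambda>z'. bessel_q_interior \<nu> c t z' y) \<longlongrightarrow> bessel_density \<nu> c t 0 y / ?m) (at_right 0)"
    by (rule Lim_transform_eventually)
  then have "Lim (at_right 0) (\<lambda>z'. bessel_q_interior \<nu> c t z' y) = bessel_density \<nu> c t 0 y / ?m"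
    by (intro tendsto_Lim) auto
  then show ?thesis using m True by (simp add: bessel_q_def)
qed

lemma bessel_kernel_eq:
  assumes "0 < t" "0 \<le> c" "0 \<le> z"
  shows "bessel_kernel \<nu> c t z = density lborel (\<lambda>y. ennreal (bessel_density \<nu> c t z y) * indicator {0<..} y)"
  unfolding bessel_kernel_def using bessel_q_speed[OF assms]
  by (intro arg_cong[where f = "density lborel"] ext) (auto split: split_indicator)

text \<open>The exponential only changes the Gaussian rate in Weber's integral from 1 / (2 t) to (1
  - \<delta>) / (2 t). The value \<delta> = 0 gives the total mass; other values give tail estimates
  on both sides, since \<delta> may be negative.\<close>

lemma nn_integral_bessel_density_exp:
  assumes t: "0 < t" and d: "\<delta> < 1"
  shows "(\<integral>\<^sup>+y. ennreal (bessel_density \<nu> c t z y * exp (\<delta> * y\<^sup>2 / (2 * t))) * indicator {0<..} y \<partial>lborel)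
    = ennreal (exp ((z\<^sup>2 / (2 * t) + c\<^sup>2 * t / 2) * (1 / (1 - \<delta>) - 1)) * bessel_clifford \<nu> (c\<^sup>2 * z\<^sup>2 / (4 * (1 - \<delta>)\<^sup>2))
        / ((1 - \<delta>) powr (\<nu> + 1) * bessel_clifford \<nu> (c\<^sup>2 * z\<^sup>2 / 4)))"
proof -
  define p where "p = (1 - \<delta>) / (2 * t)"
  define K where "K = exp (- (c\<^sup>2 * t / 2) - z\<^sup>2 / (2 * t)) / (t * (2 * t) powr \<nu> * bessel_clifford \<nu> (c\<^sup>2 * z\<^sup>2 / 4))"
  have p: "0 < p" using t d by (simp add: p_def)
  have K: "0 \<le> K" using t bessel_clifford_pos[OF nu, of "c\<^sup>2 * z\<^sup>2 / 4"] by (simp add: K_def)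
  have "bessel_density \<nu> c t z y * exp (\<delta> * y\<^sup>2 / (2 * t)) =
    K * (y powr (2 * \<nu> + 1) * exp (- p * y\<^sup>2) * bessel_clifford \<nu> (z\<^sup>2 / (4 * t\<^sup>2) * y\<^sup>2) * bessel_clifford \<nu> (c\<^sup>2 / 4 * y\<^sup>2))" for y
  proof -
    have "exp (- (c\<^sup>2 * t / 2) - (z\<^sup>2 + y\<^sup>2) / (2 * t)) * exp (\<delta> * y\<^sup>2 / (2 * t)) = exp (- (c\<^sup>2 * t / 2) - z\<^sup>2 / (2 * t)) * exp (- p * y\<^sup>2)"
      unfolding exp_add[symmetric] p_def using t by (intro arg_cong[where f = exp]) (simp add: field_simps)
    then show ?thesis unfolding bessel_density_def K_def by simp
  qed
  then have "(\<integral>\<^sup>+y. ennreal (bessel_density \<nu> c t z y * exp (\<delta> * y\<^sup>2 / (2 * t))) * indicator {0<..} y \<partial>lborel)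
    = (\<integral>\<^sup>+y. ennreal K * (ennreal (y powr (2 * \<nu> + 1) * exp (- p * y\<^sup>2) * bessel_clifford \<nu> (z\<^sup>2 / (4 * t\<^sup>2) * y\<^sup>2) * bessel_clifford \<nu> (c\<^sup>2 / 4 * y\<^sup>2)) * indicator {0<..} y) \<partial>lborel)"
    using K by (intro nn_integral_cong) (simp add: ennreal_mult' mult_ac)
  also have "\<dots> = ennreal K * (\<integral>\<^sup>+y. ennreal (y powr (2 * \<nu> + 1) * exp (- p * y\<^sup>2) * bessel_clifford \<nu> (z\<^sup>2 / (4 * t\<^sup>2) * y\<^sup>2) * bessel_clifford \<nu> (c\<^sup>2 / 4 * y\<^sup>2)) * indicator {0<..} y \<partial>lborel)"
  proof (rule nn_integral_cmult)
    note [measurable] = measurable_bessel_clifford[OF nu]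
    show "(\<lambda>y. ennreal (y powr (2 * \<nu> + 1) * exp (- p * y\<^sup>2) * bessel_clifford \<nu> (z\<^sup>2 / (4 * t\<^sup>2) * y\<^sup>2) * bessel_clifford \<nu> (c\<^sup>2 / 4 * y\<^sup>2)) * indicator {0<..} y) \<in> borel_measurable lborel"
      by measurable
  qed
  also have "\<dots> = ennreal (K * (exp ((z\<^sup>2 / (4 * t\<^sup>2) + c\<^sup>2 / 4) / p) * bessel_clifford \<nu> (z\<^sup>2 / (4 * t\<^sup>2) * (c\<^sup>2 / 4) / p\<^sup>2) / (2 * p powr (\<nu> + 1))))"
    unfolding ennreal_mult'[OF K] by (subst nn_integral_weber[OF nu p]) simp_all
  also have "K * (exp ((z\<^sup>2 / (4 * t\<^sup>2) + c\<^sup>2 / 4) / p) * bessel_clifford \<nu> (z\<^sup>2 / (4 * t\<^sup>2) * (c\<^sup>2 / 4) / p\<^sup>2) / (2 * p powr (\<nu> + 1)))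
    = exp ((z\<^sup>2 / (2 * t) + c\<^sup>2 * t / 2) * (1 / (1 - \<delta>) - 1)) * bessel_clifford \<nu> (c\<^sup>2 * z\<^sup>2 / (4 * (1 - \<delta>)\<^sup>2))
        / ((1 - \<delta>) powr (\<nu> + 1) * bessel_clifford \<nu> (c\<^sup>2 * z\<^sup>2 / 4))"
  proof -
    have 1: "z\<^sup>2 / (4 * t\<^sup>2) * (c\<^sup>2 / 4) / p\<^sup>2 = c\<^sup>2 * z\<^sup>2 / (4 * (1 - \<delta>)\<^sup>2)"
      using t d by (simp add: p_def power_divide power_mult_distrib)
    have 2: "exp (- (c\<^sup>2 * t / 2) - z\<^sup>2 / (2 * t)) * exp ((z\<^sup>2 / (4 * t\<^sup>2) + c\<^sup>2 / 4) / p)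
       = exp ((z\<^sup>2 / (2 * t) + c\<^sup>2 * t / 2) * (1 / (1 - \<delta>) - 1))"
    proof -
      have "(z\<^sup>2 / (4 * t\<^sup>2) + c\<^sup>2 / 4) / p = (z\<^sup>2 / (4 * t\<^sup>2) + c\<^sup>2 / 4) * (2 * t) * (1 / (1 - \<delta>))"
        using t d by (simp add: p_def)
      also have "(z\<^sup>2 / (4 * t\<^sup>2) + c\<^sup>2 / 4) * (2 * t) = z\<^sup>2 / (2 * t) + c\<^sup>2 * t / 2"
        using t by (simp add: distrib_right power2_eq_square)
      finally show ?thesis unfolding exp_add[symmetric]
        by (intro arg_cong[where f = exp]) (simp only: right_diff_distrib mult_1_right)
    qed
    have 3: "t * (2 * t) powr \<nu> * (2 * p powr (\<nu> + 1)) = (1 - \<delta>) powr (\<nu> + 1)"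
    proof -
      have "t * (2 * t) powr \<nu> * 2 = (2 * t) powr (\<nu> + 1)"
        using powr_mult_base[of "2 * t" \<nu>] t by (simp add: mult_ac add.commute)
      then have "t * (2 * t) powr \<nu> * (2 * p powr (\<nu> + 1)) = (2 * t) powr (\<nu> + 1) * p powr (\<nu> + 1)"
        by simp
      also have "\<dots> = (2 * t * p) powr (\<nu> + 1)" by (rule powr_mult[symmetric])
      finally show ?thesis using t by (simp add: p_def)
    qed
    have "K * (exp ((z\<^sup>2 / (4 * t\<^sup>2) + c\<^sup>2 / 4) / p) * bessel_clifford \<nu> (z\<^sup>2 / (4 * t\<^sup>2) * (c\<^sup>2 / 4) / p\<^sup>2) / (2 * p powr (\<nu> + 1)))
      = (exp (- (c\<^sup>2 * t / 2) - z\<^sup>2 / (2 * t)) * exp ((z\<^sup>2 / (4 * t\<^sup>2) + c\<^sup>2 / 4) / p)) * bessel_clifford \<nu> (c\<^sup>2 * z\<^sup>2 / (4 * (1 - \<delta>)\<^sup>2))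
        / ((t * (2 * t) powr \<nu> * (2 * p powr (\<nu> + 1))) * bessel_clifford \<nu> (c\<^sup>2 * z\<^sup>2 / 4))"
      unfolding 1 K_def by (simp only: times_divide_eq_left times_divide_eq_right divide_divide_eq_left mult_ac)
    then show ?thesis unfolding 2 3 .
  qed
  finally show ?thesis .
qed

lemma nn_integral_bessel_density:
  "0 < t \<Longrightarrow> (\<integral>\<^sup>+y. ennreal (bessel_density \<nu> c t z y) * indicator {0<..} y \<partial>lborel) = 1"
  using nn_integral_bessel_density_exp[of t 0 c z] bessel_clifford_pos[OF nu, of "c\<^sup>2 * z\<^sup>2 / 4"] by simp

text \<open>The factor J(c^2 y^2 / 4) cancels between the numerator of the first and the denominator
  of the second density. What remains is Weber's integral with p = 1 / (2 s) + 1 / (2 r).\<close>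

lemma bessel_density_chapman_kolmogorov:
  assumes s: "0 < s" and r: "0 < r"
  shows "(\<integral>\<^sup>+y. ennreal (bessel_density \<nu> c s \<xi> y) * ennreal (bessel_density \<nu> c r y z) * indicator {0<..} y \<partial>lborel)
    = ennreal (bessel_density \<nu> c (s + r) \<xi> z)"
proof -
  define p where "p = (s + r) / (2 * s * r)"
  define K where "K = z powr (2 * \<nu> + 1) * exp (- (c\<^sup>2 * (s + r) / 2) - \<xi>\<^sup>2 / (2 * s) - z\<^sup>2 / (2 * r)) * bessel_clifford \<nu> (c\<^sup>2 * z\<^sup>2 / 4)
     / (s * (2 * s) powr \<nu> * (r * (2 * r) powr \<nu>) * bessel_clifford \<nu> (c\<^sup>2 * \<xi>\<^sup>2 / 4))"
  have p: "0 < p" using s r by (simp add: p_def)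
  have K: "0 \<le> K" using s r bessel_clifford_pos[OF nu, of "c\<^sup>2 * z\<^sup>2 / 4"] bessel_clifford_pos[OF nu, of "c\<^sup>2 * \<xi>\<^sup>2 / 4"]
    by (simp add: K_def)
  have "bessel_density \<nu> c s \<xi> y * bessel_density \<nu> c r y z =
    K * (y powr (2 * \<nu> + 1) * exp (- p * y\<^sup>2) * bessel_clifford \<nu> (\<xi>\<^sup>2 / (4 * s\<^sup>2) * y\<^sup>2) * bessel_clifford \<nu> (z\<^sup>2 / (4 * r\<^sup>2) * y\<^sup>2))" for y
  proof -
    have e: "exp (- (c\<^sup>2 * s / 2) - (\<xi>\<^sup>2 + y\<^sup>2) / (2 * s)) * exp (- (c\<^sup>2 * r / 2) - (y\<^sup>2 + z\<^sup>2) / (2 * r))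
      = exp (- (c\<^sup>2 * (s + r) / 2) - \<xi>\<^sup>2 / (2 * s) - z\<^sup>2 / (2 * r)) * exp (- p * y\<^sup>2)"
      unfolding exp_add[symmetric] p_def using s r by (intro arg_cong[where f = exp]) (simp add: field_simps)
    have "bessel_density \<nu> c s \<xi> y * bessel_density \<nu> c r y z =
      (bessel_clifford \<nu> (c\<^sup>2 * y\<^sup>2 / 4) / bessel_clifford \<nu> (c\<^sup>2 * y\<^sup>2 / 4)) * z powr (2 * \<nu> + 1) * y powr (2 * \<nu> + 1)
      * (exp (- (c\<^sup>2 * s / 2) - (\<xi>\<^sup>2 + y\<^sup>2) / (2 * s)) * exp (- (c\<^sup>2 * r / 2) - (y\<^sup>2 + z\<^sup>2) / (2 * r)))
      * bessel_clifford \<nu> (c\<^sup>2 * z\<^sup>2 / 4) * bessel_clifford \<nu> (\<xi>\<^sup>2 / (4 * s\<^sup>2) * y\<^sup>2) * bessel_clifford \<nu> (z\<^sup>2 / (4 * r\<^sup>2) * y\<^sup>2)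
      / (s * (2 * s) powr \<nu> * (r * (2 * r) powr \<nu>) * bessel_clifford \<nu> (c\<^sup>2 * \<xi>\<^sup>2 / 4))"
      unfolding bessel_density_def by (simp only: times_divide_eq_left times_divide_eq_right divide_divide_eq_left times_divide_times_eq mult_ac)
    moreover have "bessel_clifford \<nu> (c\<^sup>2 * y\<^sup>2 / 4) / bessel_clifford \<nu> (c\<^sup>2 * y\<^sup>2 / 4) = 1"
      using bessel_clifford_pos[OF nu, of "c\<^sup>2 * y\<^sup>2 / 4"] by simp
    ultimately show ?thesis unfolding e K_def
      by (simp only: times_divide_eq_left times_divide_eq_right mult_1 mult_ac)
  qed
  then have "(\<integral>\<^sup>+y. ennreal (bessel_density \<nu> c s \<xi> y) * ennreal (bessel_density \<nu> c r y z) * indicator {0<..} y \<partial>lborel)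
    = (\<integral>\<^sup>+y. ennreal K * (ennreal (y powr (2 * \<nu> + 1) * exp (- p * y\<^sup>2) * bessel_clifford \<nu> (\<xi>\<^sup>2 / (4 * s\<^sup>2) * y\<^sup>2) * bessel_clifford \<nu> (z\<^sup>2 / (4 * r\<^sup>2) * y\<^sup>2)) * indicator {0<..} y) \<partial>lborel)"
    unfolding mult.assoc[of "ennreal K", symmetric] ennreal_mult'[OF K, symmetric]
    by (intro nn_integral_cong) (simp only: ennreal_mult[OF bessel_density_nonneg[OF s] bessel_density_nonneg[OF r], symmetric])
  also have "\<dots> = ennreal K * (\<integral>\<^sup>+y. ennreal (y powr (2 * \<nu> + 1) * exp (- p * y\<^sup>2) * bessel_clifford \<nu> (\<xi>\<^sup>2 / (4 * s\<^sup>2) * y\<^sup>2) * bessel_clifford \<nu> (z\<^sup>2 / (4 * r\<^sup>2) * y\<^sup>2)) * indicator {0<..} y \<partial>lborel)"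
  proof (rule nn_integral_cmult)
    note [measurable] = measurable_bessel_clifford[OF nu]
    show "(\<lambda>y. ennreal (y powr (2 * \<nu> + 1) * exp (- p * y\<^sup>2) * bessel_clifford \<nu> (\<xi>\<^sup>2 / (4 * s\<^sup>2) * y\<^sup>2) * bessel_clifford \<nu> (z\<^sup>2 / (4 * r\<^sup>2) * y\<^sup>2)) * indicator {0<..} y) \<in> borel_measurable lborel"
      by measurable
  qed
  also have "\<dots> = ennreal (K * (exp ((\<xi>\<^sup>2 / (4 * s\<^sup>2) + z\<^sup>2 / (4 * r\<^sup>2)) / p) * bessel_clifford \<nu> (\<xi>\<^sup>2 / (4 * s\<^sup>2) * (z\<^sup>2 / (4 * r\<^sup>2)) / p\<^sup>2) / (2 * p powr (\<nu> + 1))))"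
    unfolding ennreal_mult'[OF K] by (subst nn_integral_weber[OF nu p]) simp_all
  also have "K * (exp ((\<xi>\<^sup>2 / (4 * s\<^sup>2) + z\<^sup>2 / (4 * r\<^sup>2)) / p) * bessel_clifford \<nu> (\<xi>\<^sup>2 / (4 * s\<^sup>2) * (z\<^sup>2 / (4 * r\<^sup>2)) / p\<^sup>2) / (2 * p powr (\<nu> + 1)))
     = bessel_density \<nu> c (s + r) \<xi> z"
  proof -
    have 1: "\<xi>\<^sup>2 / (4 * s\<^sup>2) * (z\<^sup>2 / (4 * r\<^sup>2)) / p\<^sup>2 = \<xi>\<^sup>2 * z\<^sup>2 / (4 * (s + r)\<^sup>2)"
      using s r by (simp add: p_def power_divide power_mult_distrib)
    have 2: "exp (- (c\<^sup>2 * (s + r) / 2) - \<xi>\<^sup>2 / (2 * s) - z\<^sup>2 / (2 * r)) * exp ((\<xi>\<^sup>2 / (4 * s\<^sup>2) + z\<^sup>2 / (4 * r\<^sup>2)) / p)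
       = exp (- (c\<^sup>2 * (s + r) / 2) - (\<xi>\<^sup>2 + z\<^sup>2) / (2 * (s + r)))"
    proof -
      have "1 / (4 * s\<^sup>2) / p = r / (2 * s * (s + r))" "1 / (4 * r\<^sup>2) / p = s / (2 * r * (s + r))"
        unfolding p_def using s r by (simp_all add: power2_eq_square)
      moreover have "r / (2 * s * (s + r)) = 1 / (2 * s) - 1 / (2 * (s + r))" "s / (2 * r * (s + r)) = 1 / (2 * r) - 1 / (2 * (s + r))"
        using s r by (auto simp: divide_simps)
      moreover have "(\<xi>\<^sup>2 / (4 * s\<^sup>2) + z\<^sup>2 / (4 * r\<^sup>2)) / p = \<xi>\<^sup>2 * (1 / (4 * s\<^sup>2) / p) + z\<^sup>2 * (1 / (4 * r\<^sup>2) / p)"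
        by (simp add: add_divide_distrib)
      ultimately have eq: "(\<xi>\<^sup>2 / (4 * s\<^sup>2) + z\<^sup>2 / (4 * r\<^sup>2)) / p
        = \<xi>\<^sup>2 * (1 / (2 * s) - 1 / (2 * (s + r))) + z\<^sup>2 * (1 / (2 * r) - 1 / (2 * (s + r)))" by (simp only:)
      have lin: "- C - X * A - Z * B + (X * (A - W) + Z * (B - W)) = - C - (X + Z) * W" for A B C W X Z :: real
        by (simp add: algebra_simps)
      show ?thesis unfolding exp_add[symmetric] eq
        using lin[of "c\<^sup>2 * (s + r) / 2" "\<xi>\<^sup>2" "1 / (2 * s)" "z\<^sup>2" "1 / (2 * r)" "1 / (2 * (s + r))"]
        by (simp only: times_divide_eq_right mult_1_right)
    qed
    have 3: "s * (2 * s) powr \<nu> * (r * (2 * r) powr \<nu>) * (2 * p powr (\<nu> + 1)) = (s + r) * (2 * (s + r)) powr \<nu>"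
    proof -
      have b: "u * (2 * u) powr \<nu> = (2 * u) powr (\<nu> + 1) / 2" if "0 < u" for u
        using powr_mult_base[of "2 * u" \<nu>] that by (simp add: add.commute[of \<nu>])
      have "(2 * s) powr (\<nu> + 1) * (2 * r) powr (\<nu> + 1) * p powr (\<nu> + 1) = (2 * s * (2 * r) * p) powr (\<nu> + 1)"
        by (simp only: powr_mult)
      also have "2 * s * (2 * r) * p = 2 * (s + r)" using s r by (simp add: p_def)
      finally have "(2 * s) powr (\<nu> + 1) / 2 * ((2 * r) powr (\<nu> + 1) / 2) * (2 * p powr (\<nu> + 1)) = (2 * (s + r)) powr (\<nu> + 1) / 2"
        by linarith
      then show ?thesis unfolding b[OF s] b[OF r] b[OF add_pos_pos[OF s r]] .
    qed
    have "K * (exp ((\<xi>\<^sup>2 / (4 * s\<^sup>2) + z\<^sup>2 / (4 * r\<^sup>2)) / p) * bessel_clifford \<nu> (\<xi>\<^sup>2 / (4 * s\<^sup>2) * (z\<^sup>2 / (4 * r\<^sup>2)) / p\<^sup>2) / (2 * p powr (\<nu> + 1)))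
      = z powr (2 * \<nu> + 1) * (exp (- (c\<^sup>2 * (s + r) / 2) - \<xi>\<^sup>2 / (2 * s) - z\<^sup>2 / (2 * r)) * exp ((\<xi>\<^sup>2 / (4 * s\<^sup>2) + z\<^sup>2 / (4 * r\<^sup>2)) / p))
        * bessel_clifford \<nu> (\<xi>\<^sup>2 * z\<^sup>2 / (4 * (s + r)\<^sup>2)) * bessel_clifford \<nu> (c\<^sup>2 * z\<^sup>2 / 4)
        / ((s * (2 * s) powr \<nu> * (r * (2 * r) powr \<nu>) * (2 * p powr (\<nu> + 1))) * bessel_clifford \<nu> (c\<^sup>2 * \<xi>\<^sup>2 / 4))"
      unfolding 1 K_def by (simp only: times_divide_eq_left times_divide_eq_right divide_divide_eq_left mult_ac)
    then show ?thesis unfolding 2 3 bessel_density_def .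
  qed
  finally show ?thesis .
qed

end

section \<open>The reverse martingale\<close>

locale bessel_passage = bessel_process M R \<nu> c x
  for M :: "'w measure" and R :: "real \<Rightarrow> 'w \<Rightarrow> real" and \<nu> c x :: real +
  fixes a b :: real
  assumes nu: "\<nu> > -1" and c: "0 \<le> c" and b: "0 < b" and sqrt_a: "c < sqrt a" and x: "0 \<le> x"
begin

lemmas measurable_density[measurable] = measurable_bessel_density[OF nu]

section \<open>The Markov property for nonnegative functions and for events of the future\<close>

definition past :: "real \<Rightarrow> 'w measure" where
  "past s = sigma (space M) (\<Union>u\<in>{0..s}. {R u -` A \<inter> space M | A. A \<in> sets borel})"

definition transition :: "real \<Rightarrow> (real \<Rightarrow> ennreal) \<Rightarrow> real \<Rightarrow> ennreal" where
  "transition t u z = (\<integral>\<^sup>+y. ennreal (bessel_density \<nu> c t z y) * u y * indicator {0<..} y \<partial>lborel)"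

lemma space_past [simp]: "space (past s) = space M"
  unfolding past_def by (rule space_measure_of) auto

lemma sets_past: "sets (past s) = sigma_sets (space M) (\<Union>u\<in>{0..s}. {R u -` A \<inter> space M | A. A \<in> sets borel})"
  unfolding past_def by (rule sets_measure_of) auto

lemma subalgebra_past: "subalgebra M (past s)"
  unfolding subalgebra_def sets_past
  using measurable_R by (auto intro!: sets.sigma_sets_subset)

lemma measurable_R_past: "0 \<le> u \<Longrightarrow> u \<le> s \<Longrightarrow> R u \<in> borel_measurable (past s)"
  by (rule measurableI) (auto simp: sets_past intro!: sigma_sets.Basic bexI[of _ u], blast)

lemma measurable_past_le: "f \<in> measurable (past s) N \<Longrightarrow> s \<le> t \<Longrightarrow> f \<in> measurable (past t) N"
proof (rule measurable_from_subalg[rotated])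
  assume "s \<le> t"
  then show "subalgebra (past t) (past s)"
    unfolding subalgebra_def sets_past by (intro conjI sigma_sets_mono' UN_mono) auto
qed

lemma measurable_transition [measurable]:
  assumes [measurable]: "u \<in> borel_measurable borel"
  shows "transition t u \<in> borel_measurable borel"
  unfolding transition_def by measurable

text \<open>With B fixed, both sides integrate u against a measure on the line: the law of R (s + t)
  on B, and the measure with the Lebesgue density d found by Tonelli. By \<open>markov_R\<close> the
  two agree on Borel sets.\<close>

lemma markov_indicator:
  assumes st: "0 \<le> s" "0 < t" and B: "B \<in> sets (past s)" and u[measurable]: "u \<in> borel_measurable borel"
  shows "(\<integral>\<^sup>+\<omega>. indicator B \<omega> * u (R (s + t) \<omega>) \<partial>M) = (\<integral>\<^sup>+\<omega>. indicator B \<omega> * transition t u (R s \<omega>) \<partial>M)"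
proof -
  note [measurable] = measurable_R[of s] measurable_R[of "s + t"]
  have Rm[measurable]: "R s \<in> borel_measurable M" "R (s + t) \<in> borel_measurable M" using st by (auto intro: measurable_R)
  have BM[measurable]: "B \<in> sets M" using B subalgebra_past[of s] by (auto simp: subalgebra_def)
  interpret P: pair_sigma_finite lborel M ..
  define d where "d y = (\<integral>\<^sup>+\<omega>. indicator B \<omega> * ennreal (bessel_density \<nu> c t (R s \<omega>) y) \<partial>M) * indicator {0<..} y" for y
  have d[measurable]: "d \<in> borel_measurable borel" unfolding d_def by measurable
  have swap: "(\<integral>\<^sup>+\<omega>. indicator B \<omega> * transition t v (R s \<omega>) \<partial>M) = (\<integral>\<^sup>+y. d y * v y \<partial>lborel)"
    if [measurable]: "v \<in> borel_measurable borel" for v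
  proof -
    have "(\<integral>\<^sup>+\<omega>. indicator B \<omega> * transition t v (R s \<omega>) \<partial>M)
      = (\<integral>\<^sup>+\<omega>. (\<integral>\<^sup>+y. indicator B \<omega> * (ennreal (bessel_density \<nu> c t (R s \<omega>) y) * v y * indicator {0<..} y) \<partial>lborel) \<partial>M)"
      unfolding transition_def by (intro nn_integral_cong nn_integral_cmult[symmetric]) measurable
    also have "\<dots> = (\<integral>\<^sup>+y. (\<integral>\<^sup>+\<omega>. indicator B \<omega> * (ennreal (bessel_density \<nu> c t (R s \<omega>) y) * v y * indicator {0<..} y) \<partial>M) \<partial>lborel)"
      by (rule P.Fubini') measurable
    also have "\<dots> = (\<integral>\<^sup>+y. d y * v y \<partial>lborel)"
    proof (intro nn_integral_cong)
      fix y
      have "(\<integral>\<^sup>+\<omega>. indicator B \<omega> * (ennreal (bessel_density \<nu> c t (R s \<omega>) y) * v y * indicator {0<..} y) \<partial>M)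
        = (\<integral>\<^sup>+\<omega>. (indicator B \<omega> * ennreal (bessel_density \<nu> c t (R s \<omega>) y)) * (v y * indicator {0<..} y) \<partial>M)"
        by (simp add: mult_ac)
      also have "\<dots> = (\<integral>\<^sup>+\<omega>. indicator B \<omega> * ennreal (bessel_density \<nu> c t (R s \<omega>) y) \<partial>M) * (v y * indicator {0<..} y)"
        by (rule nn_integral_multc) measurable
      finally show "(\<integral>\<^sup>+\<omega>. indicator B \<omega> * (ennreal (bessel_density \<nu> c t (R s \<omega>) y) * v y * indicator {0<..} y) \<partial>M) = d y * v y"
        unfolding d_def by (simp add: mult_ac)
    qed
    finally show ?thesis .
  qed
  have "distr (density M (indicator B)) borel (R (s + t)) = density lborel d"
  proof (rule measure_eqI)
    fix A assume "A \<in> sets (distr (density M (indicator B)) borel (R (s + t)))"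
    then have A[measurable]: "A \<in> sets borel" by simp
    have Bsub: "B \<subseteq> space M" using sets.sets_into_space[OF BM] .
    have "emeasure (distr (density M (indicator B)) borel (R (s + t))) A
      = emeasure (density M (indicator B)) (R (s + t) -` A \<inter> space M)"
      by (subst emeasure_distr) simp_all
    also have "\<dots> = emeasure M (B \<inter> (R (s + t) -` A \<inter> space M))"
      by (subst emeasure_density) (auto simp: nn_integral_indicator[symmetric] indicator_inter_arith
          simp del: nn_integral_indicator)
    also have "B \<inter> (R (s + t) -` A \<inter> space M) = B \<inter> R (s + t) -` A" using Bsub by auto
    also have "emeasure M (B \<inter> R (s + t) -` A) = (\<integral>\<^sup>+\<omega>\<in>B. emeasure (bessel_kernel \<nu> c t (R s \<omega>)) A \<partial>M)"
      using markov_R[OF st B[unfolded sets_past] A] .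
    also have "\<dots> = (\<integral>\<^sup>+\<omega>. indicator B \<omega> * transition t (indicator A) (R s \<omega>) \<partial>M)"
    proof (intro nn_integral_cong)
      fix \<omega> assume w: "\<omega> \<in> space M"
      show "emeasure (bessel_kernel \<nu> c t (R s \<omega>)) A * indicator B \<omega> = indicator B \<omega> * transition t (indicator A) (R s \<omega>)"
        unfolding bessel_kernel_eq[OF nu st(2) c nonneg_R[OF w st(1)]]
        by (subst emeasure_density) (auto simp: transition_def mult_ac intro!: arg_cong2[where f = "(*)"] nn_integral_cong)
    qed
    also have "\<dots> = emeasure (density lborel d) A"
      by (subst swap) (auto simp: emeasure_density)
    finally show "emeasure (distr (density M (indicator B)) borel (R (s + t))) A = emeasure (density lborel d) A" .
  qed simp
  then have "nn_integral (distr (density M (indicator B)) borel (R (s + t))) u = nn_integral (density lborel d) u"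
    by simp
  then show ?thesis
    by (simp add: nn_integral_distr nn_integral_density swap)
qed

text \<open>With u fixed, both sides integrate Y against a measure on \<open>past s\<close>; by
  \<open>markov_indicator\<close> these measures coincide.\<close>

lemma markov_nn_integral:
  assumes st: "0 \<le> s" "0 < t" and Y: "Y \<in> borel_measurable (past s)" and u[measurable]: "u \<in> borel_measurable borel"
  shows "(\<integral>\<^sup>+\<omega>. Y \<omega> * u (R (s + t) \<omega>) \<partial>M) = (\<integral>\<^sup>+\<omega>. Y \<omega> * transition t u (R s \<omega>) \<partial>M)"
proof -
  have Rm[measurable]: "R s \<in> borel_measurable M" "R (s + t) \<in> borel_measurable M" using st by (auto intro: measurable_R)
  have Ym[measurable]: "Y \<in> borel_measurable M" by (rule measurable_from_subalg[OF subalgebra_past Y])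
  let ?N1 = "density M (\<lambda>\<omega>. u (R (s + t) \<omega>))" and ?N2 = "density M (\<lambda>\<omega>. transition t u (R s \<omega>))"
  have sub: "subalgebra ?N1 (past s)" "subalgebra ?N2 (past s)"
    using subalgebra_past[of s] by (auto simp: subalgebra_def)
  have "restr_to_subalg ?N1 (past s) = restr_to_subalg ?N2 (past s)"
  proof (rule measure_eqI)
    fix B assume "B \<in> sets (restr_to_subalg ?N1 (past s))"
    then have B: "B \<in> sets (past s)" using sub by (simp add: sets_restr_to_subalg)
    then have [measurable]: "B \<in> sets M" using subalgebra_past[of s] by (auto simp: subalgebra_def)
    show "emeasure (restr_to_subalg ?N1 (past s)) B = emeasure (restr_to_subalg ?N2 (past s)) B"
      using markov_indicator[OF st B u] B sub
      by (simp add: emeasure_restr_to_subalg emeasure_density mult.commute)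
  qed (use sub in \<open>simp add: sets_restr_to_subalg\<close>)
  then have "nn_integral (restr_to_subalg ?N1 (past s)) Y = nn_integral (restr_to_subalg ?N2 (past s)) Y"
    by simp
  then have "nn_integral ?N1 Y = nn_integral ?N2 Y"
    using sub Y by (simp add: nn_integral_subalgebra2)
  then show ?thesis by (simp add: nn_integral_density mult.commute)
qed

lemma nn_integral_R:
  assumes t: "0 < t" and u[measurable]: "u \<in> borel_measurable borel"
  shows "(\<integral>\<^sup>+\<omega>. u (R t \<omega>) \<partial>M) = transition t u x"
proof -
  have "(\<integral>\<^sup>+\<omega>. u (R t \<omega>) \<partial>M) = (\<integral>\<^sup>+\<omega>. transition t u (R 0 \<omega>) \<partial>M)"
    using markov_nn_integral[of 0 t "\<lambda>_. 1" u] t by simp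
  also have "\<dots> = (\<integral>\<^sup>+\<omega>. transition t u x \<partial>M)"
    using start_R by (intro nn_integral_cong_AE) auto
  finally show ?thesis by (simp add: emeasure_space_1)
qed

text \<open>Given the past up to t, an event about finitely many later times depends on
  \<open>R t\<close> alone. The induction adds the earliest time r, and the hypothesis for the
  remaining times is applied at r, where the constraint at r already belongs to the past.\<close>

lemma future_conditioning:
  assumes "finite J"
  shows "0 \<le> t \<Longrightarrow> \<forall>u\<in>J. t < u \<Longrightarrow> (\<And>u. A u \<in> sets borel) \<Longrightarrow>
    \<exists>V \<in> borel_measurable borel. \<forall>Y \<in> borel_measurable (past t).
      (\<integral>\<^sup>+\<omega>. Y \<omega> * (\<Prod>u\<in>J. indicator (A u) (R u \<omega>)) \<partial>M) = (\<integral>\<^sup>+\<omega>. Y \<omega> * V (R t \<omega>) \<partial>M)"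
  using assms
proof (induction J arbitrary: t rule: finite_linorder_min_induct)
  case empty
  show ?case by (intro bexI[of _ "\<lambda>_. 1"]) auto
next
  case (insert r J)
  note [measurable] = insert.prems(3)
  have r: "0 \<le> r" "t < r" using insert.prems by auto
  have rJ: "r \<notin> J" using insert.hyps by auto
  obtain V where V[measurable]: "V \<in> borel_measurable borel" and
    Veq: "\<And>Y. Y \<in> borel_measurable (past r) \<Longrightarrow>
      (\<integral>\<^sup>+\<omega>. Y \<omega> * (\<Prod>u\<in>J. indicator (A u) (R u \<omega>)) \<partial>M) = (\<integral>\<^sup>+\<omega>. Y \<omega> * V (R r \<omega>) \<partial>M)"
    using insert.IH[of r] insert.hyps insert.prems r by blast
  show ?case
  proof (intro bexI[of _ "transition (r - t) (\<lambda>y. indicator (A r) y * V y)"] ballI)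
    fix Y :: "'w \<Rightarrow> ennreal" assume Y: "Y \<in> borel_measurable (past t)"
    have [measurable]: "Y \<in> borel_measurable (past r)" "R r \<in> borel_measurable (past r)"
      using Y r by (auto intro: measurable_past_le measurable_R_past)
    have "(\<integral>\<^sup>+\<omega>. Y \<omega> * (\<Prod>u\<in>insert r J. indicator (A u) (R u \<omega>)) \<partial>M)
      = (\<integral>\<^sup>+\<omega>. (Y \<omega> * indicator (A r) (R r \<omega>)) * (\<Prod>u\<in>J. indicator (A u) (R u \<omega>)) \<partial>M)"
      using insert.hyps rJ by (simp add: mult.assoc)
    also have "\<dots> = (\<integral>\<^sup>+\<omega>. (Y \<omega> * indicator (A r) (R r \<omega>)) * V (R r \<omega>) \<partial>M)"
      by (rule Veq) measurable
    also have "\<dots> = (\<integral>\<^sup>+\<omega>. Y \<omega> * (indicator (A r) (R (t + (r - t)) \<omega>) * V (R (t + (r - t)) \<omega>)) \<partial>M)"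
      by (simp add: mult.assoc)
    also have "\<dots> = (\<integral>\<^sup>+\<omega>. Y \<omega> * transition (r - t) (\<lambda>y. indicator (A r) y * V y) (R t \<omega>) \<partial>M)"
      by (rule markov_nn_integral) (use insert.prems r Y in auto)
    finally show "(\<integral>\<^sup>+\<omega>. Y \<omega> * (\<Prod>u\<in>insert r J. indicator (A u) (R u \<omega>)) \<partial>M) = \<dots>" .
  qed measurable
qed

section \<open>Change of the starting point and the reversed filtration\<close>

abbreviation \<J> :: "real \<Rightarrow> real" where "\<J> \<equiv> bessel_clifford \<nu>"

lemmas measurable_J[measurable] = measurable_bessel_clifford[OF nu]

lemma J_pos: "0 \<le> w \<Longrightarrow> 0 < \<J> w"
  by (rule bessel_clifford_pos[OF nu])

text \<open>The quotient of \<open>bessel_density\<close> for the starting points \<xi> and x; all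
  factors independent of the starting point have cancelled.\<close>

definition ratio :: "real \<Rightarrow> real \<Rightarrow> real \<Rightarrow> real" where
  "ratio \<xi> t y = exp ((x\<^sup>2 - \<xi>\<^sup>2) / (2 * t)) * \<J> (\<xi>\<^sup>2 * y\<^sup>2 / (4 * t\<^sup>2)) * \<J> (c\<^sup>2 * x\<^sup>2 / 4)
    / (\<J> (x\<^sup>2 * y\<^sup>2 / (4 * t\<^sup>2)) * \<J> (c\<^sup>2 * \<xi>\<^sup>2 / 4))"

lemma measurable_ratio [measurable]: "(\<lambda>y. ratio \<xi> t y) \<in> borel_measurable borel"
  unfolding ratio_def by measurable

lemma ratio_pos: "0 < ratio \<xi> t y"
  unfolding ratio_def by (intro divide_pos_pos mult_pos_pos J_pos) simp_all

lemmas ratio_nonneg = ratio_pos[THEN less_imp_le]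

lemma bessel_density_ratio:
  "0 < t \<Longrightarrow> bessel_density \<nu> c t x y * ratio \<xi> t y = bessel_density \<nu> c t \<xi> y"
proof -
  assume t: "0 < t"
  have "exp (- (c\<^sup>2 * t / 2) - (x\<^sup>2 + y\<^sup>2) / (2 * t)) * exp ((x\<^sup>2 - \<xi>\<^sup>2) / (2 * t)) = exp (- (c\<^sup>2 * t / 2) - (\<xi>\<^sup>2 + y\<^sup>2) / (2 * t))"
    unfolding exp_add[symmetric] using t by (intro arg_cong[where f = exp]) (simp add: field_simps)
  moreover have "e1 * J1 * J2 * Y / (T * K) * (e2 * J1' * K / (J1 * K')) = Y * (e1 * e2) * J1' * J2 / (T * K')"
    if "J1 \<noteq> 0" "K \<noteq> 0" for e1 J1 J2 Y T K e2 J1' K' :: real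
    using that by (simp add: field_simps)
  ultimately show ?thesis unfolding bessel_density_def ratio_def
    using J_pos[of "x\<^sup>2 * y\<^sup>2 / (4 * t\<^sup>2)"] J_pos[of "c\<^sup>2 * x\<^sup>2 / 4"]
    by (simp add: mult_ac)
qed

lemma nn_integral_ratio:
  assumes t: "0 < t" and u[measurable]: "u \<in> borel_measurable borel"
  shows "(\<integral>\<^sup>+\<omega>. ennreal (ratio \<xi> t (R t \<omega>)) * u (R t \<omega>) \<partial>M) = transition t u \<xi>"
proof -
  have "(\<integral>\<^sup>+\<omega>. ennreal (ratio \<xi> t (R t \<omega>)) * u (R t \<omega>) \<partial>M) = transition t (\<lambda>y. ennreal (ratio \<xi> t y) * u y) x"
    by (rule nn_integral_R[OF t]) measurable
  also have "\<dots> = transition t u \<xi>"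
    unfolding transition_def
  proof (intro nn_integral_cong)
    fix y :: real
    have "ennreal (bessel_density \<nu> c t x y) * ennreal (ratio \<xi> t y) = ennreal (bessel_density \<nu> c t \<xi> y)"
      using bessel_density_nonneg[OF nu t] ratio_nonneg bessel_density_ratio[OF t]
      by (simp add: ennreal_mult[symmetric])
    then show "ennreal (bessel_density \<nu> c t x y) * (ennreal (ratio \<xi> t y) * u y) * indicator {0<..} y
      = ennreal (bessel_density \<nu> c t \<xi> y) * u y * indicator {0<..} y"
      by (auto split: split_indicator simp: mult.assoc[symmetric])
  qed
  finally show ?thesis .
qed

lemma transition_transition:
  assumes s: "0 < s" and r: "0 < r" and [measurable]: "u \<in> borel_measurable borel"
  shows "transition s (transition r u) z = transition (s + r) u z"
proof -
  have "transition s (transition r u) z = (\<integral>\<^sup>+y. \<integral>\<^sup>+w. (ennreal (bessel_density \<nu> c s z y) * ennreal (bessel_density \<nu> c r y w) * indicator {0<..} y) * (u w * indicator {0<..} w) \<partial>lborel \<partial>lborel)"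
    unfolding transition_def
  proof (intro nn_integral_cong)
    fix y :: real
    have "ennreal (bessel_density \<nu> c s z y) * (\<integral>\<^sup>+w. ennreal (bessel_density \<nu> c r y w) * u w * indicator {0<..} w \<partial>lborel) * indicator {0<..} y
      = (ennreal (bessel_density \<nu> c s z y) * indicator {0<..} y) * (\<integral>\<^sup>+w. ennreal (bessel_density \<nu> c r y w) * u w * indicator {0<..} w \<partial>lborel)"
      by (simp add: mult_ac)
    also have "\<dots> = (\<integral>\<^sup>+w. (ennreal (bessel_density \<nu> c s z y) * indicator {0<..} y) * (ennreal (bessel_density \<nu> c r y w) * u w * indicator {0<..} w) \<partial>lborel)"
      by (rule nn_integral_cmult[symmetric]) measurable
    finally show "ennreal (bessel_density \<nu> c s z y) * (\<integral>\<^sup>+w. ennreal (bessel_density \<nu> c r y w) * u w * indicator {0<..} w \<partial>lborel) * indicator {0<..} y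
      = (\<integral>\<^sup>+w. (ennreal (bessel_density \<nu> c s z y) * ennreal (bessel_density \<nu> c r y w) * indicator {0<..} y) * (u w * indicator {0<..} w) \<partial>lborel)"
      by (simp add: mult_ac)
  qed
  also have "\<dots> = (\<integral>\<^sup>+w. \<integral>\<^sup>+y. (ennreal (bessel_density \<nu> c s z y) * ennreal (bessel_density \<nu> c r y w) * indicator {0<..} y) * (u w * indicator {0<..} w) \<partial>lborel \<partial>lborel)"
    by (rule lborel_pair.Fubini') measurable
  also have "\<dots> = (\<integral>\<^sup>+w. (\<integral>\<^sup>+y. ennreal (bessel_density \<nu> c s z y) * ennreal (bessel_density \<nu> c r y w) * indicator {0<..} y \<partial>lborel) * (u w * indicator {0<..} w) \<partial>lborel)"
    by (intro nn_integral_cong nn_integral_multc) measurable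
  also have "\<dots> = transition (s + r) u z"
    unfolding bessel_density_chapman_kolmogorov[OF nu s r] transition_def by (simp add: mult.assoc)
  finally show ?thesis .
qed

lemma transition_one: "0 < t \<Longrightarrow> transition t (\<lambda>_. 1) z = 1"
  unfolding transition_def using nn_integral_bessel_density[OF nu, of t c z] by simp

definition cylinder :: "real set \<Rightarrow> (real \<Rightarrow> real set) \<Rightarrow> 'w set" where
  "cylinder J A = {\<omega>\<in>space M. \<forall>u\<in>J. R u \<omega> \<in> A u}"

text \<open>These finite-dimensional events are stable under intersection and generate the future,
  so an identity between finite measures need only be checked on them.\<close>

definition cylinders :: "real \<Rightarrow> 'w set set" where
  "cylinders t = {cylinder J A | J A. finite J \<and> J \<subseteq> {t..} \<and> (\<forall>u. A u \<in> sets borel)}"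

definition future :: "real \<Rightarrow> 'w measure" where
  "future t = sigma (space M) (cylinders t)"

lemma cylinders_subset: "cylinders t \<subseteq> Pow (space M)"
  by (auto simp: cylinders_def cylinder_def)

lemma sets_future: "sets (future t) = sigma_sets (space M) (cylinders t)"
  and space_future [simp]: "space (future t) = space M"
  unfolding future_def using cylinders_subset by (auto intro: sets_measure_of space_measure_of)

lemma Int_stable_cylinders: "Int_stable (cylinders t)"
proof (rule Int_stableI)
  fix B C assume "B \<in> cylinders t" "C \<in> cylinders t"
  then obtain J A J' A' where B: "B = cylinder J A" "finite J" "J \<subseteq> {t..}" "\<forall>u. A u \<in> sets borel"
    and C: "C = cylinder J' A'" "finite J'" "J' \<subseteq> {t..}" "\<forall>u. A' u \<in> sets borel"
    unfolding cylinders_def by auto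
  let ?A = "\<lambda>u. (if u \<in> J then A u else UNIV) \<inter> (if u \<in> J' then A' u else UNIV)"
  have "B \<inter> C = cylinder (J \<union> J') ?A"
    unfolding B C cylinder_def by auto
  moreover have "?A u \<in> sets borel" for u using B C by auto
  ultimately show "B \<inter> C \<in> cylinders t"
    unfolding cylinders_def using B C by (intro CollectI exI[of _ "J \<union> J'"] exI[of _ ?A]) auto
qed

lemma cylinder_in_future: "finite J \<Longrightarrow> J \<subseteq> {t..} \<Longrightarrow> (\<And>u. A u \<in> sets borel) \<Longrightarrow> cylinder J A \<in> sets (future t)"
  unfolding sets_future by (rule sigma_sets.Basic) (auto simp: cylinders_def)

lemma measurable_R_future: "t \<le> u \<Longrightarrow> R u \<in> borel_measurable (future t)"
proof (rule measurableI)
  fix A :: "real set" assume "t \<le> u" "A \<in> sets borel"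
  then have "cylinder {u} (\<lambda>_. A) \<in> sets (future t)" by (intro cylinder_in_future) auto
  also have "cylinder {u} (\<lambda>_. A) = R u -` A \<inter> space (future t)" by (auto simp: cylinder_def)
  finally show "R u -` A \<inter> space (future t) \<in> sets (future t)" .
qed simp

lemma subalgebra_future: "0 \<le> t \<Longrightarrow> subalgebra M (future t)"
proof -
  assume t: "0 \<le> t"
  have "cylinder J A \<in> sets M" if J: "finite J" "J \<subseteq> {t..}" "\<forall>u. A u \<in> sets borel" for J A
  proof -
    have "cylinder J A = (\<Inter>u\<in>J. R u -` A u \<inter> space M) \<inter> space M"
      by (auto simp: cylinder_def)
    also have "\<dots> \<in> sets M"
    proof (cases "J = {}")
      case False
      have "(\<Inter>u\<in>J. R u -` A u \<inter> space M) \<in> sets M"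
        using J False t by (intro sets.finite_INT measurable_sets[OF measurable_R]) auto
      then show ?thesis by blast
    qed simp
    finally show ?thesis .
  qed
  then show ?thesis
    unfolding subalgebra_def sets_future by (auto simp: cylinders_def intro!: sets.sigma_sets_subset)
qed

text \<open>Weighting by the ratio at time s replaces the starting point x by \<xi> for the law of R
  s, and the Markov property carries this over to all later times. By Chapman-Kolmogorov the
  resulting law of the future of t no longer depends on s.\<close>

lemma reverse_martingale_cylinder:
  assumes s: "0 < s" and st: "s < t" and J: "finite J" "J \<subseteq> {t..}" and A: "\<And>u. A u \<in> sets borel"
  shows "(\<integral>\<^sup>+\<omega>. ennreal (ratio \<xi> s (R s \<omega>)) * indicator (cylinder J A) \<omega> \<partial>M)
    = (\<integral>\<^sup>+\<omega>. ennreal (ratio \<xi> t (R t \<omega>)) * indicator (cylinder J A) \<omega> \<partial>M)"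
proof -
  note A[measurable]
  \<comment> \<open>\<open>future_conditioning\<close> admits only times strictly after t. A
    constraint at t itself is moved into the factor that is measurable with respect to
    \<open>past t\<close>.\<close>
  define A0 where "A0 = (if t \<in> J then A t else UNIV)"
  have A0[measurable]: "A0 \<in> sets borel" using A by (simp add: A0_def)
  define J' where "J' = J - {t}"
  have J': "finite J'" "\<forall>u\<in>J'. t < u" using J by (auto simp: J'_def)
  obtain V where V[measurable]: "V \<in> borel_measurable borel" and
    Veq: "\<And>Y. Y \<in> borel_measurable (past t) \<Longrightarrow>
      (\<integral>\<^sup>+\<omega>. Y \<omega> * (\<Prod>u\<in>J'. indicator (A u) (R u \<omega>)) \<partial>M) = (\<integral>\<^sup>+\<omega>. Y \<omega> * V (R t \<omega>) \<partial>M)"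
    using future_conditioning[OF J'(1), of t A] J' s st A by auto
  have ind: "indicator (cylinder J A) \<omega> = indicator A0 (R t \<omega>) * (\<Prod>u\<in>J'. indicator (A u) (R u \<omega>) :: ennreal)"
    if "\<omega> \<in> space M" for \<omega>
  proof -
    have "indicator (cylinder J A) \<omega> = (\<Prod>u\<in>J. indicator (A u) (R u \<omega>) :: ennreal)"
    proof (cases "\<forall>u\<in>J. R u \<omega> \<in> A u")
      case True then show ?thesis using that by (simp add: cylinder_def)
    next
      case False
      then obtain u where "u \<in> J" "R u \<omega> \<notin> A u" by auto
      then have "(\<Prod>u\<in>J. indicator (A u) (R u \<omega>) :: ennreal) = 0"
        using J(1) by (intro prod_zero bexI[of _ u]) auto
      then show ?thesis using False by (simp add: cylinder_def)
    qed
    also have "\<dots> = indicator A0 (R t \<omega>) * (\<Prod>u\<in>J'. indicator (A u) (R u \<omega>))"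
      using J(1) by (auto simp: A0_def J'_def prod.remove)
    finally show ?thesis .
  qed
  have R1[measurable]: "R s \<in> borel_measurable (past t)" "R t \<in> borel_measurable (past t)" "R s \<in> borel_measurable (past s)"
    using s st by (auto intro!: measurable_R_past)
  have "(\<integral>\<^sup>+\<omega>. ennreal (ratio \<xi> s (R s \<omega>)) * indicator (cylinder J A) \<omega> \<partial>M)
    = (\<integral>\<^sup>+\<omega>. (ennreal (ratio \<xi> s (R s \<omega>)) * indicator A0 (R t \<omega>)) * (\<Prod>u\<in>J'. indicator (A u) (R u \<omega>)) \<partial>M)"
    by (intro nn_integral_cong) (simp add: ind mult.assoc)
  also have "\<dots> = (\<integral>\<^sup>+\<omega>. (ennreal (ratio \<xi> s (R s \<omega>)) * indicator A0 (R t \<omega>)) * V (R t \<omega>) \<partial>M)"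
    by (rule Veq) measurable
  also have "\<dots> = (\<integral>\<^sup>+\<omega>. ennreal (ratio \<xi> s (R s \<omega>)) * (indicator A0 (R (s + (t - s)) \<omega>) * V (R (s + (t - s)) \<omega>)) \<partial>M)"
    by (simp add: mult.assoc)
  also have "\<dots> = (\<integral>\<^sup>+\<omega>. ennreal (ratio \<xi> s (R s \<omega>)) * transition (t - s) (\<lambda>y. indicator A0 y * V y) (R s \<omega>) \<partial>M)"
    by (rule markov_nn_integral) (use s st in \<open>auto intro!: measurable_compose[OF R1(3)]\<close>)
  also have "\<dots> = transition s (transition (t - s) (\<lambda>y. indicator A0 y * V y)) \<xi>"
    by (rule nn_integral_ratio[OF s]) measurable
  also have "\<dots> = transition t (\<lambda>y. indicator A0 y * V y) \<xi>"
    using s st by (subst transition_transition) auto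
  also have "\<dots> = (\<integral>\<^sup>+\<omega>. ennreal (ratio \<xi> t (R t \<omega>)) * (indicator A0 (R t \<omega>) * V (R t \<omega>)) \<partial>M)"
    by (rule nn_integral_ratio[symmetric]) (use s st in auto)
  also have "\<dots> = (\<integral>\<^sup>+\<omega>. (ennreal (ratio \<xi> t (R t \<omega>)) * indicator A0 (R t \<omega>)) * V (R t \<omega>) \<partial>M)"
    by (simp add: mult.assoc)
  also have "\<dots> = (\<integral>\<^sup>+\<omega>. (ennreal (ratio \<xi> t (R t \<omega>)) * indicator A0 (R t \<omega>)) * (\<Prod>u\<in>J'. indicator (A u) (R u \<omega>)) \<partial>M)"
    by (rule Veq[symmetric]) measurable
  also have "\<dots> = (\<integral>\<^sup>+\<omega>. ennreal (ratio \<xi> t (R t \<omega>)) * indicator (cylinder J A) \<omega> \<partial>M)"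
    by (intro nn_integral_cong) (simp add: ind mult.assoc)
  finally show ?thesis .
qed

text \<open>Both sides are measures in D on \<open>future t\<close> that agree on the cylinders;
  they are finite because the density from \<xi> has total mass 1.\<close>

lemma reverse_martingale:
  assumes s: "0 < s" and st: "s \<le> t" and D: "D \<in> sets (future t)"
  shows "(\<integral>\<^sup>+\<omega>. ennreal (ratio \<xi> s (R s \<omega>)) * indicator D \<omega> \<partial>M)
    = (\<integral>\<^sup>+\<omega>. ennreal (ratio \<xi> t (R t \<omega>)) * indicator D \<omega> \<partial>M)"
proof (cases "s = t")
  case False
  then have lt: "s < t" using st by simp
  have t: "0 < t" using s st by simp
  have Rm[measurable]: "R s \<in> borel_measurable M" "R t \<in> borel_measurable M" using s t by (auto intro: measurable_R)
  define N where "N r = density M (\<lambda>\<omega>. ennreal (ratio \<xi> r (R r \<omega>)))" for r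
  have sub: "subalgebra (N r) (future t)" for r
    using subalgebra_future[of t] t by (auto simp: subalgebra_def N_def)
  have em: "emeasure (restr_to_subalg (N r) (future t)) D = (\<integral>\<^sup>+\<omega>. ennreal (ratio \<xi> r (R r \<omega>)) * indicator D \<omega> \<partial>M)"
    if D: "D \<in> sets (future t)" and r: "r = s \<or> r = t" for D r
  proof -
    have [measurable]: "D \<in> sets M" using D subalgebra_future[of t] t by (auto simp: subalgebra_def)
    have "emeasure (N r) D = (\<integral>\<^sup>+\<omega>. ennreal (ratio \<xi> r (R r \<omega>)) * indicator D \<omega> \<partial>M)"
      unfolding N_def using r by (intro emeasure_density) auto
    then show ?thesis using emeasure_restr_to_subalg[OF sub D] by simp
  qed
  have "restr_to_subalg (N s) (future t) = restr_to_subalg (N t) (future t)"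
  proof (rule measure_eqI_generator_eq[OF Int_stable_cylinders cylinders_subset, where A = "\<lambda>_. space M"])
    fix B assume B: "B \<in> cylinders t"
    then have Bf: "B \<in> sets (future t)" unfolding sets_future by (rule sigma_sets.Basic)
    from B obtain J A where B': "B = cylinder J A" "finite J" "J \<subseteq> {t..}" "\<forall>u. A u \<in> sets borel"
      unfolding cylinders_def by auto
    then have "(\<integral>\<^sup>+\<omega>. ennreal (ratio \<xi> s (R s \<omega>)) * indicator B \<omega> \<partial>M)
      = (\<integral>\<^sup>+\<omega>. ennreal (ratio \<xi> t (R t \<omega>)) * indicator B \<omega> \<partial>M)"
      unfolding B'(1) by (intro reverse_martingale_cylinder[OF s lt]) auto
    then show "emeasure (restr_to_subalg (N s) (future t)) B = emeasure (restr_to_subalg (N t) (future t)) B"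
      using em[OF Bf, of s] em[OF Bf, of t] by simp
  next
    show "sets (restr_to_subalg (N s) (future t)) = sigma_sets (space M) (cylinders t)"
      "sets (restr_to_subalg (N t) (future t)) = sigma_sets (space M) (cylinders t)"
      using sub by (simp_all add: sets_restr_to_subalg sets_future)
    have "space M = cylinder {} (\<lambda>_. UNIV)" by (auto simp: cylinder_def)
    then show "range (\<lambda>_::nat. space M) \<subseteq> cylinders t"
      unfolding cylinders_def by (auto intro!: exI[of _ "{}"] exI[of _ "\<lambda>_. UNIV"])
    have "emeasure (restr_to_subalg (N s) (future t)) (space M) = (\<integral>\<^sup>+\<omega>. ennreal (ratio \<xi> s (R s \<omega>)) * 1 \<partial>M)"
      using sets.top[of "future t"] by (subst em) (auto intro!: nn_integral_cong)
    also have "\<dots> = 1"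
      using nn_integral_ratio[OF s, of "\<lambda>_. 1" \<xi>] transition_one[OF s] by simp
    finally show "emeasure (restr_to_subalg (N s) (future t)) (space M) \<noteq> \<infinity>" by simp
  qed auto
  then show ?thesis using em[OF D] by metis
qed simp


section \<open>The curve and its last hit in a compact interval of time\<close>

definition curve :: "real \<Rightarrow> real" where "curve t = sqrt (a * t\<^sup>2 + b * t)"

lemma a_pos: "0 < a"
proof -
  have "0 < sqrt a" using c sqrt_a by linarith
  then show ?thesis by simp
qed

lemma c_square_less: "c\<^sup>2 < a"
proof -
  have "c\<^sup>2 < (sqrt a)\<^sup>2" using c sqrt_a by (intro power_strict_mono) auto
  then show ?thesis using a_pos by simp
qed

lemma curve_square: "0 \<le> t \<Longrightarrow> (curve t)\<^sup>2 = a * t\<^sup>2 + b * t"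
  using a_pos b by (simp add: curve_def)

lemma curve_nonneg: "0 \<le> t \<Longrightarrow> 0 \<le> curve t"
  using a_pos b by (simp add: curve_def)

lemma continuous_on_curve: "continuous_on A curve"
  unfolding curve_def[abs_def] by (intro continuous_intros)

lemma measurable_curve [measurable]: "curve \<in> borel_measurable borel"
  unfolding curve_def[abs_def] by measurable

definition hit :: "real \<Rightarrow> real \<Rightarrow> 'w set" where
  "hit s K = {\<omega> \<in> space M. \<exists>t\<in>{s..K}. R t \<omega> = curve t}"

text \<open>A continuous path meets the curve in a compact interval exactly if its distance to the
  curve becomes arbitrarily small along a countable dense set of times, because the minimal distance
  is attained.\<close>

lemma hit_in_future:
  assumes s: "0 \<le> s"
  shows "hit s K \<in> sets (future s)"
proof (cases "s \<le> K")
  case False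
  then have "hit s K = {}" by (auto simp: hit_def)
  then show ?thesis by simp
next
  case True
  \<comment> \<open>The end point s is included because the interval may be the single point s;
    every later time is approximated by rationals from below.\<close>
  define Q where "Q = insert s ({s..K} \<inter> \<rat>)"
  have Q: "Q \<subseteq> {s..K}" "countable Q" "Q \<noteq> {}"
    using True countable_rat by (auto simp: Q_def)
  have dense: "\<exists>q\<in>Q. \<bar>q - t\<bar> < d" if "t \<in> {s..K}" "0 < d" for t d
  proof (cases "t = s")
    case False
    then have "max s (t - d) < t" using that by auto
    then obtain q where "q \<in> \<rat>" "max s (t - d) < q" "q < t" using Rats_dense_in_real by blast
    then show ?thesis using that by (intro bexI[of _ q]) (auto simp: Q_def)
  qed (use that in \<open>auto simp: Q_def\<close>)
  have "hit s K = (\<Inter>n. \<Union>q\<in>Q. {\<omega> \<in> space (future s). \<bar>R q \<omega> - curve q\<bar> < 1 / real (Suc n)})"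
  proof (intro set_eqI iffI)
    fix \<omega> assume "\<omega> \<in> hit s K"
    then obtain t where w: "\<omega> \<in> space M" and t: "t \<in> {s..K}" "R t \<omega> = curve t" by (auto simp: hit_def)
    have "\<exists>q\<in>Q. \<bar>R q \<omega> - curve q\<bar> < 1 / real (Suc n)" for n
    proof -
      have "continuous_on {s..K} (\<lambda>t. R t \<omega> - curve t)"
        using s by (intro continuous_on_diff continuous_on_curve continuous_on_subset[OF continuous_R[OF w]]) auto
      then obtain d where "0 < d" "\<And>u. u \<in> {s..K} \<Longrightarrow> dist u t < d \<Longrightarrow> dist (R u \<omega> - curve u) (R t \<omega> - curve t) < 1 / real (Suc n)"
        using t(1) unfolding continuous_on_iff by (metis of_nat_0_less_iff zero_less_Suc zero_less_divide_1_iff)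
      moreover obtain q where "q \<in> Q" "\<bar>q - t\<bar> < d" using dense[OF t(1) \<open>0 < d\<close>] by auto
      ultimately show ?thesis using Q t by (intro bexI[of _ q]) (auto simp: dist_real_def)
    qed
    then show "\<omega> \<in> (\<Inter>n. \<Union>q\<in>Q. {\<omega> \<in> space (future s). \<bar>R q \<omega> - curve q\<bar> < 1 / real (Suc n)})"
      using w by auto
  next
    fix \<omega> assume w': "\<omega> \<in> (\<Inter>n. \<Union>q\<in>Q. {\<omega> \<in> space (future s). \<bar>R q \<omega> - curve q\<bar> < 1 / real (Suc n)})"
    then have w: "\<omega> \<in> space M" by auto
    have "continuous_on {s..K} (\<lambda>t. \<bar>R t \<omega> - curve t\<bar>)"
      using s by (intro continuous_on_rabs continuous_on_diff continuous_on_curve continuous_on_subset[OF continuous_R[OF w]]) auto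
    then have "\<exists>t\<in>{s..K}. \<forall>u\<in>{s..K}. \<bar>R t \<omega> - curve t\<bar> \<le> \<bar>R u \<omega> - curve u\<bar>"
      using True by (intro continuous_attains_inf) simp_all
    then obtain t where t: "t \<in> {s..K}" "\<And>u. u \<in> {s..K} \<Longrightarrow> \<bar>R t \<omega> - curve t\<bar> \<le> \<bar>R u \<omega> - curve u\<bar>"
      by blast
    have close: "\<exists>q\<in>Q. \<bar>R q \<omega> - curve q\<bar> < 1 / real (Suc n)" for n
    proof -
      have "\<omega> \<in> (\<Union>q\<in>Q. {\<omega> \<in> space (future s). \<bar>R q \<omega> - curve q\<bar> < 1 / real (Suc n)})"
        using w' by (rule INT_D) simp
      then show ?thesis by (simp only: UN_iff mem_Collect_eq) blast
    qed
    have le: "\<bar>R t \<omega> - curve t\<bar> \<le> e" if e: "0 < e" for e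
    proof -
      obtain n where "1 / real (Suc n) < e" using nat_approx_posE[OF e] by auto
      moreover obtain q where "q \<in> Q" "\<bar>R q \<omega> - curve q\<bar> < 1 / real (Suc n)" using close by blast
      moreover have "\<bar>R t \<omega> - curve t\<bar> \<le> \<bar>R q \<omega> - curve q\<bar>" using t(2) Q \<open>q \<in> Q\<close> by blast
      ultimately show ?thesis by linarith
    qed
    have "\<bar>R t \<omega> - curve t\<bar> \<le> 0"
    proof (rule field_le_epsilon)
      show "\<bar>R t \<omega> - curve t\<bar> \<le> 0 + e" if "0 < e" for e using le[OF that] by simp
    qed
    then have "R t \<omega> = curve t" by simp
    then show "\<omega> \<in> hit s K" using w t(1) unfolding hit_def by blast
  qed
  also have "\<dots> \<in> sets (future s)"
  proof (rule sets.countable_INT')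
    have "(\<Union>q\<in>Q. {\<omega> \<in> space (future s). \<bar>R q \<omega> - curve q\<bar> < 1 / real (Suc n)}) \<in> sets (future s)" for n
    proof (rule sets.countable_UN'[OF Q(2)], rule image_subsetI)
      fix q assume "q \<in> Q"
      then have [measurable]: "R q \<in> borel_measurable (future s)" using Q by (intro measurable_R_future) auto
      show "{\<omega> \<in> space (future s). \<bar>R q \<omega> - curve q\<bar> < 1 / real (Suc n)} \<in> sets (future s)" by measurable
    qed
    then show "range (\<lambda>n. \<Union>q\<in>Q. {\<omega> \<in> space (future s). \<bar>R q \<omega> - curve q\<bar> < 1 / real (Suc n)}) \<subseteq> sets (future s)" by blast
  qed simp_all
  finally show ?thesis .
qed

lemma future_mono: "s \<le> t \<Longrightarrow> D \<in> sets (future t) \<Longrightarrow> D \<in> sets (future s)"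
proof -
  assume st: "s \<le> t" "D \<in> sets (future t)"
  have "{t..} \<subseteq> {s..}" using st by simp
  have "cylinders t \<subseteq> cylinders s"
  proof
    fix B assume "B \<in> cylinders t"
    then obtain J A where B: "B = cylinder J A" "finite J" "J \<subseteq> {t..}" "\<forall>u. A u \<in> sets borel"
      unfolding cylinders_def by auto
    moreover have "J \<subseteq> {s..}" using B(3) \<open>{t..} \<subseteq> {s..}\<close> by (rule order_trans)
    ultimately show "B \<in> cylinders s" unfolding cylinders_def by blast
  qed
  then show ?thesis using st sigma_sets_mono'[of "cylinders t" "cylinders s"] by (auto simp: sets_future)
qed

lemma future_subset: "0 \<le> t \<Longrightarrow> D \<in> sets (future t) \<Longrightarrow> D \<in> sets M"
  using subalgebra_future by (auto simp: subalgebra_def)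

lemma sets_hit [measurable]: "0 \<le> s \<Longrightarrow> hit s K \<in> sets M"
  by (rule future_subset[OF _ hit_in_future])

lemma hit_antimono: "s \<le> t \<Longrightarrow> hit t K \<subseteq> hit s K"
  by (auto simp: hit_def)

definition last_hit :: "real \<Rightarrow> real \<Rightarrow> 'w \<Rightarrow> real" where
  "last_hit s K \<omega> = Sup {t\<in>{s..K}. R t \<omega> = curve t}"

lemma last_hit:
  assumes s: "0 \<le> s" and w: "\<omega> \<in> hit s K"
  shows "last_hit s K \<omega> \<in> {s..K}" "R (last_hit s K \<omega>) \<omega> = curve (last_hit s K \<omega>)"
    "\<And>t. t \<in> {s..K} \<Longrightarrow> R t \<omega> = curve t \<Longrightarrow> t \<le> last_hit s K \<omega>"
proof -
  let ?T = "{t\<in>{s..K}. R t \<omega> = curve t}"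
  have wM: "\<omega> \<in> space M" using w by (simp add: hit_def)
  have "continuous_on {s..K} (\<lambda>t. R t \<omega> - curve t)"
    using s by (intro continuous_on_diff continuous_on_curve continuous_on_subset[OF continuous_R[OF wM]]) auto
  then have "closed ({s..K} \<inter> (\<lambda>t. R t \<omega> - curve t) -` {0})"
    by (rule continuous_closed_preimage) auto
  moreover have "{s..K} \<inter> (\<lambda>t. R t \<omega> - curve t) -` {0} = ?T" by auto
  ultimately have cl: "closed ?T" by simp
  have ne: "?T \<noteq> {}" using w by (auto simp: hit_def)
  have bd: "bdd_above ?T" by (rule bdd_aboveI[of _ K]) auto
  have "Sup ?T \<in> ?T" by (rule closed_contains_Sup[OF ne bd cl])
  then show "last_hit s K \<omega> \<in> {s..K}" "R (last_hit s K \<omega>) \<omega> = curve (last_hit s K \<omega>)"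
    by (auto simp: last_hit_def)
  show "t \<le> last_hit s K \<omega>" if "t \<in> {s..K}" "R t \<omega> = curve t" for t
    unfolding last_hit_def using that by (intro cSup_upper bd) auto
qed

text \<open>The event that the last hit is at least t is \<open>hit t K\<close>, an element of
  \<open>future t\<close>. This makes the last hit a stopping time when time runs backwards.\<close>

lemma last_hit_ge_iff:
  assumes "0 \<le> s" "\<omega> \<in> hit s K" "s \<le> t"
  shows "t \<le> last_hit s K \<omega> \<longleftrightarrow> \<omega> \<in> hit t K"
proof
  assume "t \<le> last_hit s K \<omega>"
  then show "\<omega> \<in> hit t K" using last_hit(1,2)[OF assms(1,2)] assms(2) by (auto simp: hit_def)
next
  assume "\<omega> \<in> hit t K"
  then obtain u where "u \<in> {t..K}" "R u \<omega> = curve u" by (auto simp: hit_def)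
  then have "u \<le> last_hit s K \<omega>" using assms(3) by (intro last_hit(3)[OF assms(1,2)]) auto
  then show "t \<le> last_hit s K \<omega>" using \<open>u \<in> {t..K}\<close> by simp
qed

text \<open>J is increasing and at least J(0), so the ratio is bounded as long as t stays away from
  0 and y / t stays bounded. The dominating constants of the stopping arguments come from
  here.\<close>

lemma ratio_bound:
  assumes e: "0 < \<epsilon>" "\<epsilon> \<le> t" and y: "y\<^sup>2 / t\<^sup>2 \<le> r"
  shows "ratio \<xi> t y \<le> exp (x\<^sup>2 / (2 * \<epsilon>)) * \<J> (\<xi>\<^sup>2 * r / 4) * \<J> (c\<^sup>2 * x\<^sup>2 / 4) / (\<J> 0 * \<J> (c\<^sup>2 * \<xi>\<^sup>2 / 4))"
proof -
  have r: "0 \<le> r" using order_trans[OF _ y] by simp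
  show ?thesis unfolding ratio_def
  proof (intro frac_le mult_mono mult_nonneg_nonneg less_imp_le[OF J_pos] order.refl mult_pos_pos J_pos)
  have "(x\<^sup>2 - \<xi>\<^sup>2) / (2 * t) \<le> x\<^sup>2 / (2 * t)" using e by (intro divide_right_mono) auto
  also have "\<dots> \<le> x\<^sup>2 / (2 * \<epsilon>)" using e by (intro divide_left_mono) auto
  finally show "exp ((x\<^sup>2 - \<xi>\<^sup>2) / (2 * t)) \<le> exp (x\<^sup>2 / (2 * \<epsilon>))" by simp
  have "\<xi>\<^sup>2 * (y\<^sup>2 / t\<^sup>2) \<le> \<xi>\<^sup>2 * r" using y by (intro mult_left_mono) auto
  then show "\<J> (\<xi>\<^sup>2 * y\<^sup>2 / (4 * t\<^sup>2)) \<le> \<J> (\<xi>\<^sup>2 * r / 4)"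
    by (intro bessel_clifford_mono[OF nu]) auto
  show "\<J> 0 \<le> \<J> (x\<^sup>2 * y\<^sup>2 / (4 * t\<^sup>2))" by (intro bessel_clifford_mono[OF nu]) auto
qed (use r in \<open>simp_all add: zero_le_mult_iff\<close>)
qed

lemma tendsto_ratio:
  assumes "(f \<longlongrightarrow> t) F" "(g \<longlongrightarrow> y) F" "t \<noteq> 0"
  shows "((\<lambda>n. ratio \<xi> (f n) (g n)) \<longlongrightarrow> ratio \<xi> t y) F"
proof -
  have "\<J> (x\<^sup>2 * y\<^sup>2 / (4 * t\<^sup>2)) * \<J> (c\<^sup>2 * \<xi>\<^sup>2 / 4) \<noteq> 0"
    using J_pos[of "x\<^sup>2 * y\<^sup>2 / (4 * t\<^sup>2)"] J_pos[of "c\<^sup>2 * \<xi>\<^sup>2 / 4"] by simp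
  then show ?thesis unfolding ratio_def
    using assms by (intro tendsto_divide tendsto_mult tendsto_exp tendsto_diff tendsto_const tendsto_power
        tendsto_bessel_clifford[OF nu]) simp_all
qed

lemma nn_integral_ratio_space: "0 < t \<Longrightarrow> (\<integral>\<^sup>+\<omega>. ennreal (ratio \<xi> t (R t \<omega>)) \<partial>M) = 1"
  using nn_integral_ratio[of t "\<lambda>_. 1" \<xi>] transition_one[of t \<xi>] by simp

text \<open>Optional stopping for the reverse martingale at the last time in \<open>[\<epsilon>, K]\<close> at which the
  process meets the curve. The stopping time is discretised from below; the truncation
  \<open>R \<le> \<rho>\<close> makes the discretised values bounded, and disappears in the limit.\<close>

lemma optional_stopping:
  assumes e: "0 < \<epsilon>" "\<epsilon> < K"
  shows "(\<integral>\<^sup>+\<omega>. ennreal (ratio \<xi> (last_hit \<epsilon> K \<omega>) (curve (last_hit \<epsilon> K \<omega>))) * indicator (hit \<epsilon> K) \<omega> \<partial>M)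
    = (\<integral>\<^sup>+\<omega>. ennreal (ratio \<xi> \<epsilon> (R \<epsilon> \<omega>)) * indicator (hit \<epsilon> K) \<omega> \<partial>M)"
proof -
  have e0: "0 \<le> \<epsilon>" using e by simp
  \<comment> \<open>The inequality is strict so that R at the discretised times, which converges to
    a point of the curve, is eventually below \<rho>.\<close>
  obtain \<rho> where rho: "\<And>t. t \<in> {\<epsilon>..K} \<Longrightarrow> curve t < \<rho>" "0 < \<rho>"
  proof -
    obtain u where "u \<in> {\<epsilon>..K}" "\<And>t. t \<in> {\<epsilon>..K} \<Longrightarrow> curve t \<le> curve u"
      using continuous_attains_sup[of "{\<epsilon>..K}" curve] continuous_on_curve e by auto
    moreover have "0 \<le> curve u" using calculation e by (intro curve_nonneg) auto
    ultimately show thesis by (intro that[of "curve u + 1"]) force+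
  qed
  define d where "d n = (K - \<epsilon>) / real (Suc n)" for n
  define g where "g n k = \<epsilon> + real k * d n" for n k :: nat
  define idx where "idx n \<omega> = nat \<lfloor>(last_hit \<epsilon> K \<omega> - \<epsilon>) / d n\<rfloor>" for n \<omega>
  \<comment> \<open>On this event the last hit lies between \<open>g n k\<close> and
    \<open>g n (Suc k)\<close>. It is decided by the future of the left end point but not by that of
    the right one, hence the rounding down.\<close>
  define D where "D n k = (hit (g n k) K - hit (g n (Suc k)) K) \<inter> {\<omega> \<in> space M. R (g n k) \<omega> \<le> \<rho>}" for n k
  have d: "0 < d n" for n using e by (simp add: d_def)
  have ge: "\<epsilon> \<le> g n k" for n k using d[of n] by (simp add: g_def)
  have Df: "D n k \<in> sets (future (g n k))" for n k
  proof -
    have [measurable]: "R (g n k) \<in> borel_measurable (future (g n k))" by (rule measurable_R_future) simp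
    have "{\<omega> \<in> space (future (g n k)). R (g n k) \<omega> \<le> \<rho>} \<in> sets (future (g n k))" by measurable
    moreover have "hit (g n (Suc k)) K \<in> sets (future (g n k))"
      using e0 ge[of n "Suc k"] d[of n] by (intro future_mono[OF _ hit_in_future]) (auto simp: g_def algebra_simps)
    moreover have "hit (g n k) K \<in> sets (future (g n k))"
      using e0 ge[of n k] by (intro hit_in_future) auto
    ultimately show ?thesis unfolding D_def by auto
  qed
  have DM[measurable]: "D n k \<in> sets M" for n k
    by (rule future_subset[OF _ Df]) (use e0 ge[of n k] in auto)
  have Rm[measurable]: "R (g n k) \<in> borel_measurable M" "R \<epsilon> \<in> borel_measurable M" for n k
    using e0 ge[of n k] by (auto intro: measurable_R)
  \<comment> \<open>The sum includes the index Suc n, which occurs when the last hit is K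
    itself.\<close>
  define X where "X n \<omega> = (\<Sum>k\<le>Suc n. ennreal (ratio \<xi> (g n k) (R (g n k) \<omega>)) * indicator (D n k) \<omega>)" for n \<omega>
  define Y where "Y n \<omega> = (\<Sum>k\<le>Suc n. ennreal (ratio \<xi> \<epsilon> (R \<epsilon> \<omega>)) * indicator (D n k) \<omega>)" for n \<omega>
  have XY: "integral\<^sup>N M (X n) = integral\<^sup>N M (Y n)" for n
  proof -
    have "integral\<^sup>N M (X n) = (\<Sum>k\<le>Suc n. \<integral>\<^sup>+\<omega>. ennreal (ratio \<xi> (g n k) (R (g n k) \<omega>)) * indicator (D n k) \<omega> \<partial>M)"
      unfolding X_def by (rule nn_integral_sum) measurable
    also have "\<dots> = (\<Sum>k\<le>Suc n. \<integral>\<^sup>+\<omega>. ennreal (ratio \<xi> \<epsilon> (R \<epsilon> \<omega>)) * indicator (D n k) \<omega> \<partial>M)"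
      by (intro sum.cong refl reverse_martingale[symmetric, OF e(1) ge Df])
    also have "\<dots> = integral\<^sup>N M (Y n)"
      unfolding Y_def by (rule nn_integral_sum[symmetric]) measurable
    finally show ?thesis .
  qed
  have idx: "g n (idx n \<omega>) \<le> last_hit \<epsilon> K \<omega>" "last_hit \<epsilon> K \<omega> < g n (Suc (idx n \<omega>))" "idx n \<omega> \<le> Suc n"
    if w: "\<omega> \<in> hit \<epsilon> K" for n \<omega>
  proof -
    have lh: "\<epsilon> \<le> last_hit \<epsilon> K \<omega>" "last_hit \<epsilon> K \<omega> \<le> K" using last_hit(1)[OF e0 w] by auto
    then have nn: "0 \<le> (last_hit \<epsilon> K \<omega> - \<epsilon>) / d n" using d[of n] by simp
    then have fl: "real (idx n \<omega>) \<le> (last_hit \<epsilon> K \<omega> - \<epsilon>) / d n" "(last_hit \<epsilon> K \<omega> - \<epsilon>) / d n < real (Suc (idx n \<omega>))"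
      unfolding idx_def by (simp_all add: of_nat_nat) linarith+
    then show "g n (idx n \<omega>) \<le> last_hit \<epsilon> K \<omega>" "last_hit \<epsilon> K \<omega> < g n (Suc (idx n \<omega>))"
      using d[of n] by (simp_all add: g_def field_simps)
    have "(last_hit \<epsilon> K \<omega> - \<epsilon>) / d n \<le> (K - \<epsilon>) / d n" using lh d[of n] by (intro divide_right_mono) auto
    also have "\<dots> = real (Suc n)" using e by (simp add: d_def)
    finally show "idx n \<omega> \<le> Suc n" using fl(1) by linarith
  qed
  have Dk: "\<omega> \<in> D n k \<longleftrightarrow> \<omega> \<in> hit \<epsilon> K \<and> k = idx n \<omega> \<and> R (g n (idx n \<omega>)) \<omega> \<le> \<rho>" for \<omega> n k
  proof -
    have "\<omega> \<in> hit (g n k) K \<Longrightarrow> \<omega> \<in> hit \<epsilon> K" using hit_antimono[OF ge] by blast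
    moreover have "\<omega> \<in> hit \<epsilon> K \<Longrightarrow> \<omega> \<in> hit (g n k) K - hit (g n (Suc k)) K \<longleftrightarrow> k = idx n \<omega>"
    proof -
      assume w: "\<omega> \<in> hit \<epsilon> K"
      have "\<omega> \<in> hit (g n k) K - hit (g n (Suc k)) K \<longleftrightarrow> g n k \<le> last_hit \<epsilon> K \<omega> \<and> last_hit \<epsilon> K \<omega> < g n (Suc k)"
        using last_hit_ge_iff[OF e0 w ge[of n k]] last_hit_ge_iff[OF e0 w ge[of n "Suc k"]] by auto
      also have "\<dots> \<longleftrightarrow> k = idx n \<omega>"
      proof
        assume k: "g n k \<le> last_hit \<epsilon> K \<omega> \<and> last_hit \<epsilon> K \<omega> < g n (Suc k)"
        have "g n k < g n (Suc (idx n \<omega>))" "g n (idx n \<omega>) < g n (Suc k)" using idx(1,2)[OF w, of n] k by linarith+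
        then have "real k < real (Suc (idx n \<omega>))" "real (idx n \<omega>) < real (Suc k)"
          using d[of n] by (simp_all add: g_def)
        then show "k = idx n \<omega>" by linarith
      qed (use idx(1,2)[OF w, of n] in auto)
      finally show ?thesis .
    qed
    moreover have "\<omega> \<in> hit \<epsilon> K \<Longrightarrow> \<omega> \<in> space M" by (simp add: hit_def)
    ultimately show ?thesis unfolding D_def by blast
  qed
  have X: "X n \<omega> = ennreal (ratio \<xi> (g n (idx n \<omega>)) (R (g n (idx n \<omega>)) \<omega>)) * indicator {r. r \<le> \<rho>} (R (g n (idx n \<omega>)) \<omega>) * indicator (hit \<epsilon> K) \<omega>"
    and Y: "Y n \<omega> = ennreal (ratio \<xi> \<epsilon> (R \<epsilon> \<omega>)) * indicator {r. r \<le> \<rho>} (R (g n (idx n \<omega>)) \<omega>) * indicator (hit \<epsilon> K) \<omega>" for n \<omega>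
  proof -
    have "(\<Sum>k\<le>Suc n. q k * indicator (D n k) \<omega>) = q (idx n \<omega>) * indicator {r. r \<le> \<rho>} (R (g n (idx n \<omega>)) \<omega>) * indicator (hit \<epsilon> K) \<omega>"
      for q :: "nat \<Rightarrow> ennreal"
    proof (cases "\<omega> \<in> hit \<epsilon> K")
      case True
      have "(\<Sum>k\<le>Suc n. q k * indicator (D n k) \<omega>) = (\<Sum>k\<le>Suc n. if k = idx n \<omega> then q k * indicator {r. r \<le> \<rho>} (R (g n (idx n \<omega>)) \<omega>) else 0)"
        using True by (intro sum.cong refl) (auto simp: Dk split: split_indicator)
      then show ?thesis using idx(3)[OF True, of n] True by simp
    next
      case False
      then have "indicator (D n k) \<omega> = (0::ennreal)" for k by (simp add: Dk)
      then show ?thesis using False by simp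
    qed
    from this[of "\<lambda>k. ennreal (ratio \<xi> (g n k) (R (g n k) \<omega>))"] this[of "\<lambda>k. ennreal (ratio \<xi> \<epsilon> (R \<epsilon> \<omega>))"]
    show "X n \<omega> = ennreal (ratio \<xi> (g n (idx n \<omega>)) (R (g n (idx n \<omega>)) \<omega>)) * indicator {r. r \<le> \<rho>} (R (g n (idx n \<omega>)) \<omega>) * indicator (hit \<epsilon> K) \<omega>"
      "Y n \<omega> = ennreal (ratio \<xi> \<epsilon> (R \<epsilon> \<omega>)) * indicator {r. r \<le> \<rho>} (R (g n (idx n \<omega>)) \<omega>) * indicator (hit \<epsilon> K) \<omega>"
      by (simp_all add: X_def Y_def)
  qed
  have lim: "(\<lambda>n. g n (idx n \<omega>)) \<longlonglongrightarrow> last_hit \<epsilon> K \<omega>" "(\<lambda>n. R (g n (idx n \<omega>)) \<omega>) \<longlonglongrightarrow> curve (last_hit \<epsilon> K \<omega>)"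
    if w: "\<omega> \<in> hit \<epsilon> K" for \<omega>
  proof -
    have wM: "\<omega> \<in> space M" using w by (simp add: hit_def)
    have d0: "d \<longlonglongrightarrow> 0"
      unfolding d_def by (intro tendsto_divide_0[OF tendsto_const] filterlim_at_top_imp_at_infinity
          filterlim_compose[OF filterlim_real_sequentially filterlim_Suc])
    show l: "(\<lambda>n. g n (idx n \<omega>)) \<longlonglongrightarrow> last_hit \<epsilon> K \<omega>"
    proof (rule tendsto_sandwich)
      show "\<forall>\<^sub>F n in sequentially. last_hit \<epsilon> K \<omega> - d n \<le> g n (idx n \<omega>)"
        using idx(2)[OF w] by (intro always_eventually allI) (auto simp: g_def algebra_simps intro: less_imp_le)
      show "\<forall>\<^sub>F n in sequentially. g n (idx n \<omega>) \<le> last_hit \<epsilon> K \<omega>"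
        using idx(1)[OF w] by (intro always_eventually allI)
      show "(\<lambda>n. last_hit \<epsilon> K \<omega> - d n) \<longlonglongrightarrow> last_hit \<epsilon> K \<omega>"
        using tendsto_diff[OF tendsto_const d0, of "last_hit \<epsilon> K \<omega>"] by simp
    qed simp
    have "continuous_on {0..} (\<lambda>t. R t \<omega>)" by (rule continuous_R[OF wM])
    then have "(\<lambda>n. R (g n (idx n \<omega>)) \<omega>) \<longlonglongrightarrow> R (last_hit \<epsilon> K \<omega>) \<omega>"
    proof (rule continuous_on_tendsto_compose[OF _ l])
      show "last_hit \<epsilon> K \<omega> \<in> {0..}" using last_hit(1)[OF e0 w] e0 by auto
      show "\<forall>\<^sub>F n in sequentially. g n (idx n \<omega>) \<in> {0..}"
        using ge e0 by (intro always_eventually allI) (auto intro: order_trans)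
    qed
    then show "(\<lambda>n. R (g n (idx n \<omega>)) \<omega>) \<longlonglongrightarrow> curve (last_hit \<epsilon> K \<omega>)"
      using last_hit(2)[OF e0 w] by simp
  qed
  have ev: "\<forall>\<^sub>F n in sequentially. R (g n (idx n \<omega>)) \<omega> \<le> \<rho>" if w: "\<omega> \<in> hit \<epsilon> K" for \<omega>
    using order_tendstoD(2)[OF lim(2)[OF w] rho(1)[OF last_hit(1)[OF e0 w]]]
    by eventually_elim simp
  have Xm[measurable]: "X n \<in> borel_measurable M" and Ym[measurable]: "Y n \<in> borel_measurable M" for n
    unfolding X_def Y_def by measurable
  define X' where "X' \<omega> = ennreal (ratio \<xi> (last_hit \<epsilon> K \<omega>) (curve (last_hit \<epsilon> K \<omega>))) * indicator (hit \<epsilon> K) \<omega>" for \<omega>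
  define Y' where "Y' \<omega> = ennreal (ratio \<xi> \<epsilon> (R \<epsilon> \<omega>)) * indicator (hit \<epsilon> K) \<omega>" for \<omega>
  have limX: "(\<lambda>n. X n \<omega>) \<longlonglongrightarrow> X' \<omega>" for \<omega>
  proof (cases "\<omega> \<in> hit \<epsilon> K")
    case True
    have "(\<lambda>n. ennreal (ratio \<xi> (g n (idx n \<omega>)) (R (g n (idx n \<omega>)) \<omega>))) \<longlonglongrightarrow> X' \<omega>"
      unfolding X'_def using True e last_hit(1)[OF e0 True]
      by (simp, intro tendsto_ennrealI tendsto_ratio lim[OF True]) auto
    then show ?thesis
      by (rule Lim_transform_eventually) (use ev[OF True] in \<open>auto elim!: eventually_mono simp: X True\<close>)
  qed (simp add: X X'_def)
  have limY: "(\<lambda>n. Y n \<omega>) \<longlonglongrightarrow> Y' \<omega>" for \<omega>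
  proof (cases "\<omega> \<in> hit \<epsilon> K")
    case True
    show ?thesis
      by (rule tendsto_eventually) (use ev[OF True] in \<open>auto elim!: eventually_mono simp: Y Y'_def True\<close>)
  qed (simp add: Y Y'_def)
  have X'm: "X' \<in> borel_measurable M" by (rule borel_measurable_LIMSEQ_order[OF limX Xm])
  have Y'm: "Y' \<in> borel_measurable M" unfolding Y'_def using e0 by measurable
  define C where "C = exp (x\<^sup>2 / (2 * \<epsilon>)) * \<J> (\<xi>\<^sup>2 * (\<rho>\<^sup>2 / \<epsilon>\<^sup>2) / 4) * \<J> (c\<^sup>2 * x\<^sup>2 / 4) / (\<J> 0 * \<J> (c\<^sup>2 * \<xi>\<^sup>2 / 4))"
  have "(\<lambda>n. integral\<^sup>N M (X n)) \<longlonglongrightarrow> integral\<^sup>N M X'"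
  proof (rule nn_integral_dominated_convergence[where w = "\<lambda>_. ennreal C"])
    show "AE \<omega> in M. X n \<omega> \<le> ennreal C" for n
    proof (intro AE_I2)
      fix \<omega> assume w: "\<omega> \<in> space M"
      have "ratio \<xi> (g n (idx n \<omega>)) (R (g n (idx n \<omega>)) \<omega>) \<le> C" if "R (g n (idx n \<omega>)) \<omega> \<le> \<rho>"
        unfolding C_def
      proof (rule ratio_bound[OF e(1) ge])
        have "0 \<le> R (g n (idx n \<omega>)) \<omega>" using nonneg_R[OF w] ge[of n "idx n \<omega>"] e0 by auto
        then have "(R (g n (idx n \<omega>)) \<omega>)\<^sup>2 \<le> \<rho>\<^sup>2" using that by (intro power_mono)
        moreover have "\<epsilon>\<^sup>2 \<le> (g n (idx n \<omega>))\<^sup>2" using ge e0 by (intro power_mono)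
        ultimately show "(R (g n (idx n \<omega>)) \<omega>)\<^sup>2 / (g n (idx n \<omega>))\<^sup>2 \<le> \<rho>\<^sup>2 / \<epsilon>\<^sup>2"
          using e by (intro frac_le) auto
      qed
      then show "X n \<omega> \<le> ennreal C" unfolding X by (auto split: split_indicator intro: ennreal_leI)
    qed
  qed (use limX X'm in \<open>auto simp: emeasure_space_1 ennreal_mult_less_top\<close>)
  moreover have "(\<lambda>n. integral\<^sup>N M (Y n)) \<longlonglongrightarrow> integral\<^sup>N M Y'"
  proof (rule nn_integral_dominated_convergence[where w = "\<lambda>\<omega>. ennreal (ratio \<xi> \<epsilon> (R \<epsilon> \<omega>))"])
    show "(\<integral>\<^sup>+\<omega>. ennreal (ratio \<xi> \<epsilon> (R \<epsilon> \<omega>)) \<partial>M) < \<infinity>" using nn_integral_ratio_space[OF e(1)] by simp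
    show "AE \<omega> in M. Y n \<omega> \<le> ennreal (ratio \<xi> \<epsilon> (R \<epsilon> \<omega>))" for n
      unfolding Y by (intro AE_I2) (auto split: split_indicator)
  qed (use limY Y'm in auto)
  ultimately have "integral\<^sup>N M X' = integral\<^sup>N M Y'"
    unfolding XY by (rule LIMSEQ_unique)
  then show ?thesis unfolding X'_def Y'_def .
qed

end

section \<open>The last passage time\<close>

context bessel_passage
begin

definition hit_after :: "real \<Rightarrow> 'w set" where
  "hit_after s = {\<omega> \<in> space M. \<exists>t\<ge>s. R t \<omega> = curve t}"

definition unbounded :: "'w set" where
  "unbounded = (\<Inter>n. hit_after (real n))"

abbreviation G :: "'w \<Rightarrow> real" where "G \<equiv> last_passage_time R curve"

lemma hit_after_UN: "hit_after s = (\<Union>n. hit s (s + real (Suc n)))"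
proof (intro set_eqI iffI)
  fix \<omega> assume "\<omega> \<in> hit_after s"
  then obtain t where t: "\<omega> \<in> space M" "s \<le> t" "R t \<omega> = curve t" by (auto simp: hit_after_def)
  obtain n where "t - s \<le> real n" using real_arch_simple by blast
  then have "t \<in> {s..s + real (Suc n)}" using t by auto
  then have "\<omega> \<in> hit s (s + real (Suc n))" using t unfolding hit_def by blast
  then show "\<omega> \<in> (\<Union>n. hit s (s + real (Suc n)))" by blast
qed (auto simp: hit_def hit_after_def)

lemma incseq_hit: "incseq (\<lambda>n. hit s (s + real (Suc n)))"
  by (auto simp: incseq_def hit_def intro: order_trans)

lemma sets_hit_after [measurable]: "0 \<le> s \<Longrightarrow> hit_after s \<in> sets M"
  unfolding hit_after_UN by (intro sets.countable_UN) auto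

lemma hit_after_antimono: "s \<le> t \<Longrightarrow> hit_after t \<subseteq> hit_after s"
  unfolding hit_after_def by (auto intro: order_trans)

lemma sets_unbounded [measurable]: "unbounded \<in> sets M"
  unfolding unbounded_def by (intro sets.countable_INT) auto

lemma not_unboundedD:
  assumes "\<omega> \<in> space M" "\<omega> \<notin> unbounded"
  obtains n :: nat where "\<omega> \<notin> hit_after (real n)"
  using assms by (auto simp: unbounded_def)

lemma not_hit_afterD:
  assumes "\<omega> \<in> space M" "\<omega> \<notin> hit_after s" "R t \<omega> = curve t"
  shows "t < s"
  using assms unfolding hit_after_def by (metis (mono_tags, lifting) mem_Collect_eq not_le)

lemma curve_div: "0 < t \<Longrightarrow> (curve t)\<^sup>2 / t\<^sup>2 = a + b / t"
  by (subst curve_square) (simp_all add: add_divide_distrib power2_eq_square)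

lemma ratio_curve:
  assumes "0 < t"
  shows "ratio \<xi> t (curve t) = exp ((x\<^sup>2 - \<xi>\<^sup>2) / (2 * t)) * \<J> (\<xi>\<^sup>2 * (a + b / t) / 4) * \<J> (c\<^sup>2 * x\<^sup>2 / 4)
    / (\<J> (x\<^sup>2 * (a + b / t) / 4) * \<J> (c\<^sup>2 * \<xi>\<^sup>2 / 4))"
proof -
  have "z * (curve t)\<^sup>2 / (4 * t\<^sup>2) = z * (a + b / t) / 4" for z
    unfolding curve_div[OF assms, symmetric] by simp
  then show ?thesis unfolding ratio_def by (simp only:)
qed

section \<open>Almost surely the curve is not met at arbitrarily large times\<close>

definition ratio_limit :: "real \<Rightarrow> real" where
  "ratio_limit \<xi> = \<J> (\<xi>\<^sup>2 * a / 4) * \<J> (c\<^sup>2 * x\<^sup>2 / 4) / (\<J> (x\<^sup>2 * a / 4) * \<J> (c\<^sup>2 * \<xi>\<^sup>2 / 4))"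

lemma ratio_limit_pos: "0 < ratio_limit \<xi>"
  unfolding ratio_limit_def using a_pos by (intro divide_pos_pos mult_pos_pos J_pos) simp_all

lemma ratio_curve_tendsto: "((\<lambda>t. ratio \<xi> t (curve t)) \<longlongrightarrow> ratio_limit \<xi>) at_top"
proof -
  have inv: "((\<lambda>t. z / t) \<longlongrightarrow> 0) at_top" for z :: real
    by (rule tendsto_divide_0[OF tendsto_const filterlim_at_top_imp_at_infinity[OF filterlim_ident]])
  have ab: "((\<lambda>t. z * (a + b / t) / 4) \<longlongrightarrow> z * a / 4) at_top" for z
    using tendsto_divide[OF tendsto_mult[OF tendsto_const tendsto_add[OF tendsto_const inv[of b]], of z a] tendsto_const, of 4] by simp
  have e: "((\<lambda>t. exp ((x\<^sup>2 - \<xi>\<^sup>2) / (2 * t))) \<longlongrightarrow> 1) at_top"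
    using tendsto_exp[OF inv[of "(x\<^sup>2 - \<xi>\<^sup>2) / 2"]] by simp
  have "\<J> (x\<^sup>2 * a / 4) * \<J> (c\<^sup>2 * \<xi>\<^sup>2 / 4) \<noteq> 0"
    using J_pos[of "x\<^sup>2 * a / 4"] J_pos[of "c\<^sup>2 * \<xi>\<^sup>2 / 4"] a_pos by simp
  then have "((\<lambda>t. exp ((x\<^sup>2 - \<xi>\<^sup>2) / (2 * t)) * \<J> (\<xi>\<^sup>2 * (a + b / t) / 4) * \<J> (c\<^sup>2 * x\<^sup>2 / 4)
    / (\<J> (x\<^sup>2 * (a + b / t) / 4) * \<J> (c\<^sup>2 * \<xi>\<^sup>2 / 4))) \<longlongrightarrow> 1 * \<J> (\<xi>\<^sup>2 * a / 4) * \<J> (c\<^sup>2 * x\<^sup>2 / 4) / (\<J> (x\<^sup>2 * a / 4) * \<J> (c\<^sup>2 * \<xi>\<^sup>2 / 4))) at_top"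
    by (intro tendsto_divide tendsto_mult tendsto_bessel_clifford[OF nu] ab e tendsto_const)
  then have "((\<lambda>t. exp ((x\<^sup>2 - \<xi>\<^sup>2) / (2 * t)) * \<J> (\<xi>\<^sup>2 * (a + b / t) / 4) * \<J> (c\<^sup>2 * x\<^sup>2 / 4)
    / (\<J> (x\<^sup>2 * (a + b / t) / 4) * \<J> (c\<^sup>2 * \<xi>\<^sup>2 / 4))) \<longlongrightarrow> ratio_limit \<xi>) at_top"
    unfolding ratio_limit_def mult_1 .
  then show ?thesis
  proof (rule Lim_transform_eventually)
    show "\<forall>\<^sub>F t in at_top. exp ((x\<^sup>2 - \<xi>\<^sup>2) / (2 * t)) * \<J> (\<xi>\<^sup>2 * (a + b / t) / 4) * \<J> (c\<^sup>2 * x\<^sup>2 / 4)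
    / (\<J> (x\<^sup>2 * (a + b / t) / 4) * \<J> (c\<^sup>2 * \<xi>\<^sup>2 / 4)) = ratio \<xi> t (curve t)"
      using eventually_gt_at_top[of 0] by eventually_elim (simp only: ratio_curve)
  qed
qed

text \<open>A Markov inequality: for late s the ratio on the curve exceeds half its limit, whereas
  optional stopping bounds its mean over \<open>hit s K\<close> by 1, uniformly in K.\<close>

lemma prob_unbounded_le: "prob unbounded \<le> 2 / ratio_limit \<xi>"
proof -
  let ?r = "ratio_limit \<xi>"
  have r: "0 < ?r" by (rule ratio_limit_pos)
  have "\<forall>\<^sub>F t in at_top. ?r / 2 < ratio \<xi> t (curve t)"
    using r by (intro order_tendstoD(1)[OF ratio_curve_tendsto]) simp
  then obtain m where m: "\<And>t. m \<le> t \<Longrightarrow> ?r / 2 < ratio \<xi> t (curve t)"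
    by (auto simp: eventually_at_top_linorder)
  obtain N :: nat where "m \<le> real N" using real_arch_simple by blast
  \<comment> \<open>An integer, so that \<open>unbounded\<close> is contained in
    \<open>hit_after s\<close>; the successor makes it positive.\<close>
  define s where "s = real (Suc N)"
  have s: "0 < s" "m \<le> s" using \<open>m \<le> real N\<close> by (auto simp: s_def)
  have "prob (hit s (s + real (Suc n))) \<le> 2 / ?r" for n
  proof -
    define K where "K = s + real (Suc n)"
    have K: "s < K" by (simp add: K_def)
    have [measurable]: "hit s K \<in> sets M" using s by simp
    have "ennreal (?r / 2) * emeasure M (hit s K) = (\<integral>\<^sup>+\<omega>. ennreal (?r / 2) * indicator (hit s K) \<omega> \<partial>M)"
      by (simp add: nn_integral_cmult_indicator)
    also have "\<dots> \<le> (\<integral>\<^sup>+\<omega>. ennreal (ratio \<xi> (last_hit s K \<omega>) (curve (last_hit s K \<omega>))) * indicator (hit s K) \<omega> \<partial>M)"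
    proof (intro nn_integral_mono)
      fix \<omega>
      show "ennreal (?r / 2) * indicator (hit s K) \<omega> \<le> ennreal (ratio \<xi> (last_hit s K \<omega>) (curve (last_hit s K \<omega>))) * indicator (hit s K) \<omega>"
      proof (cases "\<omega> \<in> hit s K")
        case True
        then have "m \<le> last_hit s K \<omega>" using last_hit(1)[OF _ True] s by simp
        then have "?r / 2 \<le> ratio \<xi> (last_hit s K \<omega>) (curve (last_hit s K \<omega>))" using m by (simp add: less_imp_le)
        then show ?thesis using True by (simp add: ennreal_leI)
      qed simp
    qed
    also have "\<dots> = (\<integral>\<^sup>+\<omega>. ennreal (ratio \<xi> s (R s \<omega>)) * indicator (hit s K) \<omega> \<partial>M)"
      by (rule optional_stopping[OF s(1) K])
    also have "\<dots> \<le> (\<integral>\<^sup>+\<omega>. ennreal (ratio \<xi> s (R s \<omega>)) \<partial>M)"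
      by (intro nn_integral_mono) (auto split: split_indicator)
    also have "\<dots> = 1" by (rule nn_integral_ratio_space[OF s(1)])
    finally have "ennreal (?r / 2) * ennreal (prob (hit s K)) \<le> 1" by (simp only: emeasure_eq_measure)
    moreover have "ennreal (?r / 2 * prob (hit s K)) = ennreal (?r / 2) * ennreal (prob (hit s K))"
      using r by (intro ennreal_mult) simp_all
    ultimately have "ennreal (?r / 2 * prob (hit s K)) \<le> ennreal 1" by (simp only: ennreal_1)
    then have "?r / 2 * prob (hit s K) \<le> 1" by (subst (asm) ennreal_le_iff) auto
    then show ?thesis using r by (simp add: K_def field_simps)
  qed
  moreover have "(\<lambda>n. prob (hit s (s + real (Suc n)))) \<longlonglongrightarrow> prob (\<Union>n. hit s (s + real (Suc n)))"
    using s by (intro finite_Lim_measure_incseq incseq_hit) auto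
  ultimately have "prob (\<Union>n. hit s (s + real (Suc n))) \<le> 2 / ?r"
    by (intro LIMSEQ_le_const2) auto
  moreover have "unbounded \<subseteq> hit_after s" unfolding unbounded_def s_def by (rule INT_lower) simp
  then have "prob unbounded \<le> prob (hit_after s)"
    using s by (intro finite_measure_mono sets_hit_after) simp_all
  ultimately show ?thesis by (simp add: hit_after_UN)
qed

text \<open>The bound of \<open>prob_unbounded_le\<close> has to be exploited for large \<xi>. In
  place of asymptotics of J, the inequality P J(a y^2 / 4) \<le> C J(c^2 y^2 / 4) is integrated
  against Gaussian weights; Weber's formula turns it into P exp (a n) \<le> C exp (c^2 n), and c^2 <
  a.\<close>

lemma prob_unbounded: "prob unbounded = 0"
proof -
  define P where "P = prob unbounded"
  define C where "C = 2 * \<J> (x\<^sup>2 * a / 4) / \<J> (c\<^sup>2 * x\<^sup>2 / 4)"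
  have P: "0 \<le> P" by (simp add: P_def)
  have C: "0 \<le> C" using J_pos[of "x\<^sup>2 * a / 4"] J_pos[of "c\<^sup>2 * x\<^sup>2 / 4"] a_pos by (simp add: C_def)
  have J0: "0 < \<J> 0" by (rule J_pos) simp
  have le: "P * \<J> (a / 4 * y\<^sup>2) \<le> C * \<J> (c\<^sup>2 / 4 * y\<^sup>2)" for y
  proof -
    have J: "0 < \<J> (a / 4 * y\<^sup>2)" "0 < \<J> (c\<^sup>2 / 4 * y\<^sup>2)" "0 < \<J> (x\<^sup>2 * a / 4)" "0 < \<J> (c\<^sup>2 * x\<^sup>2 / 4)"
      using a_pos by (intro J_pos; simp)+
    have "P \<le> 2 / ratio_limit y" unfolding P_def by (rule prob_unbounded_le)
    also have "\<dots> = C * \<J> (c\<^sup>2 / 4 * y\<^sup>2) / \<J> (a / 4 * y\<^sup>2)"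
      unfolding ratio_limit_def C_def by (simp add: mult_ac)
    finally show ?thesis using J by (simp add: pos_le_divide_eq)
  qed
  have bound: "P \<le> C * exp (c\<^sup>2 - a) ^ n" if n: "0 < n" for n
  proof -
    \<comment> \<open>With one argument of Weber's formula equal to 0, the other argument a / 4
      contributes the factor exp (a / (4 p)) = exp (a n).\<close>
    define p where "p = 1 / (4 * real n)"
    have p: "0 < p" using n by (simp add: p_def)
    define I where "I \<alpha> = (\<integral>\<^sup>+y. ennreal (y powr (2 * \<nu> + 1) * exp (- p * y\<^sup>2) * \<J> (\<alpha> * y\<^sup>2) * \<J> (0 * y\<^sup>2)) * indicator {0<..} y \<partial>lborel)" for \<alpha>
    define L where "L = \<J> 0 / (2 * p powr (\<nu> + 1))"
    have L: "0 < L" using J0 p by (simp add: L_def)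
    have I: "I \<alpha> = ennreal (exp (\<alpha> / p) * L)" if "0 \<le> \<alpha>" for \<alpha>
      using nn_integral_weber[OF nu p that order.refl] by (simp add: I_def L_def)
    have "ennreal P * I (a / 4) = (\<integral>\<^sup>+y. ennreal P * (ennreal (y powr (2 * \<nu> + 1) * exp (- p * y\<^sup>2) * \<J> (a / 4 * y\<^sup>2) * \<J> (0 * y\<^sup>2)) * indicator {0<..} y) \<partial>lborel)"
      unfolding I_def by (rule nn_integral_cmult[symmetric]) measurable
    also have "\<dots> \<le> (\<integral>\<^sup>+y. ennreal C * (ennreal (y powr (2 * \<nu> + 1) * exp (- p * y\<^sup>2) * \<J> (c\<^sup>2 / 4 * y\<^sup>2) * \<J> (0 * y\<^sup>2)) * indicator {0<..} y) \<partial>lborel)"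
    proof (intro nn_integral_mono)
      fix y :: real
      let ?w = "y powr (2 * \<nu> + 1) * exp (- p * y\<^sup>2) * \<J> (0 * y\<^sup>2)"
      have "?w * (P * \<J> (a / 4 * y\<^sup>2)) \<le> ?w * (C * \<J> (c\<^sup>2 / 4 * y\<^sup>2))"
        using J0 by (intro mult_left_mono le) simp
      then have "P * (y powr (2 * \<nu> + 1) * exp (- p * y\<^sup>2) * \<J> (a / 4 * y\<^sup>2) * \<J> (0 * y\<^sup>2)) \<le> C * (y powr (2 * \<nu> + 1) * exp (- p * y\<^sup>2) * \<J> (c\<^sup>2 / 4 * y\<^sup>2) * \<J> (0 * y\<^sup>2))"
        by (simp only: mult_ac)
      then have "ennreal P * ennreal (y powr (2 * \<nu> + 1) * exp (- p * y\<^sup>2) * \<J> (a / 4 * y\<^sup>2) * \<J> (0 * y\<^sup>2)) \<le> ennreal C * ennreal (y powr (2 * \<nu> + 1) * exp (- p * y\<^sup>2) * \<J> (c\<^sup>2 / 4 * y\<^sup>2) * \<J> (0 * y\<^sup>2))"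
        unfolding ennreal_mult'[OF P, symmetric] ennreal_mult'[OF C, symmetric] by (rule ennreal_leI)
      then show "ennreal P * (ennreal (y powr (2 * \<nu> + 1) * exp (- p * y\<^sup>2) * \<J> (a / 4 * y\<^sup>2) * \<J> (0 * y\<^sup>2)) * indicator {0<..} y)
        \<le> ennreal C * (ennreal (y powr (2 * \<nu> + 1) * exp (- p * y\<^sup>2) * \<J> (c\<^sup>2 / 4 * y\<^sup>2) * \<J> (0 * y\<^sup>2)) * indicator {0<..} y)"
        unfolding mult.assoc[symmetric] by (rule mult_right_mono) simp
    qed
    also have "\<dots> = ennreal C * I (c\<^sup>2 / 4)"
      unfolding I_def by (rule nn_integral_cmult) measurable
    finally have "ennreal (P * (exp (a / 4 / p) * L)) \<le> ennreal (C * (exp (c\<^sup>2 / 4 / p) * L))"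
      using a_pos by (simp only: I ennreal_mult'[OF P] ennreal_mult'[OF C] zero_le_divide_iff zero_le_power2) (simp add: I)
    then have "P * (exp (a / 4 / p) * L) \<le> C * (exp (c\<^sup>2 / 4 / p) * L)"
      using C L by (subst (asm) ennreal_le_iff) simp_all
    then have "(P * exp (a * n)) * L \<le> (C * exp (c\<^sup>2 * n)) * L" by (simp add: p_def mult.assoc)
    then have "P * exp (a * n) \<le> C * exp (c\<^sup>2 * n)" using L by simp
    then have "P \<le> C * exp (c\<^sup>2 * n) / exp (a * n)" by (simp add: pos_le_divide_eq)
    also have "\<dots> = C * exp (c\<^sup>2 - a) ^ n"
    proof -
      have "exp (c\<^sup>2 - a) ^ n = exp (real n * (c\<^sup>2 - a))" by (rule exp_of_nat_mult[symmetric])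
      also have "\<dots> = exp (c\<^sup>2 * n) / exp (a * n)" by (simp add: exp_diff[symmetric] algebra_simps)
      finally show ?thesis by simp
    qed
    finally show ?thesis .
  qed
  have "(\<lambda>n. C * exp (c\<^sup>2 - a) ^ n) \<longlonglongrightarrow> C * 0"
    using c_square_less by (intro tendsto_mult tendsto_const LIMSEQ_power_zero) simp
  then have "P \<le> C * 0"
    by (rule LIMSEQ_le_const) (use bound in \<open>auto intro!: exI[of _ 1]\<close>)
  then have "P = 0" using P by simp
  then show ?thesis by (simp add: P_def)
qed

lemma AE_not_unbounded: "AE \<omega> in M. \<omega> \<notin> unbounded"
  by (rule AE_not_in) (simp add: null_sets_def emeasure_eq_measure prob_unbounded)

lemma last_passage_eq_last_hit:
  assumes s: "0 \<le> s" and w: "\<omega> \<in> hit s K" and nh: "\<omega> \<notin> hit_after K"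
  shows "G \<omega> = last_hit s K \<omega>"
proof -
  have wM: "\<omega> \<in> space M" using w by (simp add: hit_def)
  let ?S = "{t. 0 \<le> t \<and> R t \<omega> = curve t}"
  have S: "last_hit s K \<omega> \<in> ?S" using last_hit(1,2)[OF s w] s by auto
  have "t \<le> last_hit s K \<omega>" if t: "t \<in> ?S" for t
  proof (cases "s \<le> t")
    case True
    have "t \<le> K" using not_hit_afterD[OF wM nh, of t] t by simp
    then show ?thesis using last_hit(3)[OF s w, of t] True t by simp
  next
    case False
    then show ?thesis using last_hit(1)[OF s w] by auto
  qed
  then have "Sup ?S = last_hit s K \<omega>" by (intro cSup_eq_maximum S)
  moreover have "?S \<noteq> {}" using S by blast
  ultimately show ?thesis unfolding last_passage_time_def Let_def by (simp only: if_False)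
qed

text \<open>Boundedness makes the supremum a maximum, and s > 0 excludes the value 0 that is
  assigned to paths which never meet the curve.\<close>

lemma last_passage_ge_iff:
  assumes w: "\<omega> \<in> space M" "\<omega> \<notin> unbounded" and s: "0 < s"
  shows "s \<le> G \<omega> \<longleftrightarrow> \<omega> \<in> hit_after s"
proof -
  obtain n :: nat where n: "\<omega> \<notin> hit_after (real n)" using not_unboundedD[OF w] .
  show ?thesis
  proof
    assume h: "\<omega> \<in> hit_after s"
    then obtain t where t: "s \<le> t" "R t \<omega> = curve t" by (auto simp: hit_after_def)
    have "t \<le> real n" using not_hit_afterD[OF w(1) n t(2)] by simp
    then have "\<omega> \<in> hit s (real n)" using t w(1) unfolding hit_def by auto
    then show "s \<le> G \<omega>" using last_passage_eq_last_hit[OF _ _ n, of s] last_hit(1)[of s \<omega> "real n"] s by auto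
  next
    assume g: "s \<le> G \<omega>"
    have "\<omega> \<in> hit 0 (real n)"
    proof (rule ccontr)
      assume nh: "\<omega> \<notin> hit 0 (real n)"
      have False if t: "0 \<le> t" "R t \<omega> = curve t" for t
      proof (cases "t \<le> real n")
        case True
        then have "t \<in> {0..real n}" using t by simp
        then show False using nh t w(1) unfolding hit_def by blast
      next
        case False
        then have "real n \<le> t" by simp
        then show False using n t w(1) unfolding hit_after_def by blast
      qed
      then have "{t. 0 \<le> t \<and> R t \<omega> = curve t} = {}" by blast
      then have "G \<omega> = 0" by (simp add: last_passage_time_def)
      then show False using g s by simp
    qed
    note h = this
    have "G \<omega> = last_hit 0 (real n) \<omega>" by (rule last_passage_eq_last_hit[OF order.refl h n])
    then have "R (G \<omega>) \<omega> = curve (G \<omega>)" using last_hit(2)[OF order.refl h] by simp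
    then show "\<omega> \<in> hit_after s" using g w(1) unfolding hit_after_def by blast
  qed
qed

lemma last_passage_nonneg:
  assumes w: "\<omega> \<in> space M" "\<omega> \<notin> unbounded"
  shows "0 \<le> G \<omega>"
proof (cases "{t. 0 \<le> t \<and> R t \<omega> = curve t} = {}")
  case False
  obtain n :: nat where n: "\<omega> \<notin> hit_after (real n)" using not_unboundedD[OF w] .
  obtain t where t: "0 \<le> t" "R t \<omega> = curve t" using False by blast
  have "bdd_above {t. 0 \<le> t \<and> R t \<omega> = curve t}"
  proof (rule bdd_aboveI)
    fix u assume "u \<in> {t. 0 \<le> t \<and> R t \<omega> = curve t}"
    then show "u \<le> real n" using not_hit_afterD[OF w(1) n, of u] by simp
  qed
  then have "t \<le> Sup {t. 0 \<le> t \<and> R t \<omega> = curve t}" using t by (intro cSup_upper) auto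
  then show ?thesis using t(1) False by (simp add: last_passage_time_def Let_def)
qed (simp add: last_passage_time_def)

text \<open>On unbounded sets the supremum is one and the same junk value.\<close>

lemma measurable_last_passage [measurable]: "G \<in> borel_measurable M"
proof (rule borel_measurable_iff_ge[THEN iffD2, rule_format])
  fix s :: real
  \<comment> \<open>The real supremum is the LEAST upper bound; without any upper bound the
    predicate under LEAST is constantly false.\<close>
  define k0 where "k0 = (LEAST z::real. False)"
  have unb: "G \<omega> = k0" if w: "\<omega> \<in> unbounded" for \<omega>
  proof -
    let ?S = "{t. 0 \<le> t \<and> R t \<omega> = curve t}"
    have nb: "\<not> (\<forall>t\<in>?S. t \<le> z)" for z
    proof -
      obtain n :: nat where n: "\<bar>z\<bar> < real n" using reals_Archimedean2 by blast
      have "\<omega> \<in> hit_after (real n)" using w by (simp add: unbounded_def)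
      then obtain t where "real n \<le> t" "R t \<omega> = curve t" by (auto simp: hit_after_def)
      moreover have "0 \<le> t" "\<not> t \<le> z" using n \<open>real n \<le> t\<close> by linarith+
      ultimately show ?thesis by blast
    qed
    then have "?S \<noteq> {}" by (metis empty_iff)
    moreover have "Sup ?S = k0" unfolding k0_def Sup_real_def by (simp only: nb)
    ultimately show ?thesis unfolding last_passage_time_def Let_def by (simp only: if_False)
  qed
  have "{\<omega> \<in> space M. s \<le> G \<omega>} = (if s \<le> k0 then unbounded else {}) \<union> ((if s \<le> 0 then space M else hit_after s) - unbounded)"
  proof (intro set_eqI)
    fix \<omega>
    have sub: "hit_after s \<subseteq> space M" "unbounded \<subseteq> space M" by (auto simp: hit_after_def unbounded_def)
    consider "\<omega> \<notin> space M" | "\<omega> \<in> unbounded" | "\<omega> \<in> space M" "\<omega> \<notin> unbounded" "s \<le> 0" | "\<omega> \<in> space M" "\<omega> \<notin> unbounded" "0 < s"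
      using sub by linarith
    then show "\<omega> \<in> {\<omega> \<in> space M. s \<le> G \<omega>} \<longleftrightarrow> \<omega> \<in> (if s \<le> k0 then unbounded else {}) \<union> ((if s \<le> 0 then space M else hit_after s) - unbounded)"
    proof cases
      case 1 then show ?thesis using sub by auto
    next
      case 2 then show ?thesis using sub unb by auto
    next
      case 3 then show ?thesis using last_passage_nonneg[of \<omega>] by auto
    next
      case 4 then show ?thesis using last_passage_ge_iff[of \<omega> s] by auto
    qed
  qed
  also have "\<dots> \<in> sets M" by auto
  finally show "{\<omega> \<in> space M. s \<le> G \<omega>} \<in> sets M" .
qed


text \<open>Off \<open>hit s K\<close> the supremum is over the empty set; the indicator replaces
  that unspecified value by 0.\<close>

lemma measurable_last_hit:
  assumes s: "0 \<le> s"
  shows "(\<lambda>\<omega>. last_hit s K \<omega> * indicator (hit s K) \<omega>) \<in> borel_measurable M"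
proof (rule borel_measurable_iff_ge[THEN iffD2, rule_format])
  fix t :: real
  have sub: "hit s K \<subseteq> space M" "hit (max s t) K \<subseteq> hit s K" by (auto simp: hit_def)
  have "t \<le> last_hit s K \<omega> \<longleftrightarrow> \<omega> \<in> hit (max s t) K" if w: "\<omega> \<in> hit s K" for \<omega>
    using last_hit_ge_iff[OF s w, of "max s t"] last_hit(1)[OF s w] by auto
  then have "{\<omega> \<in> space M. t \<le> last_hit s K \<omega> * indicator (hit s K) \<omega>} = (if t \<le> 0 then space M - hit s K else {}) \<union> hit (max s t) K"
    using sub by (auto split: split_indicator if_splits)
  also have "\<dots> \<in> sets M" using s by auto
  finally show "{\<omega> \<in> space M. t \<le> last_hit s K \<omega> * indicator (hit s K) \<omega>} \<in> sets M" .
qed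

lemma measurable_ratio2 [measurable]:
  assumes [measurable]: "f \<in> borel_measurable N" "g \<in> borel_measurable N"
  shows "(\<lambda>\<omega>. ratio \<xi> (f \<omega>) (g \<omega>)) \<in> borel_measurable N"
  unfolding ratio_def by measurable

lemma ratio_curve_le:
  assumes "0 < \<epsilon>"
  obtains C where "\<And>t. \<epsilon> \<le> t \<Longrightarrow> ratio \<xi> t (curve t) \<le> C"
proof
  fix t assume t: "\<epsilon> \<le> t"
  have "(curve t)\<^sup>2 / t\<^sup>2 = a + b / t" using assms t by (intro curve_div) simp
  also have "\<dots> \<le> a + b / \<epsilon>" using assms t b by (intro add_left_mono divide_left_mono) auto
  finally show "ratio \<xi> t (curve t) \<le> exp (x\<^sup>2 / (2 * \<epsilon>)) * \<J> (\<xi>\<^sup>2 * (a + b / \<epsilon>) / 4) * \<J> (c\<^sup>2 * x\<^sup>2 / 4) / (\<J> 0 * \<J> (c\<^sup>2 * \<xi>\<^sup>2 / 4))"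
    by (rule ratio_bound[OF assms t])
qed

lemma hit_subset_hit_after: "hit s K \<subseteq> hit_after s"
  by (auto simp: hit_def hit_after_def)

lemma hit_eventually:
  assumes "\<omega> \<in> hit_after s"
  shows "\<forall>\<^sub>F n in sequentially. \<omega> \<in> hit s (s + real (Suc n))"
proof -
  obtain n0 where n0: "\<omega> \<in> hit s (s + real (Suc n0))" using assms hit_after_UN by auto
  show ?thesis
    unfolding eventually_sequentially
    using n0 incseqD[OF incseq_hit[of s]] by blast
qed

text \<open>The right end K tends to infinity. Almost every path finally stops meeting the curve, so
  its last hit before K is eventually G. The ratio on the curve is bounded for times at least
  \<epsilon>, and the ratio at \<epsilon> is its own integrable majorant.\<close>

lemma stop_at_last_passage:
  assumes e: "0 < \<epsilon>"
  shows "(\<integral>\<^sup>+\<omega>. ennreal (ratio \<xi> (G \<omega>) (curve (G \<omega>))) * indicator (hit_after \<epsilon>) \<omega> \<partial>M)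
    = (\<integral>\<^sup>+\<omega>. ennreal (ratio \<xi> \<epsilon> (R \<epsilon> \<omega>)) * indicator (hit_after \<epsilon>) \<omega> \<partial>M)"
proof -
  define K where "K n = \<epsilon> + real (Suc n)" for n
  have K: "\<epsilon> < K n" for n by (simp add: K_def)
  have [measurable]: "R \<epsilon> \<in> borel_measurable M" "hit \<epsilon> (K n) \<in> sets M" "hit_after \<epsilon> \<in> sets M" for n
    using e by (auto intro: measurable_R)
  obtain C where C: "\<And>t. \<epsilon> \<le> t \<Longrightarrow> ratio \<xi> t (curve t) \<le> C" using ratio_curve_le[OF e] by blast
  define l where "l n \<omega> = last_hit \<epsilon> (K n) \<omega> * indicator (hit \<epsilon> (K n)) \<omega>" for n \<omega>
  have [measurable]: "l n \<in> borel_measurable M" for n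
    unfolding l_def using e by (intro measurable_last_hit) simp
  define X where "X n \<omega> = ennreal (ratio \<xi> (l n \<omega>) (curve (l n \<omega>))) * indicator (hit \<epsilon> (K n)) \<omega>" for n \<omega>
  define Y where "Y n \<omega> = ennreal (ratio \<xi> \<epsilon> (R \<epsilon> \<omega>)) * indicator (hit \<epsilon> (K n)) \<omega>" for n \<omega>
  have [measurable]: "X n \<in> borel_measurable M" "Y n \<in> borel_measurable M" for n
    unfolding X_def Y_def by measurable
  have XY: "integral\<^sup>N M (X n) = integral\<^sup>N M (Y n)" for n
  proof -
    have "integral\<^sup>N M (X n) = (\<integral>\<^sup>+\<omega>. ennreal (ratio \<xi> (last_hit \<epsilon> (K n) \<omega>) (curve (last_hit \<epsilon> (K n) \<omega>))) * indicator (hit \<epsilon> (K n)) \<omega> \<partial>M)"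
      unfolding X_def l_def by (intro nn_integral_cong) (simp split: split_indicator)
    then show ?thesis unfolding Y_def optional_stopping[OF e K] .
  qed
  let ?X = "\<lambda>\<omega>. ennreal (ratio \<xi> (G \<omega>) (curve (G \<omega>))) * indicator (hit_after \<epsilon>) \<omega>"
  let ?Y = "\<lambda>\<omega>. ennreal (ratio \<xi> \<epsilon> (R \<epsilon> \<omega>)) * indicator (hit_after \<epsilon>) \<omega>"
  have "(\<lambda>n. integral\<^sup>N M (X n)) \<longlonglongrightarrow> integral\<^sup>N M ?X"
  proof (rule nn_integral_dominated_convergence[where w = "\<lambda>_. ennreal C"])
    show "AE \<omega> in M. X n \<omega> \<le> ennreal C" for n
    proof (intro AE_I2)
      fix \<omega>
      show "X n \<omega> \<le> ennreal C"
      proof (cases "\<omega> \<in> hit \<epsilon> (K n)")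
        case True
        have "\<epsilon> \<le> l n \<omega>" using last_hit(1)[OF _ True] e True by (simp add: l_def)
        then show ?thesis unfolding X_def using True C by (simp add: ennreal_leI)
      qed (simp add: X_def)
    qed
    show "AE \<omega> in M. (\<lambda>n. X n \<omega>) \<longlonglongrightarrow> ?X \<omega>"
      using AE_not_unbounded AE_space
    proof eventually_elim
      case (elim \<omega>)
      show ?case
      proof (rule tendsto_eventually, cases "\<omega> \<in> hit_after \<epsilon>")
        case False
        then have "\<omega> \<notin> hit \<epsilon> (K n)" for n using hit_subset_hit_after by blast
        then show "\<forall>\<^sub>F n in sequentially. X n \<omega> = ?X \<omega>" using False by (simp add: X_def)
      next
        case True
        obtain m :: nat where m: "\<omega> \<notin> hit_after (real m)" using not_unboundedD[OF elim(2,1)] .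
        have "\<forall>\<^sub>F n in sequentially. \<omega> \<in> hit \<epsilon> (K n)"
          unfolding K_def by (rule hit_eventually[OF True])
        moreover have "\<forall>\<^sub>F n in sequentially. m \<le> n" by (rule eventually_ge_at_top)
        ultimately show "\<forall>\<^sub>F n in sequentially. X n \<omega> = ?X \<omega>"
        proof eventually_elim
          case (elim n)
          have "real m \<le> K n" using elim(2) e by (simp add: K_def)
          then have "\<omega> \<notin> hit_after (K n)" using m hit_after_antimono by blast
          then have "G \<omega> = l n \<omega>"
            using last_passage_eq_last_hit[OF _ elim(1)] e elim(1) by (simp add: l_def)
          then show ?case using True elim(1) by (simp add: X_def)
        qed
      qed
    qed
  qed (auto simp: emeasure_space_1 ennreal_mult_less_top)
  moreover have "(\<lambda>n. integral\<^sup>N M (Y n)) \<longlonglongrightarrow> integral\<^sup>N M ?Y"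
  proof (rule nn_integral_dominated_convergence[where w = "\<lambda>\<omega>. ennreal (ratio \<xi> \<epsilon> (R \<epsilon> \<omega>))"])
    show "(\<integral>\<^sup>+\<omega>. ennreal (ratio \<xi> \<epsilon> (R \<epsilon> \<omega>)) \<partial>M) < \<infinity>" using nn_integral_ratio_space[OF e] by simp
    show "AE \<omega> in M. Y n \<omega> \<le> ennreal (ratio \<xi> \<epsilon> (R \<epsilon> \<omega>))" for n
      unfolding Y_def by (intro AE_I2) (auto split: split_indicator)
    show "AE \<omega> in M. (\<lambda>n. Y n \<omega>) \<longlonglongrightarrow> ?Y \<omega>"
    proof (intro AE_I2 tendsto_eventually)
      fix \<omega>
      show "\<forall>\<^sub>F n in sequentially. Y n \<omega> = ?Y \<omega>"
      proof (cases "\<omega> \<in> hit_after \<epsilon>")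
        case False
        then have "\<omega> \<notin> hit \<epsilon> (K n)" for n using hit_subset_hit_after by blast
        then show ?thesis using False by (simp add: Y_def)
      next
        case True
        have "\<forall>\<^sub>F n in sequentially. \<omega> \<in> hit \<epsilon> (K n)"
          unfolding K_def by (rule hit_eventually[OF True])
        then show ?thesis by eventually_elim (simp add: Y_def True)
      qed
    qed
  qed auto
  ultimately show ?thesis unfolding XY by (rule LIMSEQ_unique)
qed

text \<open>Intermediate values: a path that is not below the curve at s and not above it at t meets
  it in between. Failure to hit is thus covered by two events that concern a single time
  each.\<close>

lemma no_hit_sign:
  assumes w: "\<omega> \<in> space M" and s: "0 \<le> s" "s \<le> t" and nh: "\<omega> \<notin> hit_after s"
  shows "R s \<omega> < curve s \<or> curve t < R t \<omega>"
proof (rule ccontr)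
  assume "\<not> ?thesis"
  then have *: "R t \<omega> - curve t \<le> 0" "0 \<le> R s \<omega> - curve s" by auto
  have "continuous_on {s..t} (\<lambda>t. R t \<omega> - curve t)"
    using s by (intro continuous_on_diff continuous_on_curve continuous_on_subset[OF continuous_R[OF w]]) auto
  then obtain u where "s \<le> u" "R u \<omega> - curve u = 0"
    using IVT2'[of "\<lambda>t. R t \<omega> - curve t" t 0 s] * s by auto
  then show False using not_hit_afterD[OF w nh, of u] by simp
qed

text \<open>Exponential Chebyshev inequality with weight exp (\<delta> y^2 / (2 t)). The assumption
  on A carries the factor \<delta> so that the sign of \<delta> selects the upper or the lower
  tail.\<close>

lemma transition_chernoff:
  assumes t: "0 < t" and d: "\<delta> < 1" and A[measurable]: "A \<in> sets borel"
    and le: "\<And>y. y \<in> A \<Longrightarrow> 0 < y \<Longrightarrow> \<delta> * (curve t)\<^sup>2 \<le> \<delta> * y\<^sup>2"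
  shows "transition t (indicator A) z \<le> ennreal (exp ((z\<^sup>2 / (2 * t) + c\<^sup>2 * t / 2) * (1 / (1 - \<delta>) - 1) - \<delta> * (a * t + b) / 2)
    * (\<J> (c\<^sup>2 * z\<^sup>2 / (4 * (1 - \<delta>)\<^sup>2)) / ((1 - \<delta>) powr (\<nu> + 1) * \<J> (c\<^sup>2 * z\<^sup>2 / 4))))"
proof -
  define m where "m = \<delta> * (a * t + b) / 2"
  have cm: "\<delta> * (curve t)\<^sup>2 / (2 * t) = m"
  proof -
    have "(curve t)\<^sup>2 = a * t\<^sup>2 + b * t" using t by (intro curve_square) simp
    then show ?thesis using t by (simp add: m_def power2_eq_square field_simps)
  qed
  have "transition t (indicator A) z \<le> (\<integral>\<^sup>+y. ennreal (exp (- m)) * (ennreal (bessel_density \<nu> c t z y * exp (\<delta> * y\<^sup>2 / (2 * t))) * indicator {0<..} y) \<partial>lborel)"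
    unfolding transition_def
  proof (intro nn_integral_mono)
    fix y :: real
    have "bessel_density \<nu> c t z y \<le> exp (- m) * (bessel_density \<nu> c t z y * exp (\<delta> * y\<^sup>2 / (2 * t)))" if y: "y \<in> A" "0 < y"
    proof -
      have "m \<le> \<delta> * y\<^sup>2 / (2 * t)" unfolding cm[symmetric] using le[OF y] t by (intro divide_right_mono) auto
      then have "1 \<le> exp (- m) * exp (\<delta> * y\<^sup>2 / (2 * t))" by (simp add: exp_add[symmetric])
      then have "bessel_density \<nu> c t z y * 1 \<le> bessel_density \<nu> c t z y * (exp (- m) * exp (\<delta> * y\<^sup>2 / (2 * t)))"
        by (intro mult_left_mono bessel_density_nonneg[OF nu t])
      then show ?thesis by (simp only: mult_1_right mult_ac)
    qed
    then have "ennreal (bessel_density \<nu> c t z y) \<le> ennreal (exp (- m)) * ennreal (bessel_density \<nu> c t z y * exp (\<delta> * y\<^sup>2 / (2 * t)))" if "y \<in> A" "0 < y"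
      using that by (subst ennreal_mult'[symmetric]) (auto intro!: ennreal_leI)
    then show "ennreal (bessel_density \<nu> c t z y) * indicator A y * indicator {0<..} y
      \<le> ennreal (exp (- m)) * (ennreal (bessel_density \<nu> c t z y * exp (\<delta> * y\<^sup>2 / (2 * t))) * indicator {0<..} y)"
      by (cases "y \<in> A \<and> 0 < y") auto
  qed
  also have "\<dots> = ennreal (exp (- m)) * (\<integral>\<^sup>+y. ennreal (bessel_density \<nu> c t z y * exp (\<delta> * y\<^sup>2 / (2 * t))) * indicator {0<..} y \<partial>lborel)"
    by (rule nn_integral_cmult) measurable
  also have "\<dots> = ennreal (exp (- m) * (exp ((z\<^sup>2 / (2 * t) + c\<^sup>2 * t / 2) * (1 / (1 - \<delta>) - 1)) * \<J> (c\<^sup>2 * z\<^sup>2 / (4 * (1 - \<delta>)\<^sup>2))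
        / ((1 - \<delta>) powr (\<nu> + 1) * \<J> (c\<^sup>2 * z\<^sup>2 / 4))))"
    unfolding nn_integral_bessel_density_exp[OF nu t d] by (rule ennreal_mult'[symmetric]) simp
  also have "exp (- m) * (exp ((z\<^sup>2 / (2 * t) + c\<^sup>2 * t / 2) * (1 / (1 - \<delta>) - 1)) * \<J> (c\<^sup>2 * z\<^sup>2 / (4 * (1 - \<delta>)\<^sup>2))
        / ((1 - \<delta>) powr (\<nu> + 1) * \<J> (c\<^sup>2 * z\<^sup>2 / 4)))
      = exp ((z\<^sup>2 / (2 * t) + c\<^sup>2 * t / 2) * (1 / (1 - \<delta>) - 1) - m)
    * (\<J> (c\<^sup>2 * z\<^sup>2 / (4 * (1 - \<delta>)\<^sup>2)) / ((1 - \<delta>) powr (\<nu> + 1) * \<J> (c\<^sup>2 * z\<^sup>2 / 4)))"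
    by (simp only: exp_diff exp_minus divide_inverse mult_ac)
  finally show ?thesis unfolding m_def .
qed

text \<open>With drift c the process grows at speed c, which is less than the speed sqrt a of the
  curve; the estimate is exponential in time.\<close>

lemma transition_above_tendsto:
  "(\<lambda>n. transition (real (Suc n)) (indicator {y. curve (real (Suc n)) < y}) z) \<longlonglongrightarrow> 0"
proof -
  \<comment> \<open>Per unit of time the exponent is c^2 q / 2 - a \<delta> / 2 with q = \<delta> /
    (1 - \<delta>). Its minimiser 1 - \<delta> = c / sqrt a is not admissible for c = 0; the present
    choice lies strictly between 0 and 1 in all cases and gives the negative rate -
    \<kappa>.\<close>
  define \<delta> where "\<delta> = (a - c\<^sup>2) / (2 * a)"
  define \<kappa> where "\<kappa> = (a - c\<^sup>2)\<^sup>2 / (4 * (a + c\<^sup>2))"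
  define q where "q = 1 / (1 - \<delta>) - 1"
  define E where "E = \<J> (c\<^sup>2 * z\<^sup>2 / (4 * (1 - \<delta>)\<^sup>2)) / ((1 - \<delta>) powr (\<nu> + 1) * \<J> (c\<^sup>2 * z\<^sup>2 / 4))"
  have ac: "0 < a + c\<^sup>2" using a_pos by (intro add_pos_nonneg) auto
  have d1: "1 - \<delta> = (a + c\<^sup>2) / (2 * a)" using a_pos by (simp add: \<delta>_def field_simps)
  have d: "0 < \<delta>" using a_pos c_square_less by (simp add: \<delta>_def)
  moreover have "0 < 1 - \<delta>" unfolding d1 using ac a_pos by simp
  ultimately have d: "0 < \<delta>" "\<delta> < 1" by simp_all
  have k: "0 < \<kappa>" using ac c_square_less by (simp add: \<kappa>_def)
  have q: "q = (a - c\<^sup>2) / (a + c\<^sup>2)" unfolding q_def d1 using ac a_pos by (simp add: field_simps)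
  have q0: "0 \<le> q" using ac c_square_less by (simp add: q)
  have kq: "c\<^sup>2 * q / 2 - \<delta> * a / 2 = - \<kappa>"
  proof -
    have "\<delta> * a / 2 = (a - c\<^sup>2) / 4" using a_pos by (simp add: \<delta>_def)
    moreover have "c\<^sup>2 * q / 2 - (a - c\<^sup>2) / 4 = - \<kappa>"
    proof -
      have "C * ((a - C) / (a + C)) / 2 - (a - C) / 4 = - ((a - C)\<^sup>2 / (4 * (a + C)))" if "0 < a + C" for C
        using that by (simp add: field_simps power2_eq_square)
      then show ?thesis unfolding q \<kappa>_def using ac by simp
    qed
    ultimately show ?thesis by (simp only:)
  qed
  have E: "0 \<le> E" unfolding E_def by (intro divide_nonneg_nonneg mult_nonneg_nonneg less_imp_le[OF J_pos]) simp_all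
  have up: "transition (real (Suc n)) (indicator {y. curve (real (Suc n)) < y}) z \<le> ennreal (exp (z\<^sup>2 * q / 2) * E * exp (- \<kappa>) ^ Suc n)" for n
  proof -
    define t where "t = real (Suc n)"
    have t: "0 < t" "1 \<le> t" by (simp_all add: t_def)
    have "transition t (indicator {y. curve t < y}) z \<le> ennreal (exp ((z\<^sup>2 / (2 * t) + c\<^sup>2 * t / 2) * q - \<delta> * (a * t + b) / 2) * E)"
      unfolding q_def E_def
    proof (rule transition_chernoff[OF t(1) d(2)])
      fix y :: real assume "y \<in> {y. curve t < y}" "0 < y"
      then show "\<delta> * (curve t)\<^sup>2 \<le> \<delta> * y\<^sup>2"
        using d curve_nonneg[of t] t by (intro mult_left_mono power_mono) auto
    qed simp
    also have "\<dots> \<le> ennreal (exp (z\<^sup>2 * q / 2 + t * - \<kappa>) * E)"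
    proof (intro ennreal_leI mult_right_mono E)
      have "z\<^sup>2 / (2 * t) * q \<le> z\<^sup>2 / 2 * q" using t q0 by (intro mult_right_mono divide_left_mono) auto
      moreover have "0 \<le> \<delta> * b / 2" using d b by simp
      moreover have "(z\<^sup>2 / (2 * t) + c\<^sup>2 * t / 2) * q - \<delta> * (a * t + b) / 2 = z\<^sup>2 / (2 * t) * q + t * (c\<^sup>2 * q / 2 - \<delta> * a / 2) - \<delta> * b / 2"
        by (simp add: algebra_simps add_divide_distrib)
      ultimately show "exp ((z\<^sup>2 / (2 * t) + c\<^sup>2 * t / 2) * q - \<delta> * (a * t + b) / 2) \<le> exp (z\<^sup>2 * q / 2 + t * - \<kappa>)"
        unfolding kq by simp
    qed
    also have "exp (z\<^sup>2 * q / 2 + t * - \<kappa>) * E = exp (z\<^sup>2 * q / 2) * E * exp (- \<kappa>) ^ Suc n"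
      unfolding t_def exp_add exp_of_nat_mult by (simp only: mult_ac)
    finally show ?thesis unfolding t_def .
  qed
  have lim: "(\<lambda>n. ennreal (exp (z\<^sup>2 * q / 2) * E * exp (- \<kappa>) ^ Suc n)) \<longlonglongrightarrow> ennreal (exp (z\<^sup>2 * q / 2) * E * 0)"
    using k by (intro tendsto_ennrealI tendsto_mult tendsto_const LIMSEQ_Suc[OF LIMSEQ_power_zero]) simp
  have "ennreal (exp (z\<^sup>2 * q / 2) * E * 0) = 0" by simp
  note lim = lim[unfolded this]
  show ?thesis
  proof (rule tendsto_sandwich[OF _ _ tendsto_const lim])
    show "\<forall>\<^sub>F n in sequentially. 0 \<le> transition (real (Suc n)) (indicator {y. curve (real (Suc n)) < y}) z" by (intro always_eventually allI zero_le)
  qed (intro always_eventually allI up)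
qed

text \<open>A process started from z > 0 is not near 0 after a short time t: with \<delta> = -1 the
  exponent is - z^2 / (4 t) up to bounded terms. Started from 0, the process and the curve would
  both be of order sqrt t; this is the reason for requiring \<xi> > 0 later.\<close>

lemma transition_below_tendsto:
  assumes z: "0 < z"
  shows "(\<lambda>n. transition (1 / real (Suc n)) (indicator {y. y < curve (1 / real (Suc n))}) z) \<longlonglongrightarrow> 0"
proof -
  define E where "E = \<J> (c\<^sup>2 * z\<^sup>2 / (4 * (1 - - 1)\<^sup>2)) / ((1 - - 1) powr (\<nu> + 1) * \<J> (c\<^sup>2 * z\<^sup>2 / 4))"
  define \<kappa> where "\<kappa> = z\<^sup>2 / 4"
  have k: "0 < \<kappa>" using z by (simp add: \<kappa>_def)
  have E: "0 \<le> E" unfolding E_def by (intro divide_nonneg_nonneg mult_nonneg_nonneg less_imp_le[OF J_pos]) simp_all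
  have up: "transition (1 / real (Suc n)) (indicator {y. y < curve (1 / real (Suc n))}) z \<le> ennreal (exp ((a + b) / 2) * E * exp (- \<kappa>) ^ Suc n)" for n
  proof -
    define t where "t = 1 / real (Suc n)"
    have t: "0 < t" "t \<le> 1" "1 / t = real (Suc n)" by (simp_all add: t_def)
    have "transition t (indicator {y. y < curve t}) z \<le> ennreal (exp ((z\<^sup>2 / (2 * t) + c\<^sup>2 * t / 2) * (1 / (1 - - 1) - 1) - (- 1) * (a * t + b) / 2) * E)"
      unfolding E_def
    proof (rule transition_chernoff[OF t(1)])
      fix y :: real assume "y \<in> {y. y < curve t}" "0 < y"
      then have "y\<^sup>2 \<le> (curve t)\<^sup>2" by (intro power_mono) auto
      then show "- 1 * (curve t)\<^sup>2 \<le> - 1 * y\<^sup>2" by simp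
    qed simp_all
    also have "\<dots> \<le> ennreal (exp ((a + b) / 2 + real (Suc n) * - \<kappa>) * E)"
    proof (intro ennreal_leI mult_right_mono E)
      have h1: "a * t \<le> a * 1" using a_pos t by (intro mult_left_mono) auto
      have h2: "0 \<le> c\<^sup>2 * t / 2" using t by simp
      have h3: "z\<^sup>2 / (2 * t) * (1 / 2) = real (Suc n) * \<kappa>"
        unfolding \<kappa>_def t(3)[symmetric] by simp
      have h: "1 / (1 - - 1) - 1 = (- (1 / 2) :: real)" by simp
      have lin: "(A + B) * - (1 / 2) - (- 1) * C / 2 = - (A * (1 / 2)) - B * (1 / 2) + C / 2" for A B C :: real
        by (simp add: add_divide_distrib)
      have arith: "- X - B * (1 / 2) + (A + b) / 2 \<le> (a + b) / 2 + - X" if "A \<le> a * 1" "0 \<le> B" for A B X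
      proof -
        have "(A + b) / 2 \<le> (a + b) / 2" using that(1) by (intro divide_right_mono) simp_all
        moreover have "- X - B * (1 / 2) \<le> - X" using that(2) by simp
        ultimately have "- X - B * (1 / 2) + (A + b) / 2 \<le> - X + (a + b) / 2" by (rule add_mono[rotated])
        then show ?thesis by (simp only: add.commute)
      qed
      show "exp ((z\<^sup>2 / (2 * t) + c\<^sup>2 * t / 2) * (1 / (1 - - 1) - 1) - (- 1) * (a * t + b) / 2) \<le> exp ((a + b) / 2 + real (Suc n) * - \<kappa>)"
        unfolding exp_le_cancel_iff h lin h3 unfolding mult_minus_right by (rule arith[OF h1 h2])
    qed
    also have "exp ((a + b) / 2 + real (Suc n) * - \<kappa>) * E = exp ((a + b) / 2) * E * exp (- \<kappa>) ^ Suc n"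
      unfolding exp_add exp_of_nat_mult by (simp only: mult_ac)
    finally show ?thesis unfolding t_def .
  qed
  have lim: "(\<lambda>n. ennreal (exp ((a + b) / 2) * E * exp (- \<kappa>) ^ Suc n)) \<longlonglongrightarrow> ennreal (exp ((a + b) / 2) * E * 0)"
    using k by (intro tendsto_ennrealI tendsto_mult tendsto_const LIMSEQ_Suc[OF LIMSEQ_power_zero]) simp
  have "ennreal (exp ((a + b) / 2) * E * 0) = 0" by simp
  note lim = lim[unfolded this]
  show ?thesis
  proof (rule tendsto_sandwich[OF _ _ tendsto_const lim])
    show "\<forall>\<^sub>F n in sequentially. 0 \<le> transition (1 / real (Suc n)) (indicator {y. y < curve (1 / real (Suc n))}) z" by (intro always_eventually allI zero_le)
  qed (intro always_eventually allI up)
qed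

text \<open>Of the two events of \<open>no_hit_sign\<close>, the second is moved by the reverse
  martingale to the late time t. There its weighted mass is the probability of being above the curve
  when started from \<xi>, which disappears as t grows.\<close>

lemma no_hit_mass_le:
  assumes e: "0 < \<epsilon>"
  shows "(\<integral>\<^sup>+\<omega>. ennreal (ratio \<xi> \<epsilon> (R \<epsilon> \<omega>)) * indicator (space M - hit_after \<epsilon>) \<omega> \<partial>M) \<le> transition \<epsilon> (indicator {y. y < curve \<epsilon>}) \<xi>"
proof (rule LIMSEQ_le_const)
  let ?A = "transition \<epsilon> (indicator {y. y < curve \<epsilon>}) \<xi>"
  show "(\<lambda>n. ?A + transition (real (Suc n)) (indicator {y. curve (real (Suc n)) < y}) \<xi>) \<longlonglongrightarrow> ?A"
    using tendsto_add[OF tendsto_const transition_above_tendsto, of ?A \<xi>] by simp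
  have "(\<integral>\<^sup>+\<omega>. ennreal (ratio \<xi> \<epsilon> (R \<epsilon> \<omega>)) * indicator (space M - hit_after \<epsilon>) \<omega> \<partial>M)
    \<le> ?A + transition (real (Suc n)) (indicator {y. curve (real (Suc n)) < y}) \<xi>" if n: "nat \<lceil>\<epsilon>\<rceil> \<le> n" for n
  proof -
    define t where "t = real (Suc n)"
    have "\<epsilon> \<le> real (Suc n)" using n by linarith
    then have t: "\<epsilon> \<le> t" "0 < t" by (simp_all add: t_def)
    have [measurable]: "R \<epsilon> \<in> borel_measurable M" "R t \<in> borel_measurable M" using e t by (auto intro: measurable_R)
    define D where "D = {\<omega> \<in> space M. curve t < R t \<omega>}"
    have Df: "D \<in> sets (future t)"
    proof -
      have [measurable]: "R t \<in> borel_measurable (future t)" by (rule measurable_R_future) simp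
      have "{\<omega> \<in> space (future t). curve t < R t \<omega>} \<in> sets (future t)" by measurable
      then show ?thesis by (simp add: D_def)
    qed
    have [measurable]: "D \<in> sets M" unfolding D_def by measurable
    have "(\<integral>\<^sup>+\<omega>. ennreal (ratio \<xi> \<epsilon> (R \<epsilon> \<omega>)) * indicator (space M - hit_after \<epsilon>) \<omega> \<partial>M)
      \<le> (\<integral>\<^sup>+\<omega>. ennreal (ratio \<xi> \<epsilon> (R \<epsilon> \<omega>)) * indicator {y. y < curve \<epsilon>} (R \<epsilon> \<omega>) + ennreal (ratio \<xi> \<epsilon> (R \<epsilon> \<omega>)) * indicator D \<omega> \<partial>M)"
    proof (intro nn_integral_mono)
      fix \<omega> assume w: "\<omega> \<in> space M"
      have "\<omega> \<notin> hit_after \<epsilon> \<Longrightarrow> R \<epsilon> \<omega> < curve \<epsilon> \<or> \<omega> \<in> D"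
        using no_hit_sign[OF w _ t(1)] e w by (auto simp: D_def)
      then show "ennreal (ratio \<xi> \<epsilon> (R \<epsilon> \<omega>)) * indicator (space M - hit_after \<epsilon>) \<omega>
        \<le> ennreal (ratio \<xi> \<epsilon> (R \<epsilon> \<omega>)) * indicator {y. y < curve \<epsilon>} (R \<epsilon> \<omega>) + ennreal (ratio \<xi> \<epsilon> (R \<epsilon> \<omega>)) * indicator D \<omega>"
        using w by (cases "\<omega> \<in> hit_after \<epsilon>"; cases "R \<epsilon> \<omega> < curve \<epsilon>"; cases "\<omega> \<in> D") auto
    qed
    also have "\<dots> = (\<integral>\<^sup>+\<omega>. ennreal (ratio \<xi> \<epsilon> (R \<epsilon> \<omega>)) * indicator {y. y < curve \<epsilon>} (R \<epsilon> \<omega>) \<partial>M) + (\<integral>\<^sup>+\<omega>. ennreal (ratio \<xi> \<epsilon> (R \<epsilon> \<omega>)) * indicator D \<omega> \<partial>M)"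
      by (rule nn_integral_add) measurable
    also have "(\<integral>\<^sup>+\<omega>. ennreal (ratio \<xi> \<epsilon> (R \<epsilon> \<omega>)) * indicator {y. y < curve \<epsilon>} (R \<epsilon> \<omega>) \<partial>M) = ?A"
      by (rule nn_integral_ratio[OF e]) measurable
    also have "(\<integral>\<^sup>+\<omega>. ennreal (ratio \<xi> \<epsilon> (R \<epsilon> \<omega>)) * indicator D \<omega> \<partial>M) = (\<integral>\<^sup>+\<omega>. ennreal (ratio \<xi> t (R t \<omega>)) * indicator D \<omega> \<partial>M)"
      by (rule reverse_martingale[OF e t(1) Df])
    also have "\<dots> = (\<integral>\<^sup>+\<omega>. ennreal (ratio \<xi> t (R t \<omega>)) * indicator {y. curve t < y} (R t \<omega>) \<partial>M)"
      by (intro nn_integral_cong) (simp add: D_def split: split_indicator)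
    also have "\<dots> = transition t (indicator {y. curve t < y}) \<xi>"
      by (rule nn_integral_ratio[OF t(2)]) measurable
    finally show ?thesis unfolding t_def .
  qed
  then show "\<exists>N. \<forall>n\<ge>N. (\<integral>\<^sup>+\<omega>. ennreal (ratio \<xi> \<epsilon> (R \<epsilon> \<omega>)) * indicator (space M - hit_after \<epsilon>) \<omega> \<partial>M)
    \<le> ?A + transition (real (Suc n)) (indicator {y. curve (real (Suc n)) < y}) \<xi>" by blast
qed

text \<open>As \<epsilon> decreases to 0 the stopped expectations increase. What they lack to 1 is
  the weighted mass of the paths that do not hit after \<epsilon>, at most the probability of lying
  below the curve at the small time \<epsilon> when started from \<xi> > 0.\<close>

theorem nn_integral_ratio_last_passage:
  assumes xi: "0 < \<xi>"
  shows "(\<integral>\<^sup>+\<omega>. ennreal (ratio \<xi> (G \<omega>) (curve (G \<omega>))) * indicator {\<omega> \<in> space M. 0 < G \<omega>} \<omega> \<partial>M) = 1"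
proof -
  define e where "e n = 1 / real (Suc n)" for n
  have e: "0 < e n" for n by (simp add: e_def)
  define X where "X n \<omega> = ennreal (ratio \<xi> (G \<omega>) (curve (G \<omega>))) * indicator (hit_after (e n)) \<omega>" for n \<omega>
  let ?X = "\<lambda>\<omega>. ennreal (ratio \<xi> (G \<omega>) (curve (G \<omega>))) * indicator {\<omega> \<in> space M. 0 < G \<omega>} \<omega>"
  have ms: "hit_after (e n) \<in> sets M" for n using e[of n] by (intro sets_hit_after) simp
  note [measurable] = ms
  have [measurable]: "X n \<in> borel_measurable M" for n unfolding X_def by measurable
  have inc: "incseq X"
  proof (rule incseq_SucI, rule le_funI)
    fix n \<omega>
    have "e (Suc n) \<le> e n" by (simp add: e_def field_simps)
    then have "hit_after (e n) \<subseteq> hit_after (e (Suc n))" by (rule hit_after_antimono)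
    then show "X n \<omega> \<le> X (Suc n) \<omega>" unfolding X_def by (intro mult_left_mono) (auto split: split_indicator)
  qed
  have "AE \<omega> in M. (SUP n. X n \<omega>) = ?X \<omega>"
    using AE_not_unbounded AE_space
  proof eventually_elim
    case (elim \<omega>)
    have ge: "\<omega> \<in> hit_after (e n) \<longleftrightarrow> e n \<le> G \<omega>" for n
      using last_passage_ge_iff[OF elim(2,1) e] by simp
    show ?case
    proof (cases "0 < G \<omega>")
      case True
      obtain m where m: "e m < G \<omega>" unfolding e_def by (rule nat_approx_posE[OF True])
      have "X m \<omega> = ?X \<omega>" using m True ge[of m] elim by (simp add: X_def)
      moreover have "X n \<omega> \<le> ?X \<omega>" for n using True elim by (auto simp: X_def split: split_indicator)
      ultimately have "(SUP n. X n \<omega>) \<le> ?X \<omega>" by (intro SUP_least)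
      moreover have "X m \<omega> \<le> (SUP n. X n \<omega>)" by (rule SUP_upper) simp
      ultimately show ?thesis unfolding \<open>X m \<omega> = ?X \<omega>\<close> by (rule antisym)
    next
      case False
      have "\<omega> \<notin> hit_after (e n)" for n using ge[of n] e[of n] False by simp
      then show ?thesis using False by (simp add: X_def)
    qed
  qed
  then have "(\<integral>\<^sup>+\<omega>. (SUP n. X n \<omega>) \<partial>M) = integral\<^sup>N M ?X"
    by (rule nn_integral_cong_AE)
  then have "integral\<^sup>N M ?X = (\<integral>\<^sup>+\<omega>. (SUP n. X n \<omega>) \<partial>M)" by (rule sym)
  also have "\<dots> = (SUP n. integral\<^sup>N M (X n))"
    by (rule nn_integral_monotone_convergence_SUP[OF inc]) measurable
  also have "\<dots> = 1"
  proof (rule LIMSEQ_unique[OF LIMSEQ_SUP])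
    show "incseq (\<lambda>n. integral\<^sup>N M (X n))"
      by (intro incseq_SucI nn_integral_mono le_funD[OF incseq_SucD[OF inc]])
    define d where "d n = transition (e n) (indicator {y. y < curve (e n)}) \<xi>" for n
    have d0: "d \<longlonglongrightarrow> 0" unfolding d_def e_def using transition_below_tendsto[OF xi] by simp
    have up: "integral\<^sup>N M (X n) \<le> 1" and lo: "1 \<le> integral\<^sup>N M (X n) + d n" for n
    proof -
      have [measurable]: "R (e n) \<in> borel_measurable M" using e[of n] by (intro measurable_R) simp
      have Xn: "integral\<^sup>N M (X n) = (\<integral>\<^sup>+\<omega>. ennreal (ratio \<xi> (e n) (R (e n) \<omega>)) * indicator (hit_after (e n)) \<omega> \<partial>M)"
        unfolding X_def by (rule stop_at_last_passage[OF e])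
      also have "\<dots> \<le> (\<integral>\<^sup>+\<omega>. ennreal (ratio \<xi> (e n) (R (e n) \<omega>)) \<partial>M)"
        by (intro nn_integral_mono) (auto split: split_indicator)
      finally show "integral\<^sup>N M (X n) \<le> 1" by (simp add: nn_integral_ratio_space[OF e])
      have "1 = (\<integral>\<^sup>+\<omega>. ennreal (ratio \<xi> (e n) (R (e n) \<omega>)) * indicator (hit_after (e n)) \<omega> + ennreal (ratio \<xi> (e n) (R (e n) \<omega>)) * indicator (space M - hit_after (e n)) \<omega> \<partial>M)"
        by (subst nn_integral_ratio_space[of "e n" \<xi>, OF e, symmetric], intro nn_integral_cong) (simp split: split_indicator)
      also have "\<dots> = integral\<^sup>N M (X n) + (\<integral>\<^sup>+\<omega>. ennreal (ratio \<xi> (e n) (R (e n) \<omega>)) * indicator (space M - hit_after (e n)) \<omega> \<partial>M)"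
        unfolding Xn by (rule nn_integral_add) measurable
      also have "\<dots> \<le> integral\<^sup>N M (X n) + d n"
        unfolding d_def by (intro add_left_mono no_hit_mass_le e)
      finally show "1 \<le> integral\<^sup>N M (X n) + d n" .
    qed
    have "1 - d n \<le> integral\<^sup>N M (X n)" for n
      unfolding ennreal_minus_le_iff using lo[of n] by (simp add: add.commute)
    then have lo': "\<forall>\<^sub>F n in sequentially. 1 - d n \<le> integral\<^sup>N M (X n)" by (intro always_eventually allI)
    have up': "\<forall>\<^sub>F n in sequentially. integral\<^sup>N M (X n) \<le> 1" using up by (intro always_eventually allI)
    have "(\<lambda>n. 1 - d n) \<longlonglongrightarrow> 1 - 0"
      by (intro tendsto_diff_ennreal[OF tendsto_const d0]) simp_all
    moreover have "1 - 0 = (1::ennreal)" by simp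
    ultimately have "(\<lambda>n. 1 - d n) \<longlonglongrightarrow> 1" by (simp only:)
    then show "(\<lambda>n. integral\<^sup>N M (X n)) \<longlonglongrightarrow> 1"
      by (rule tendsto_sandwich[OF lo' up' _ tendsto_const])
  qed
  finally show ?thesis .
qed

end

section \<open>Decay of ratios of Kummer functions\<close>

definition kummer_c :: "complex \<Rightarrow> real \<Rightarrow> complex \<Rightarrow> complex" where
  "kummer_c \<alpha> \<beta> z = (\<Sum>k. pochhammer \<alpha> k / (of_real (pochhammer \<beta> k) * fact k) * z ^ k)"

context
  fixes \<beta> :: real
  assumes beta: "0 < \<beta>"
begin

lemma summable_kummer_c:
  "summable (\<lambda>k. norm (pochhammer \<alpha> k / (of_real (pochhammer \<beta> k) * fact k) * z ^ k :: complex))"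
\<comment> \<open>Since |\<alpha> + k| / (\<beta> + k) \<le> |\<alpha>| / \<beta> + 1, consecutive
  terms have ratio at most (|\<alpha>| / \<beta> + 1) |z| / (k + 1), which is at most 1/2 from this
  N on.\<close>
proof (rule summable_ratio_test[where c = "1/2" and N = "nat \<lceil>2 * (norm \<alpha> / \<beta> + 1) * norm z\<rceil>"])
  fix k assume "nat \<lceil>2 * (norm \<alpha> / \<beta> + 1) * norm z\<rceil> \<le> k"
  then have k: "2 * (norm \<alpha> / \<beta> + 1) * norm z \<le> real k" by linarith
  let ?f = "\<lambda>k. pochhammer \<alpha> k / (of_real (pochhammer \<beta> k) * fact k) * z ^ k :: complex"
  have bk: "0 < \<beta> + real k" using beta by simp
  have "norm (\<alpha> + of_nat k) \<le> norm \<alpha> + real k" by (rule order_trans[OF norm_triangle_ineq]) simp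
  also have "\<dots> \<le> (norm \<alpha> / \<beta> + 1) * (\<beta> + real k)"
    using beta by (simp add: field_simps)
  finally have "norm (\<alpha> + of_nat k) / (\<beta> + real k) \<le> norm \<alpha> / \<beta> + 1"
    using bk by (simp add: pos_divide_le_eq)
  then have "norm (\<alpha> + of_nat k) / (\<beta> + real k) * norm z / (real k + 1) \<le> (norm \<alpha> / \<beta> + 1) * norm z / (real k + 1)"
    by (intro divide_right_mono mult_right_mono) auto
  also have "\<dots> \<le> 1 / 2" using k by (simp add: field_simps)
  finally have le: "norm (\<alpha> + of_nat k) / (\<beta> + real k) * norm z / (real k + 1) \<le> 1 / 2" .
  have "norm (?f (Suc k)) = norm (\<alpha> + of_nat k) / (\<beta> + real k) * norm z / (real k + 1) * norm (?f k)"
  proof -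
    have b: "\<bar>\<beta> + real k\<bar> = \<beta> + real k" using bk by simp
    have "norm (complex_of_real \<beta> + of_nat k) = \<beta> + real k"
      using norm_of_real[where 'a = complex, of "\<beta> + real k"] b by simp
    moreover have "norm (fact (Suc k) :: complex) = (real k + 1) * norm (fact k :: complex)"
      by (simp add: norm_mult add.commute) (metis norm_of_nat of_nat_Suc)
    ultimately show ?thesis
      by (simp add: norm_mult norm_divide pochhammer_Suc norm_power mult_ac)
  qed
  also have "\<dots> \<le> 1 / 2 * norm (?f k)" by (rule mult_right_mono[OF le]) simp
  finally show "norm (norm (?f (Suc k))) \<le> 1 / 2 * norm (norm (?f k))" by simp
qed simp

text \<open>Compared coefficientwise, Kummer's equation is the recursion (k + 1) (k + \<beta>) f(k +
  1) = (\<alpha> + k) f(k).\<close>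

lemma kummer_c_ode:
  obtains w' w'' where "\<And>z. (kummer_c \<alpha> \<beta> has_field_derivative w' z) (at z)"
    "\<And>z. (w' has_field_derivative w'' z) (at z)"
    "\<And>z. z * w'' z + (of_real \<beta> - z) * w' z = \<alpha> * kummer_c \<alpha> \<beta> z"
proof -
  define f :: "nat \<Rightarrow> complex" where "f k = pochhammer \<alpha> k / (of_real (pochhammer \<beta> k) * fact k)" for k
  have s0: "summable (\<lambda>k. f k * z ^ k)" for z
    using summable_norm_cancel[OF summable_kummer_c[of \<alpha> z]] by (simp add: f_def)
  have s1: "summable (\<lambda>k. diffs f k * z ^ k)" for z by (rule termdiff_converges_all[OF s0])
  have s2: "summable (\<lambda>k. diffs (diffs f) k * z ^ k)" for z by (rule termdiff_converges_all[OF s1])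
  define w' where "w' z = (\<Sum>k. diffs f k * z ^ k)" for z
  define w'' where "w'' z = (\<Sum>k. diffs (diffs f) k * z ^ k)" for z
  have w: "kummer_c \<alpha> \<beta> = (\<lambda>z. \<Sum>k. f k * z ^ k)" by (simp add: kummer_c_def f_def fun_eq_iff)
  have d1: "(kummer_c \<alpha> \<beta> has_field_derivative w' z) (at z)" for z
    unfolding w w'_def by (rule termdiffs_strong_converges_everywhere[OF s0])
  have d2: "(w' has_field_derivative w'' z) (at z)" for z
    unfolding w'_def[abs_def] w''_def by (rule termdiffs_strong_converges_everywhere[OF s1])
  have rec: "of_nat (Suc k) * (of_nat k + of_real \<beta>) * f (Suc k) = (\<alpha> + of_nat k) * f k" for k
  proof -
    have "of_real \<beta> + of_nat k \<noteq> (0::complex)" using beta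
      by (metis add_pos_nonneg of_nat_0_le_iff of_real_add of_real_eq_0_iff of_real_of_nat_eq less_irrefl)
    moreover have "of_nat (Suc k) \<noteq> (0::complex)" by (rule of_nat_neq_0)
    moreover have "pochhammer \<beta> k \<noteq> 0" using beta pochhammer_pos[of \<beta> k] by simp
    ultimately show ?thesis
      unfolding f_def pochhammer_Suc fact_Suc by (simp add: divide_simps del: of_nat_Suc)
  qed
  have ode: "z * w'' z + (of_real \<beta> - z) * w' z = \<alpha> * kummer_c \<alpha> \<beta> z" for z
  proof -
    have t1: "(\<lambda>k. of_nat k * of_nat (Suc k) * f (Suc k) * z ^ k) sums (z * w'' z)"
    proof -
      have "(\<lambda>k. z * (diffs (diffs f) k * z ^ k)) sums (z * w'' z)"
        unfolding w''_def by (intro sums_mult summable_sums s2)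
      then have "(\<lambda>k. (\<lambda>k. of_nat k * of_nat (Suc k) * f (Suc k) * z ^ k) (Suc k)) sums (z * w'' z)"
        by (simp add: diffs_def mult_ac)
      then show ?thesis by (subst (asm) sums_Suc_iff) simp
    qed
    have t2: "(\<lambda>k. of_real \<beta> * (of_nat (Suc k) * f (Suc k) * z ^ k)) sums (of_real \<beta> * w' z)"
      unfolding w'_def using summable_sums[OF s1[of z]] by (intro sums_mult) (simp add: diffs_def)
    have t3: "(\<lambda>k. of_nat k * f k * z ^ k) sums (z * w' z)"
    proof -
      have "(\<lambda>k. z * (diffs f k * z ^ k)) sums (z * w' z)"
        unfolding w'_def by (intro sums_mult summable_sums s1)
      then have "(\<lambda>k. (\<lambda>k. of_nat k * f k * z ^ k) (Suc k)) sums (z * w' z)"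
        by (simp add: diffs_def mult_ac)
      then show ?thesis by (subst (asm) sums_Suc_iff) simp
    qed
    have t4: "(\<lambda>k. \<alpha> * (f k * z ^ k)) sums (\<alpha> * kummer_c \<alpha> \<beta> z)"
      unfolding w by (intro sums_mult summable_sums s0)
    have "(\<lambda>k. of_nat k * of_nat (Suc k) * f (Suc k) * z ^ k + of_real \<beta> * (of_nat (Suc k) * f (Suc k) * z ^ k) - of_nat k * f k * z ^ k)
      sums (z * w'' z + of_real \<beta> * w' z - z * w' z)"
      by (intro sums_diff sums_add t1 t2 t3)
    moreover have "of_nat k * of_nat (Suc k) * f (Suc k) * z ^ k + of_real \<beta> * (of_nat (Suc k) * f (Suc k) * z ^ k) - of_nat k * f k * z ^ k
      = \<alpha> * (f k * z ^ k)" for k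
    proof -
      have "of_nat k * of_nat (Suc k) * f (Suc k) * z ^ k + of_real \<beta> * (of_nat (Suc k) * f (Suc k) * z ^ k)
        = (of_nat (Suc k) * (of_nat k + of_real \<beta>) * f (Suc k)) * z ^ k" by (simp add: ring_distribs mult_ac)
      also have "\<dots> = (\<alpha> + of_nat k) * f k * z ^ k" unfolding rec ..
      finally show ?thesis by (simp add: ring_distribs mult_ac)
    qed
    ultimately have "(\<lambda>k. \<alpha> * (f k * z ^ k)) sums (z * w'' z + of_real \<beta> * w' z - z * w' z)" by (simp only:)
    with t4 have "\<alpha> * kummer_c \<alpha> \<beta> z = z * w'' z + of_real \<beta> * w' z - z * w' z" by (rule sums_unique2)
    then show ?thesis by (simp add: left_diff_distrib)
  qed
  show thesis by (rule that[OF d1 d2 ode])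
qed

text \<open>With \<open>w\<close> the Kummer function and \<open>p = z powr \<beta> * exp (-z)\<close>, the function \<open>F = p w' cnj w\<close>
  satisfies \<open>F' = p |w'|\<^sup>2 + \<alpha> (p / z) |w|\<^sup>2\<close>. Here \<open>A\<close>, \<open>P\<close> and \<open>Q\<close> are \<open>|w|\<^sup>2\<close> and the real and
  imaginary parts of \<open>F\<close>.\<close>

lemma kummer_c_flux:
  obtains A P Q V :: "real \<Rightarrow> real" where
    "\<And>z. A z = (norm (kummer_c \<alpha> \<beta> (of_real z)))\<^sup>2"
    "\<And>z. 0 < z \<Longrightarrow> (A has_real_derivative 2 * P z / (z powr \<beta> * exp (- z))) (at z)"
    "\<And>z. 0 < z \<Longrightarrow> (P has_real_derivative z powr \<beta> * exp (- z) * (V z + Re \<alpha> * A z / z)) (at z)"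
    "\<And>z. 0 < z \<Longrightarrow> (Q has_real_derivative z powr \<beta> * exp (- z) * (Im \<alpha> * A z / z)) (at z)"
    "\<And>z. (P z)\<^sup>2 + (Q z)\<^sup>2 = (z powr \<beta> * exp (- z))\<^sup>2 * (V z * A z)"
    "\<And>z. 0 \<le> V z"
    "P 0 = 0" "Q 0 = 0" "continuous_on {0..} A" "continuous_on {0..} P" "continuous_on {0..} Q"
proof -
  obtain w' w'' where d: "\<And>z. (kummer_c \<alpha> \<beta> has_field_derivative w' z) (at z)"
    "\<And>z. (w' has_field_derivative w'' z) (at z)"
    and ode: "\<And>z. z * w'' z + (of_real \<beta> - z) * w' z = \<alpha> * kummer_c \<alpha> \<beta> z"
    using kummer_c_ode[of \<alpha>] by blast
  define u1 u2 v1 v2 where "u1 z = Re (kummer_c \<alpha> \<beta> (of_real z))" and "u2 z = Im (kummer_c \<alpha> \<beta> (of_real z))"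
    and "v1 z = Re (w' (of_real z))" and "v2 z = Im (w' (of_real z))" for z
  have du1: "(u1 has_real_derivative v1 z) (at z)" and du2: "(u2 has_real_derivative v2 z) (at z)"
    and dv1: "(v1 has_real_derivative Re (w'' (of_real z))) (at z)" and dv2: "(v2 has_real_derivative Im (w'' (of_real z))) (at z)" for z
    unfolding u1_def[abs_def] u2_def[abs_def] v1_def[abs_def] v2_def[abs_def] has_real_derivative_iff_has_vector_derivative
    by (auto intro!: bounded_linear.has_vector_derivative[OF bounded_linear_Re] bounded_linear.has_vector_derivative[OF bounded_linear_Im]
        has_vector_derivative_real_field d)
  have r1: "Re (w'' (of_real z)) = (Re \<alpha> * u1 z - Im \<alpha> * u2 z - (\<beta> - z) * v1 z) / z"
    and r2: "Im (w'' (of_real z)) = (Im \<alpha> * u1 z + Re \<alpha> * u2 z - (\<beta> - z) * v2 z) / z" if z: "0 < z" for z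
  proof -
    have "Re (of_real z * w'' (of_real z) + (of_real \<beta> - of_real z) * w' (of_real z)) = Re (\<alpha> * kummer_c \<alpha> \<beta> (of_real z))"
      "Im (of_real z * w'' (of_real z) + (of_real \<beta> - of_real z) * w' (of_real z)) = Im (\<alpha> * kummer_c \<alpha> \<beta> (of_real z))"
      unfolding ode by simp_all
    then have "z * Re (w'' (of_real z)) = Re \<alpha> * u1 z - Im \<alpha> * u2 z - (\<beta> - z) * v1 z"
      "z * Im (w'' (of_real z)) = Im \<alpha> * u1 z + Re \<alpha> * u2 z - (\<beta> - z) * v2 z"
      unfolding u1_def u2_def v1_def v2_def by (simp_all add: algebra_simps)
    then show "Re (w'' (of_real z)) = (Re \<alpha> * u1 z - Im \<alpha> * u2 z - (\<beta> - z) * v1 z) / z"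
      "Im (w'' (of_real z)) = (Im \<alpha> * u1 z + Re \<alpha> * u2 z - (\<beta> - z) * v2 z) / z"
      using z by (simp_all add: eq_divide_eq mult.commute)
  qed
  \<comment> \<open>The integrating factor that brings Kummer's equation into the self-adjoint form
    (p w')' = \<alpha> p w / z.\<close>
  define p where "p z = z powr \<beta> * exp (- z)" for z
  have dp: "(p has_real_derivative p z * (\<beta> / z - 1)) (at z)" if z: "0 < z" for z
  proof -
    have "(p has_real_derivative (\<beta> * z powr (\<beta> - 1)) * exp (- z) + (exp (- z) * - 1) * z powr \<beta>) (at z)"
      unfolding p_def[abs_def] using z by (auto intro!: derivative_eq_intros)
    moreover have "z powr (\<beta> - 1) = z powr \<beta> / z" using z by (simp add: powr_diff)
    ultimately show ?thesis unfolding p_def by (simp add: algebra_simps)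
  qed
  define A where "A z = u1 z * u1 z + u2 z * u2 z" for z
  define V where "V z = v1 z * v1 z + v2 z * v2 z" for z
  define P where "P z = p z * (v1 z * u1 z + v2 z * u2 z)" for z
  define Q where "Q z = p z * (v2 z * u1 z - v1 z * u2 z)" for z
  have p0: "p z > 0" if "0 < z" for z using that by (simp add: p_def)
  have cu: "continuous_on S u1" "continuous_on S u2" "continuous_on S v1" "continuous_on S v2" for S
    using du1 du2 dv1 dv2 by (auto intro!: continuous_at_imp_continuous_on DERIV_isCont)
  have cp: "continuous_on {0..} p"
    unfolding p_def using beta by (intro continuous_on_mult continuous_on_powr' continuous_on_exp continuous_on_minus continuous_on_id continuous_on_const) auto
  show thesis
  proof (rule that[of A P V Q])
    show "A z = (norm (kummer_c \<alpha> \<beta> (of_real z)))\<^sup>2" for z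
      unfolding A_def cmod_power2 u1_def u2_def by (simp only: power2_eq_square)
    show "(A has_real_derivative 2 * P z / (z powr \<beta> * exp (- z))) (at z)" if z: "0 < z" for z
    proof -
      have "(A has_real_derivative (v1 z * u1 z + v1 z * u1 z) + (v2 z * u2 z + v2 z * u2 z)) (at z)"
        unfolding A_def[abs_def] by (intro DERIV_add DERIV_mult du1 du2)
      also have "(v1 z * u1 z + v1 z * u1 z) + (v2 z * u2 z + v2 z * u2 z) = 2 * P z / p z"
        unfolding P_def using p0[OF z] by simp
      finally show ?thesis unfolding p_def .
    qed
    show "(P has_real_derivative z powr \<beta> * exp (- z) * (V z + Re \<alpha> * A z / z)) (at z)" if z: "0 < z" for z
    proof -
      have "(P has_real_derivative p z * (\<beta> / z - 1) * (v1 z * u1 z + v2 z * u2 z)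
        + ((Re (w'' (of_real z)) * u1 z + v1 z * v1 z) + (Im (w'' (of_real z)) * u2 z + v2 z * v2 z)) * p z) (at z)"
        unfolding P_def[abs_def]
        by (rule DERIV_cong[OF DERIV_mult[OF dp[OF z] DERIV_add[OF DERIV_mult[OF dv1 du1] DERIV_mult[OF dv2 du2]]]]) (simp add: mult.commute)
      also have "p z * (\<beta> / z - 1) * (v1 z * u1 z + v2 z * u2 z)
        + ((Re (w'' (of_real z)) * u1 z + v1 z * v1 z) + (Im (w'' (of_real z)) * u2 z + v2 z * v2 z)) * p z
        = p z * (V z + Re \<alpha> * A z / z)"
        unfolding r1[OF z] r2[OF z] V_def A_def using z by (simp add: field_simps)
      finally show ?thesis unfolding p_def .
    qed
    show "(Q has_real_derivative z powr \<beta> * exp (- z) * (Im \<alpha> * A z / z)) (at z)" if z: "0 < z" for z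
    proof -
      have "(Q has_real_derivative p z * (\<beta> / z - 1) * (v2 z * u1 z - v1 z * u2 z)
        + ((Im (w'' (of_real z)) * u1 z + v1 z * v2 z) - (Re (w'' (of_real z)) * u2 z + v2 z * v1 z)) * p z) (at z)"
        unfolding Q_def[abs_def]
        by (rule DERIV_cong[OF DERIV_mult[OF dp[OF z] DERIV_diff[OF DERIV_mult[OF dv2 du1] DERIV_mult[OF dv1 du2]]]]) (simp add: mult.commute)
      also have "p z * (\<beta> / z - 1) * (v2 z * u1 z - v1 z * u2 z)
        + ((Im (w'' (of_real z)) * u1 z + v1 z * v2 z) - (Re (w'' (of_real z)) * u2 z + v2 z * v1 z)) * p z
        = p z * (Im \<alpha> * A z / z)"
        unfolding r1[OF z] r2[OF z] A_def using z by (simp add: field_simps)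
      finally show ?thesis unfolding p_def .
    qed
    show "(P z)\<^sup>2 + (Q z)\<^sup>2 = (z powr \<beta> * exp (- z))\<^sup>2 * (V z * A z)" for z
      unfolding P_def Q_def V_def A_def p_def[symmetric] by (simp add: power2_eq_square algebra_simps)
    show "0 \<le> V z" for z unfolding V_def by simp
    show "P 0 = 0" "Q 0 = 0" unfolding P_def Q_def p_def using beta by simp_all
    show "continuous_on {0..} A" "continuous_on {0..} P" "continuous_on {0..} Q"
      unfolding A_def[abs_def] P_def[abs_def] Q_def[abs_def]
      by (intro continuous_on_add continuous_on_diff continuous_on_mult cu cp)+
  qed
qed

text \<open>For Re \<alpha> \<ge> 0 the real part P of the flux vanishes at 0 and has a nonnegative
  derivative, so it is nonnegative; and the derivative of |w|^2 is 2 P / p.\<close>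

lemma norm_kummer_c_mono:
  assumes re: "0 \<le> Re \<alpha>" and z: "0 \<le> z" "z \<le> y"
  shows "norm (kummer_c \<alpha> \<beta> (of_real z)) \<le> norm (kummer_c \<alpha> \<beta> (of_real y))"
proof (cases "z = y")
  case False
  obtain A P Q V where F: "\<And>z. A z = (norm (kummer_c \<alpha> \<beta> (of_real z)))\<^sup>2"
    "\<And>z. 0 < z \<Longrightarrow> (A has_real_derivative 2 * P z / (z powr \<beta> * exp (- z))) (at z)"
    "\<And>z. 0 < z \<Longrightarrow> (P has_real_derivative z powr \<beta> * exp (- z) * (V z + Re \<alpha> * A z / z)) (at z)"
    "\<And>z. 0 \<le> V z" "P 0 = 0" "continuous_on {0..} A" "continuous_on {0..} P"
    by (rule kummer_c_flux[of \<alpha>]) blast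
  have A0: "0 \<le> A z" for z unfolding F(1) by simp
  have P0: "0 \<le> P z" if "0 < z" for z
  proof -
    have "P 0 \<le> P z"
    proof (rule DERIV_nonneg_imp_increasing_open[OF less_imp_le[OF that]])
      fix s assume s: "0 < s" "s < z"
      have "0 \<le> s powr \<beta> * exp (- s) * (V s + Re \<alpha> * A s / s)"
        using s re A0[of s] F(4)[of s] by (intro mult_nonneg_nonneg add_nonneg_nonneg divide_nonneg_nonneg) auto
      then show "\<exists>d. (P has_real_derivative d) (at s) \<and> 0 \<le> d" using F(3)[OF s(1)] by blast
    qed (rule continuous_on_subset[OF F(7)], auto)
    then show ?thesis using F(5) by simp
  qed
  have "A z \<le> A y"
  proof (rule DERIV_nonneg_imp_increasing_open[OF z(2)])
    fix s assume s: "z < s" "s < y"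
    then have s0: "0 < s" using z by simp
    have "0 \<le> 2 * P s / (s powr \<beta> * exp (- s))" using P0[OF s0] by simp
    then show "\<exists>d. (A has_real_derivative d) (at s) \<and> 0 \<le> d" using F(2)[OF s0] by blast
  qed (rule continuous_on_subset[OF F(6)], use z in auto)
  then show ?thesis unfolding F(1) by (rule power2_le_imp_le) simp
qed simp

lemma kummer_c_0 [simp]: "kummer_c \<alpha> \<beta> 0 = 1"
  unfolding kummer_c_def by (subst powser_zero) simp

lemma norm_kummer_c_ge_1: "0 \<le> Re \<alpha> \<Longrightarrow> 0 \<le> z \<Longrightarrow> 1 \<le> norm (kummer_c \<alpha> \<beta> (of_real z))"
  using norm_kummer_c_mono[of \<alpha> 0 z] by simp

text \<open>A bootstrap on the interval from z0 to z1 with \<theta> = Im \<alpha>. The derivative of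
  Q contains \<theta> |w|^2, so |Q| grows at least linearly. Since |F| = p |w'| |w|, a large Q
  forces a large |w'|^2; this makes P grow like (s - z0)^3 and |w|^2 like (s - z0)^4. In the end |w|
  gains a factor of order sqrt |\<theta>|; stating it with fourth powers avoids roots.\<close>

lemma norm_kummer_c_growth:
  assumes z: "0 < z0" "z0 < z1"
  obtains C where "0 < C" "\<And>\<alpha>. 0 \<le> Re \<alpha> \<Longrightarrow>
    C * (Im \<alpha>)\<^sup>2 * norm (kummer_c \<alpha> \<beta> (of_real z0)) ^ 4 \<le> norm (kummer_c \<alpha> \<beta> (of_real z1)) ^ 4"
proof -
  \<comment> \<open>Bounds for p = z powr \<beta> * exp (- z) on the interval: p \<le> p1 and m0
    \<le> p / z.\<close>
  define p1 where "p1 = z1 powr \<beta>"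
  define m0 where "m0 = z0 powr \<beta> * exp (- z1) / z1"
  have p1: "0 < p1" and m0: "0 < m0" using z by (auto simp: p1_def m0_def)
  define C where "C = m0\<^sup>2 * (z1 - z0) ^ 4 / (6 * p1\<^sup>2)"
  have C: "0 < C" unfolding C_def using z p1 m0 by simp
  have pz: "z powr \<beta> * exp (- z) \<le> p1" "m0 \<le> z powr \<beta> * exp (- z) / z" "0 < z powr \<beta> * exp (- z)" if z': "z0 \<le> z" "z \<le> z1" for z
  proof -
    have "z powr \<beta> \<le> p1" unfolding p1_def using z z' beta by (intro powr_mono2) auto
    moreover have "exp (- z) \<le> 1" using z z' by simp
    ultimately show "z powr \<beta> * exp (- z) \<le> p1" using p1 by (smt (verit) mult_left_le powr_ge_zero)
    have "z0 powr \<beta> * exp (- z1) \<le> z powr \<beta> * exp (- z)" using z z' beta by (intro mult_mono powr_mono2) auto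
    then show "m0 \<le> z powr \<beta> * exp (- z) / z" unfolding m0_def using z z' by (intro frac_le) auto
    show "0 < z powr \<beta> * exp (- z)" using z z' by simp
  qed
  have "C * (Im \<alpha>)\<^sup>2 * norm (kummer_c \<alpha> \<beta> (of_real z0)) ^ 4 \<le> norm (kummer_c \<alpha> \<beta> (of_real z1)) ^ 4" if re: "0 \<le> Re \<alpha>" for \<alpha>
  proof -
    obtain A P Q V where F: "\<And>z. A z = (norm (kummer_c \<alpha> \<beta> (of_real z)))\<^sup>2"
      "\<And>z. 0 < z \<Longrightarrow> (A has_real_derivative 2 * P z / (z powr \<beta> * exp (- z))) (at z)"
      "\<And>z. 0 < z \<Longrightarrow> (P has_real_derivative z powr \<beta> * exp (- z) * (V z + Re \<alpha> * A z / z)) (at z)"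
      "\<And>z. 0 < z \<Longrightarrow> (Q has_real_derivative z powr \<beta> * exp (- z) * (Im \<alpha> * A z / z)) (at z)"
      "\<And>z. (P z)\<^sup>2 + (Q z)\<^sup>2 = (z powr \<beta> * exp (- z))\<^sup>2 * (V z * A z)"
      "\<And>z. 0 \<le> V z" "P 0 = 0" "Q 0 = 0" "continuous_on {0..} A" "continuous_on {0..} P" "continuous_on {0..} Q"
      by (rule kummer_c_flux[of \<alpha>]) blast
    define \<theta> where "\<theta> = Im \<alpha>"
    define A0 where "A0 = A z0"
    define A1 where "A1 = A z1"
    have mono: "A y \<le> A z" if "0 \<le> y" "y \<le> z" for y z
      unfolding F(1) using norm_kummer_c_mono[OF re that] by (intro power_mono) auto
    have Age: "1 \<le> A z" if "0 \<le> z" for z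
      unfolding F(1) using norm_kummer_c_ge_1[OF re that] by (intro one_le_power)
    have A01: "1 \<le> A0" "1 \<le> A1" unfolding A0_def A1_def using z by (auto intro!: Age)
    have sub: "{s..t} \<subseteq> {0..}" if "0 \<le> s" for s t :: real using that by auto
    \<comment> \<open>The factor \<theta> on both sides spares a distinction by its sign.\<close>
    have Q1: "\<theta>\<^sup>2 * A0 * m0 * (t - z0) \<le> \<theta> * Q t" if t: "z0 \<le> t" "t \<le> z1" for t
    proof -
      have "\<theta> * Q 0 \<le> \<theta> * Q z0"
      proof (rule DERIV_nonneg_imp_increasing_open[OF less_imp_le[OF z(1)], where f = "\<lambda>s. \<theta> * Q s"])
        fix s assume s: "0 < s" "s < z0"
        have "((\<lambda>s. \<theta> * Q s) has_real_derivative \<theta> * (s powr \<beta> * exp (- s) * (Im \<alpha> * A s / s))) (at s)"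
          by (intro DERIV_cmult F(4) s)
        moreover have "0 \<le> \<theta> * (s powr \<beta> * exp (- s) * (Im \<alpha> * A s / s))"
        proof -
          have eq: "\<theta> * (s powr \<beta> * exp (- s) * (Im \<alpha> * A s / s)) = (\<theta> * \<theta>) * (s powr \<beta> * exp (- s) * (A s / s))"
            unfolding \<theta>_def by simp
          have "0 \<le> s powr \<beta> * exp (- s) * (A s / s)" using s Age[of s] by simp
          then show "0 \<le> \<theta> * (s powr \<beta> * exp (- s) * (Im \<alpha> * A s / s))"
            unfolding eq by (rule mult_nonneg_nonneg[OF zero_le_square])
        qed
        ultimately show "\<exists>d. ((\<lambda>s. \<theta> * Q s) has_real_derivative d) (at s) \<and> 0 \<le> d" by blast
      qed (use z in \<open>auto intro!: continuous_on_mult continuous_on_const continuous_on_subset[OF F(11)]\<close>)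
      then have q0: "0 \<le> \<theta> * Q z0" using F(8) by simp
      have "\<theta> * Q z0 - \<theta>\<^sup>2 * A0 * m0 * (z0 - z0) \<le> \<theta> * Q t - \<theta>\<^sup>2 * A0 * m0 * (t - z0)"
      proof (rule DERIV_nonneg_imp_increasing_open[OF t(1), where f = "\<lambda>s. \<theta> * Q s - \<theta>\<^sup>2 * A0 * m0 * (s - z0)"])
        fix s assume s: "z0 < s" "s < t"
        then have s0: "0 < s" "s \<le> z1" using z t by auto
        have "((\<lambda>s. \<theta> * Q s - \<theta>\<^sup>2 * A0 * m0 * (s - z0)) has_real_derivative \<theta> * (s powr \<beta> * exp (- s) * (Im \<alpha> * A s / s)) - \<theta>\<^sup>2 * A0 * m0 * (1 - 0)) (at s)"
          by (intro DERIV_diff DERIV_cmult F(4) s0 DERIV_ident DERIV_const)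
        moreover have "0 \<le> \<theta> * (s powr \<beta> * exp (- s) * (Im \<alpha> * A s / s)) - \<theta>\<^sup>2 * A0 * m0 * (1 - 0)"
        proof -
          have "A0 * m0 \<le> A s * (s powr \<beta> * exp (- s) / s)"
            unfolding A0_def using mono[of z0 s] pz(2)[of s] s s0 z m0 Age[of s] by (intro mult_mono) auto
          then have "\<theta>\<^sup>2 * (A0 * m0) \<le> \<theta>\<^sup>2 * (A s * (s powr \<beta> * exp (- s) / s))" by (rule mult_left_mono) simp
          then show ?thesis unfolding \<theta>_def by (simp add: power2_eq_square mult_ac)
        qed
        ultimately show "\<exists>d. ((\<lambda>s. \<theta> * Q s - \<theta>\<^sup>2 * A0 * m0 * (s - z0)) has_real_derivative d) (at s) \<and> 0 \<le> d" by blast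
      qed (use z in \<open>auto intro!: continuous_on_diff continuous_on_id continuous_on_mult continuous_on_const continuous_on_subset[OF F(11)]\<close>)
      then show ?thesis using q0 by simp
    qed
    \<comment> \<open>From Q^2 \<le> p^2 V A with p A \<le> p1 A1. The value A1 to be estimated
      enters the denominator; it is cleared at the end by multiplication with A1, which produces the
      square of A1.\<close>
    define \<kappa> where "\<kappa> = \<theta>\<^sup>2 * A0\<^sup>2 * m0\<^sup>2 / (p1 * A1)"
    have k: "0 \<le> \<kappa>" unfolding \<kappa>_def using p1 A01 by simp
    have Vk: "\<kappa> * (s - z0)\<^sup>2 \<le> s powr \<beta> * exp (- s) * V s" if s: "z0 \<le> s" "s \<le> z1" for s
    proof (cases "\<theta> = 0")
      case True
      then show ?thesis using F(6)[of s] by (simp add: \<kappa>_def)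
    next
      case False
      let ?p = "s powr \<beta> * exp (- s)"
      have p: "0 < ?p" "?p \<le> p1" using pz[OF s] by auto
      have As: "0 < A s" "A s \<le> A1" using Age[of s] mono[of s z1] s z unfolding A1_def by auto
      have "(\<theta>\<^sup>2 * A0 * m0 * (s - z0))\<^sup>2 \<le> (\<theta> * Q s)\<^sup>2"
        using Q1[OF s] m0 A01 s by (intro power_mono) auto
      then have "\<theta>\<^sup>2 * (\<theta>\<^sup>2 * A0\<^sup>2 * m0\<^sup>2 * (s - z0)\<^sup>2) \<le> \<theta>\<^sup>2 * (Q s)\<^sup>2"
        by (simp add: power_mult_distrib power2_eq_square mult_ac)
      then have "\<theta>\<^sup>2 * A0\<^sup>2 * m0\<^sup>2 * (s - z0)\<^sup>2 \<le> (Q s)\<^sup>2" using False by simp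
      also have "\<dots> \<le> (P s)\<^sup>2 + (Q s)\<^sup>2" by simp
      also have "\<dots> = (?p * A s) * (?p * V s)" unfolding F(5) by (simp add: power2_eq_square)
      also have "\<dots> \<le> (p1 * A1) * (?p * V s)"
        using p As F(6)[of s] by (intro mult_right_mono mult_mono) auto
      finally show ?thesis unfolding \<kappa>_def using p1 A01 by (simp add: pos_divide_le_eq mult_ac)
    qed
    have P0: "0 \<le> P s" if "0 < s" for s
    proof -
      have "P 0 \<le> P s"
      proof (rule DERIV_nonneg_imp_increasing_open[OF less_imp_le[OF that]])
        fix t assume t: "0 < t" "t < s"
        have "0 \<le> t powr \<beta> * exp (- t) * (V t + Re \<alpha> * A t / t)"
          using t re Age[of t] F(6)[of t] by (intro mult_nonneg_nonneg add_nonneg_nonneg divide_nonneg_nonneg) auto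
        then show "\<exists>d. (P has_real_derivative d) (at t) \<and> 0 \<le> d" using F(3)[OF t(1)] by blast
      qed (rule continuous_on_subset[OF F(10)], auto)
      then show ?thesis using F(7) by simp
    qed
    have P1: "\<kappa> / 3 * (t - z0) ^ 3 \<le> P t" if t: "z0 \<le> t" "t \<le> z1" for t
    proof -
      have "P z0 - \<kappa> / 3 * (z0 - z0) ^ 3 \<le> P t - \<kappa> / 3 * (t - z0) ^ 3"
      proof (rule DERIV_nonneg_imp_increasing_open[OF t(1), where f = "\<lambda>s. P s - \<kappa> / 3 * (s - z0) ^ 3"])
        fix s assume s: "z0 < s" "s < t"
        then have s0: "0 < s" "s \<le> z1" "z0 \<le> s" using z t by auto
        have "((\<lambda>s. P s - \<kappa> / 3 * (s - z0) ^ 3) has_real_derivative s powr \<beta> * exp (- s) * (V s + Re \<alpha> * A s / s) - \<kappa> * (s - z0)\<^sup>2) (at s)"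
          by (rule DERIV_diff[OF F(3)[OF s0(1)]]) (auto intro!: derivative_eq_intros)
        moreover have "s powr \<beta> * exp (- s) * V s \<le> s powr \<beta> * exp (- s) * (V s + Re \<alpha> * A s / s)"
          using s0 re Age[of s] by (intro mult_left_mono) auto
        then have "0 \<le> s powr \<beta> * exp (- s) * (V s + Re \<alpha> * A s / s) - \<kappa> * (s - z0)\<^sup>2"
          using Vk[OF s0(3,2)] by linarith
        ultimately show "\<exists>d. ((\<lambda>s. P s - \<kappa> / 3 * (s - z0) ^ 3) has_real_derivative d) (at s) \<and> 0 \<le> d" by blast
      qed (use z in \<open>auto intro!: continuous_intros continuous_on_subset[OF F(10)]\<close>)
      then show ?thesis using P0[OF z(1)] by simp
    qed
    have "A z0 - \<kappa> / (6 * p1) * (z0 - z0) ^ 4 \<le> A z1 - \<kappa> / (6 * p1) * (z1 - z0) ^ 4"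
    proof (rule DERIV_nonneg_imp_increasing_open[OF less_imp_le[OF z(2)], where f = "\<lambda>s. A s - \<kappa> / (6 * p1) * (s - z0) ^ 4"])
      fix s assume s: "z0 < s" "s < z1"
      then have s0: "0 < s" "z0 \<le> s" "s \<le> z1" using z by auto
      let ?p = "s powr \<beta> * exp (- s)"
      have p: "0 < ?p" "?p \<le> p1" using pz[OF s0(2,3)] by auto
      have "((\<lambda>s. A s - \<kappa> / (6 * p1) * (s - z0) ^ 4) has_real_derivative 2 * P s / ?p - 2 * (\<kappa> / 3 * (s - z0) ^ 3) / p1) (at s)"
        by (rule DERIV_diff[OF F(2)[OF s0(1)]]) (use p1 in \<open>auto intro!: derivative_eq_intros\<close>)
      moreover have "2 * (\<kappa> / 3 * (s - z0) ^ 3) / p1 \<le> 2 * P s / ?p"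
        using P1[OF s0(2,3)] p P0[OF s0(1)] by (intro frac_le) auto
      then have "0 \<le> 2 * P s / ?p - 2 * (\<kappa> / 3 * (s - z0) ^ 3) / p1" by simp
      ultimately show "\<exists>d. ((\<lambda>s. A s - \<kappa> / (6 * p1) * (s - z0) ^ 4) has_real_derivative d) (at s) \<and> 0 \<le> d" by blast
    qed (use z p1 in \<open>auto intro!: continuous_intros continuous_on_subset[OF F(9)]\<close>)
    then have "\<kappa> / (6 * p1) * (z1 - z0) ^ 4 \<le> A1" using A01 unfolding A0_def A1_def by simp
    then have "\<kappa> / (6 * p1) * (z1 - z0) ^ 4 * A1 \<le> A1 * A1" using A01 by (intro mult_right_mono) auto
    moreover have "\<kappa> / (6 * p1) * (z1 - z0) ^ 4 * A1 = C * \<theta>\<^sup>2 * (A0 * A0)"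
      unfolding \<kappa>_def C_def using p1 A01 by (simp add: power2_eq_square mult_ac)
    ultimately have "C * \<theta>\<^sup>2 * (A0 * A0) \<le> A1 * A1" by simp
    then show ?thesis unfolding A0_def A1_def F(1) \<theta>_def by (simp add: power2_eq_square power4_eq_xxxx mult_ac)
  qed
  then show thesis using that C by blast
qed

end

section \<open>Mellin, Fourier and Laplace transforms\<close>

text \<open>Each application of \<open>norm_kummer_c_growth\<close> gains a factor of order sqrt |Im
  \<alpha>|; four of them give the quadratic decay that is integrable along a vertical line.\<close>

lemma kummer_c_ratio_decay:
  assumes beta: "0 < \<beta>" and z: "0 \<le> z0" "z0 < z1"
  obtains K where "\<And>\<alpha>. 0 \<le> Re \<alpha> \<Longrightarrow>
    norm (kummer_c \<alpha> \<beta> (of_real z0) / kummer_c \<alpha> \<beta> (of_real z1)) * (1 + (Im \<alpha>)\<^sup>2) \<le> K"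
proof -
  \<comment> \<open>Five subintervals for four applications: z0 may be 0, while the growth estimate
    needs a positive left end, so on the first subinterval only monotonicity is used.\<close>
  define y where "y j = z0 + (z1 - z0) * ((real j + 1) / 5)" for j :: nat
  have y0: "0 < y j" for j using z by (auto simp: y_def intro!: add_nonneg_pos)
  have ys: "y j < y (Suc j)" for j using z by (simp add: y_def)
  have y1: "z0 \<le> y 0" "y 4 = z1" using z by (auto simp: y_def)
  have "\<exists>C>0. \<forall>\<alpha>. 0 \<le> Re \<alpha> \<longrightarrow> C * (Im \<alpha>)\<^sup>2 * norm (kummer_c \<alpha> \<beta> (of_real (y j))) ^ 4 \<le> norm (kummer_c \<alpha> \<beta> (of_real (y (Suc j)))) ^ 4" for j
    using norm_kummer_c_growth[OF beta y0[of j] ys[of j]] by blast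
  then have "\<forall>j. \<exists>C. 0 < C \<and> (\<forall>\<alpha>. 0 \<le> Re \<alpha> \<longrightarrow> C * (Im \<alpha>)\<^sup>2 * norm (kummer_c \<alpha> \<beta> (of_real (y j))) ^ 4 \<le> norm (kummer_c \<alpha> \<beta> (of_real (y (Suc j)))) ^ 4)"
    by (rule allI)
  then obtain C where "\<forall>j. 0 < C j \<and> (\<forall>\<alpha>. 0 \<le> Re \<alpha> \<longrightarrow> C j * (Im \<alpha>)\<^sup>2 * norm (kummer_c \<alpha> \<beta> (of_real (y j))) ^ 4 \<le> norm (kummer_c \<alpha> \<beta> (of_real (y (Suc j)))) ^ 4)"
    by (rule choice[THEN exE])
  then have C: "\<And>j. 0 < C j" "\<And>j \<alpha>. 0 \<le> Re \<alpha> \<Longrightarrow> C j * (Im \<alpha>)\<^sup>2 * norm (kummer_c \<alpha> \<beta> (of_real (y j))) ^ 4 \<le> norm (kummer_c \<alpha> \<beta> (of_real (y (Suc j)))) ^ 4"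
    by blast+
  define D where "D = root 4 (C 3 * C 2 * C 1 * C 0)"
  have D: "0 < D" "D ^ 4 = C 3 * C 2 * C 1 * C 0"
    using C(1)[of 0] C(1)[of 1] C(1)[of 2] C(1)[of 3] by (auto simp: D_def)
  have "norm (kummer_c \<alpha> \<beta> (of_real z0) / kummer_c \<alpha> \<beta> (of_real z1)) * (1 + (Im \<alpha>)\<^sup>2) \<le> 1 + 1 / D" if re: "0 \<le> Re \<alpha>" for \<alpha>
  proof -
    define N where "N j = norm (kummer_c \<alpha> \<beta> (of_real (y j)))" for j
    define n0 n1 \<theta> where "n0 = norm (kummer_c \<alpha> \<beta> (of_real z0))" and "n1 = norm (kummer_c \<alpha> \<beta> (of_real z1))" and "\<theta> = (Im \<alpha>)\<^sup>2"
    have th: "0 \<le> \<theta>" by (simp add: \<theta>_def)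
    have n: "0 \<le> n0" "n0 \<le> N 0" "n0 \<le> n1" "1 \<le> n1" "N 4 = n1"
      unfolding n0_def n1_def N_def y1(2) using norm_kummer_c_mono[OF beta re z(1) y1(1)] norm_kummer_c_mono[OF beta re z(1) less_imp_le[OF z(2)]]
        norm_kummer_c_ge_1[OF beta re, of z1] z by auto
    have step: "C j * \<theta> * N j ^ 4 \<le> N (Suc j) ^ 4" for j
      unfolding N_def \<theta>_def using C(2)[OF re] .
    have cj: "0 \<le> C j * \<theta>" for j using C(1)[of j] th by (simp add: less_imp_le)
    have "(D * \<theta> * n0) ^ 4 = C 3 * \<theta> * (C 2 * \<theta> * (C 1 * \<theta> * (C 0 * \<theta> * n0 ^ 4)))"
      unfolding power_mult_distrib D(2) by (simp add: power4_eq_xxxx)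
    also have "\<dots> \<le> C 3 * \<theta> * (C 2 * \<theta> * (C 1 * \<theta> * (C 0 * \<theta> * N 0 ^ 4)))"
      using n by (intro mult_left_mono power_mono cj) auto
    also have "\<dots> \<le> C 3 * \<theta> * (C 2 * \<theta> * (C 1 * \<theta> * N 1 ^ 4))"
      using step[of 0] by (intro mult_left_mono cj) simp
    also have "\<dots> \<le> C 3 * \<theta> * (C 2 * \<theta> * N 2 ^ 4)"
      using step[of 1] by (intro mult_left_mono cj) (simp add: numeral_2_eq_2)
    also have "\<dots> \<le> C 3 * \<theta> * N 3 ^ 4"
      using step[of 2] by (intro mult_left_mono cj) (simp add: numeral_3_eq_3 numeral_2_eq_2)
    also have "\<dots> \<le> n1 ^ 4"
      using step[of 3] n(5) by (simp add: eval_nat_numeral)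
    finally have "(D * \<theta> * n0) ^ 4 \<le> n1 ^ 4" .
    moreover have "Suc 3 = 4" "0 \<le> n1" using n by simp_all
    ultimately have "D * \<theta> * n0 \<le> n1" using power_le_imp_le_base[of "D * \<theta> * n0" 3 n1] by (simp only:)
    then have "n0 * \<theta> \<le> n1 * (1 / D)" using D by (simp add: field_simps)
    then have "n0 * (1 + \<theta>) \<le> n1 * (1 + 1 / D)" using n by (simp add: distrib_left)
    then show ?thesis unfolding norm_divide n0_def[symmetric] n1_def[symmetric] \<theta>_def[symmetric]
      using n by (simp add: divide_le_eq mult.commute)
  qed
  then show thesis by (rule that)
qed

section \<open>Mellin transforms\<close>

lemma has_bochner_integral_Gamma_scaled:
  assumes z: "0 < Re z" and p: "0 < p"
  shows "has_bochner_integral lborel (\<lambda>t. indicator {0<..} t *\<^sub>R (of_real t powr (z - 1) * of_real (exp (- p * t)) :: complex))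
    (Gamma z * of_real p powr (- z))"
proof -
  let ?f = "\<lambda>t. of_real t powr (z - 1) / of_real (exp t) :: complex"
  let ?g = "\<lambda>t. indicator {0<..} t *\<^sub>R ?f t"
  have g: "?g = (\<lambda>t. indicator {0<..} t *\<^sub>R (exp ((z - 1) * of_real (ln t)) / of_real (exp t)))"
  proof
    fix t show "?g t = indicator {0<..} t *\<^sub>R (exp ((z - 1) * of_real (ln t)) / of_real (exp t))"
      by (cases "0 < t") (simp_all add: powr_def Ln_of_real)
  qed
  have "continuous_on {0<..} (\<lambda>t. exp ((z - 1) * of_real (ln t)) / of_real (exp t) :: complex)"
    by (intro continuous_intros) auto
  then have "(\<lambda>t. indicator {0<..} t *\<^sub>R (exp ((z - 1) * of_real (ln t)) / of_real (exp t) :: complex)) \<in> borel_measurable borel"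
    by (intro borel_measurable_continuous_on_indicator) auto
  then have m: "?g \<in> borel_measurable lborel" unfolding g by (simp only: measurable_lborel2)
  have "integrable lebesgue ?g"
    using absolutely_integrable_Gamma_integral'[OF z] by (simp add: set_integrable_def)
  then have i: "set_integrable lborel {0<..} ?f"
    using m by (simp add: set_integrable_def integrable_completion)
  have "(LINT t:{0<..}|lborel. ?f t) = Gamma z"
    using set_borel_integral_eq_integral(2)[OF i] Gamma_integral_complex'[OF z] by (simp add: integral_unique)
  then have "has_bochner_integral lborel ?g (Gamma z)"
    using i by (simp add: has_bochner_integral_iff set_integrable_def set_lebesgue_integral_def)
  then have "has_bochner_integral lborel (\<lambda>t. ?g (0 + p * t)) (Gamma z /\<^sub>R \<bar>p\<bar>)"
    using p by (subst lborel_has_bochner_integral_real_affine_iff[symmetric]) auto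
  then have "has_bochner_integral lborel (\<lambda>t. of_real p powr (1 - z) * ?g (0 + p * t)) (of_real p powr (1 - z) * (Gamma z /\<^sub>R \<bar>p\<bar>))"
    by (intro has_bochner_integral_mult_right)
  moreover have "of_real p powr (1 - z) * ?g (0 + p * t) = indicator {0<..} t *\<^sub>R (of_real t powr (z - 1) * of_real (exp (- p * t)))" for t
  proof (cases "0 < t")
    case True
    have "(of_real (p * t) :: complex) powr (z - 1) = of_real p powr (z - 1) * of_real t powr (z - 1)"
      using True p by (simp add: powr_times_real)
    moreover have "(of_real p :: complex) powr (1 - z) * of_real p powr (z - 1) = 1"
      using p by (simp add: powr_add[symmetric])
    moreover have "(of_real (exp (- p * t)) :: complex) = 1 / of_real (exp (p * t))"
      by (simp add: exp_minus inverse_eq_divide)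
    ultimately show ?thesis using True p by (simp add: mult.assoc[symmetric])
  qed (use p in \<open>auto simp: zero_less_mult_iff\<close>)
  moreover have "of_real p powr (1 - z) * (Gamma z /\<^sub>R \<bar>p\<bar>) = Gamma z * of_real p powr (- z)"
    using p by (simp add: powr_diff powr_minus scaleR_conv_of_real field_simps)
  ultimately show ?thesis by simp
qed

lemma complex_powr_add_nat: "0 < t \<Longrightarrow> (of_real t :: complex) powr (z + of_nat k) = of_real t powr z * of_real t ^ k"
  by (simp add: powr_add powr_nat)

text \<open>Termwise integration of the series of J by Euler integrals: Gamma (\<alpha> + k) / Gamma
  (\<nu> + k + 1) becomes the quotient of Pochhammer symbols in Kummer's series.\<close>

lemma mellin_bessel_clifford:
  assumes nu: "\<nu> > -1" and re: "0 < Re \<alpha>" and p: "0 < p" and kappa: "0 \<le> \<kappa>"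
  shows "has_bochner_integral lborel
    (\<lambda>t. indicator {0<..} t *\<^sub>R (of_real t powr (\<alpha> - 1) * of_real (exp (- p * t) * bessel_clifford \<nu> (\<kappa> * t))) :: complex)
    (Gamma \<alpha> / of_real (Gamma (\<nu> + 1)) * of_real p powr (- \<alpha>) * kummer_c \<alpha> (\<nu> + 1) (of_real (\<kappa> / p)))"
proof -
  have nu1: "0 < \<nu> + 1" using nu by simp
  define d where "d k = 1 / (fact k * Gamma (\<nu> + real k + 1))" for k
  have d0: "0 \<le> d k" for k using Gamma_shift_pos[OF nu, of k] by (simp add: d_def less_imp_le)
  define f where "f \<alpha> k t = (of_real (d k * \<kappa> ^ k) :: complex) * (indicator {0<..} t *\<^sub>R (of_real t powr (\<alpha> + of_nat k - 1) * of_real (exp (- p * t))))" for \<alpha> :: complex and k and t :: real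
  define T where "T \<alpha> k = pochhammer \<alpha> k / (of_real (pochhammer (\<nu> + 1) k) * fact k) * (of_real (\<kappa> / p)) ^ k" for \<alpha> :: complex and k
  define c where "c \<alpha> = Gamma \<alpha> / of_real (Gamma (\<nu> + 1)) * of_real p powr (- \<alpha>)" for \<alpha> :: complex
  have F: "has_bochner_integral lborel (f \<alpha> k) (c \<alpha> * T \<alpha> k)" if re: "0 < Re \<alpha>" for \<alpha> k
  proof -
    have "0 < Re (\<alpha> + of_nat k)" using re by simp
    then have "has_bochner_integral lborel (f \<alpha> k) (of_real (d k * \<kappa> ^ k) * (Gamma (\<alpha> + of_nat k) * of_real p powr (- (\<alpha> + of_nat k))))"
      unfolding f_def by (intro has_bochner_integral_mult_right has_bochner_integral_Gamma_scaled p)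
    also have "of_real (d k * \<kappa> ^ k) * (Gamma (\<alpha> + of_nat k) * of_real p powr (- (\<alpha> + of_nat k))) = c \<alpha> * T \<alpha> k"
    proof -
      have na: "\<alpha> \<notin> \<int>\<^sub>\<le>\<^sub>0" using re by (auto elim!: nonpos_Ints_cases)
      have nn: "\<nu> + 1 \<notin> \<int>\<^sub>\<le>\<^sub>0" using nu by (auto elim!: nonpos_Ints_cases)
      have G: "Gamma (\<alpha> + of_nat k) = Gamma \<alpha> * pochhammer \<alpha> k"
        using pochhammer_Gamma[OF na, of k] Gamma_nonzero[OF na] by (simp add: field_simps)
      have G2: "Gamma (\<nu> + real k + 1) = Gamma (\<nu> + 1) * pochhammer (\<nu> + 1) k"
        using pochhammer_Gamma[OF nn, of k] Gamma_nonzero[OF nn] by (simp add: field_simps)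
      have P: "(of_real p :: complex) powr (- (\<alpha> + of_nat k)) = of_real p powr (- \<alpha>) / of_real p ^ k"
        using p by (simp add: powr_diff powr_nat)
      show ?thesis unfolding c_def T_def d_def G G2 P by (simp add: power_divide mult_ac)
    qed
    finally show ?thesis .
  qed
  have int: "integrable lborel (f \<alpha> k)" and eq: "(LINT t|lborel. f \<alpha> k t) = c \<alpha> * T \<alpha> k" if "0 < Re \<alpha>" for \<alpha> k
    using F[OF that, of k] by (auto simp: has_bochner_integral_iff)
  \<comment> \<open>The norm of a term is the same term for the real parameter Re \<alpha>, so
    absolute convergence is the same computation with \<alpha> replaced by Re \<alpha>.\<close>
  have nf: "of_real (norm (f \<alpha> k t)) = f (of_real (Re \<alpha>)) k t" for k t
  proof (cases "0 < t")
    case True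
    have e: "of_real (Re \<alpha>) + of_nat k - 1 = (of_real (Re \<alpha> + real k - 1) :: complex)" by simp
    have "(of_real t :: complex) powr (of_real (Re \<alpha>) + of_nat k - 1) = of_real (t powr (Re \<alpha> + real k - 1))"
      unfolding e using True by (intro powr_of_real) auto
    moreover have "norm ((of_real t :: complex) powr (\<alpha> + of_nat k - 1)) = t powr (Re \<alpha> + real k - 1)"
      using True by (subst norm_powr_real_powr) auto
    ultimately show ?thesis unfolding f_def using True d0[of k] kappa by (simp add: norm_mult norm_power)
  qed (simp add: f_def)
  have sumT: "summable (\<lambda>k. norm (T \<alpha> k))" for \<alpha>
    unfolding T_def by (rule summable_kummer_c[OF nu1])
  have sn: "summable (\<lambda>k. LINT t|lborel. norm (f \<alpha> k t))"
  proof (rule summable_comparison_test[OF _ summable_mult[OF sumT[of "of_real (Re \<alpha>)"], of "norm (c (of_real (Re \<alpha>)))"]], intro exI allI impI)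
    fix k
    have "of_real (LINT t|lborel. norm (f \<alpha> k t)) = (LINT t|lborel. f (of_real (Re \<alpha>)) k t)"
      unfolding nf[symmetric] by simp
    also have "\<dots> = c (of_real (Re \<alpha>)) * T (of_real (Re \<alpha>)) k" using re by (intro eq) simp
    finally have "norm (of_real (LINT t|lborel. norm (f \<alpha> k t)) :: complex) = norm (c (of_real (Re \<alpha>)) * T (of_real (Re \<alpha>)) k)" by (simp only:)
    then show "norm (LINT t|lborel. norm (f \<alpha> k t)) \<le> norm (c (of_real (Re \<alpha>))) * norm (T (of_real (Re \<alpha>)) k)"
      by (simp only: norm_of_real real_norm_def norm_mult order.refl)
  qed
  have ser: "(\<lambda>k. f \<alpha> k t) sums (indicator {0<..} t *\<^sub>R (of_real t powr (\<alpha> - 1) * of_real (exp (- p * t) * bessel_clifford \<nu> (\<kappa> * t))))" 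
    and sern: "summable (\<lambda>k. norm (f \<alpha> k t))" for t
  proof -
    have s: "summable (\<lambda>k. d k * (\<kappa> * t) ^ k)" unfolding d_def by (rule summable_bessel_clifford[OF nu])
    have fk: "f \<alpha> k t = (indicator {0<..} t *\<^sub>R (of_real t powr (\<alpha> - 1) * of_real (exp (- p * t)))) * of_real (d k * (\<kappa> * t) ^ k)" for k
    proof (cases "0 < t")
      case True
      have "(of_real t :: complex) powr (\<alpha> + of_nat k - 1) = of_real t powr (\<alpha> - 1) * of_real t ^ k"
        using complex_powr_add_nat[OF True, of "\<alpha> - 1" k] by (simp add: algebra_simps)
      then show ?thesis unfolding f_def by (simp add: power_mult_distrib)
    qed (simp add: f_def)
    have "(\<lambda>k. d k * (\<kappa> * t) ^ k) sums bessel_clifford \<nu> (\<kappa> * t)"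
      using summable_sums[OF s] by (simp add: bessel_clifford_def d_def)
    then have "(\<lambda>k. f \<alpha> k t) sums ((indicator {0<..} t *\<^sub>R (of_real t powr (\<alpha> - 1) * of_real (exp (- p * t)))) * of_real (bessel_clifford \<nu> (\<kappa> * t)))"
      unfolding fk by (intro sums_mult sums_of_real)
    then show "(\<lambda>k. f \<alpha> k t) sums (indicator {0<..} t *\<^sub>R (of_real t powr (\<alpha> - 1) * of_real (exp (- p * t) * bessel_clifford \<nu> (\<kappa> * t))))"
      by (simp add: mult.assoc)
    show "summable (\<lambda>k. norm (f \<alpha> k t))"
    proof (cases "0 < t")
      case True
      then have nn: "0 \<le> d k * (\<kappa> * t) ^ k" for k using d0[of k] kappa by simp
      have "summable (\<lambda>k. norm (indicator {0<..} t *\<^sub>R (of_real t powr (\<alpha> - 1) * of_real (exp (- p * t)) :: complex)) * (d k * (\<kappa> * t) ^ k))"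
        by (intro summable_mult s)
      then show ?thesis unfolding fk norm_mult norm_of_real abs_of_nonneg[OF nn] .
    qed (simp add: fk)
  qed
  have AEs: "AE t in lborel. summable (\<lambda>k. norm (f \<alpha> k t))" using sern by simp
  have e1: "(\<lambda>t. \<Sum>k. f \<alpha> k t) = (\<lambda>t. indicator {0<..} t *\<^sub>R (of_real t powr (\<alpha> - 1) * of_real (exp (- p * t) * bessel_clifford \<nu> (\<kappa> * t))))"
    using sums_unique[OF ser] by (simp add: fun_eq_iff)
  have e2: "(\<Sum>k. LINT t|lborel. f \<alpha> k t) = c \<alpha> * kummer_c \<alpha> (\<nu> + 1) (of_real (\<kappa> / p))"
    unfolding eq[OF re] kummer_c_def T_def[symmetric] by (rule suminf_mult[OF summable_norm_cancel[OF sumT]])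
  show ?thesis
    using integrable_suminf[OF int[OF re] AEs sn] integral_suminf[OF int[OF re] AEs sn]
    unfolding e1 e2 c_def has_bochner_integral_iff by blast
qed

text \<open>A sum serves in place of a difference: once a measure plus a second one is seen to be a
  multiple of Lebesgue measure, the first is bounded by that multiple.\<close>

lemma sum_measure_exists:
  assumes "sets N = sets M"
  shows "\<exists>S. sets S = sets M \<and> (\<forall>A\<in>sets M. emeasure S A = emeasure M A + emeasure N A)"
proof (intro exI conjI ballI)
  let ?S = "measure_of (space M) (sets M) (\<lambda>A. emeasure M A + emeasure N A)"
  show "sets ?S = sets M" by simp
  fix A assume "A \<in> sets M"
  show "emeasure ?S A = emeasure M A + emeasure N A"
  proof (rule emeasure_measure_of_sigma)
    show "countably_additive (sets M) (\<lambda>A. emeasure M A + emeasure N A)"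
    proof (rule countably_additiveI)
      fix B :: "nat \<Rightarrow> 'a set" assume B: "range B \<subseteq> sets M" "disjoint_family B"
      have "(\<Sum>i. emeasure M (B i) + emeasure N (B i)) = (\<Sum>i. emeasure M (B i)) + (\<Sum>i. emeasure N (B i))"
        by (rule suminf_add[symmetric]) auto
      also have "\<dots> = emeasure M (\<Union>i. B i) + emeasure N (\<Union>i. B i)"
        using B assms by (simp add: suminf_emeasure)
      finally show "(\<Sum>i. emeasure M (B i) + emeasure N (B i)) = emeasure M (\<Union>i. B i) + emeasure N (\<Union>i. B i)" .
    qed
  qed (use \<open>A \<in> sets M\<close> in \<open>auto simp: positive_def sets.sigma_algebra_axioms\<close>)
qed

text \<open>An integrable characteristic function bounds the measure of intervals linearly in their length,
  by the inversion formula; comparing with the Lebesgue-Stieltjes measure of \<open>B * x - cdf M x\<close>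
  turns this into absolute continuity.\<close>

lemma (in real_distribution) absolutely_continuous_of_integrable_char:
  assumes i: "integrable lborel (char M)"
  shows "absolutely_continuous lborel M"
proof -
  define B where "B = 1 / (2 * pi) * (LINT t|lborel. norm (char M t))"
  have B: "0 \<le> B" unfolding B_def by simp
  have cont: "measure M {u<..v} \<le> B * (v - u)" if uv: "u \<le> v" and u: "measure M {u} = 0" and v: "measure M {v} = 0" for u v
  proof -
    let ?I = "\<lambda>T::nat. 1 / (2 * pi) * (CLBINT t=-T..T. (iexp (-(t * u)) - iexp (-(t * v))) / (\<i> * t) * char M t)"
    have L: "?I \<longlonglongrightarrow> of_real (measure M {u<..v})" by (rule Levy_Inversion[OF uv u v])
    have "norm (?I T) \<le> B * (v - u)" for T
    proof -
      \<comment> \<open>This is |exp (- i t u) - exp (- i t v)| \<le> |t| (v - u); at t = 0 the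
        quotient is 0 by convention.\<close>
      have le: "norm ((iexp (-(t * u)) - iexp (-(t * v))) / (\<i> * t) * char M t) \<le> (v - u) * norm (char M t)" for t :: real
      proof (cases "t = 0")
        case False
        have "norm ((iexp (-(t * u)) - iexp (-(t * v))) / (\<i> * t)) \<le> v - u"
          using Levy_Inversion_aux2[of "-v" "-u" t] uv False by simp
        then show ?thesis by (simp only: norm_mult) (rule mult_right_mono, auto)
      qed (use uv in simp)
      define f where "f t = (iexp (-(t * u)) - iexp (-(t * v))) / (\<i> * t) * char M t" for t :: real
      have le: "norm (f t) \<le> (v - u) * norm (char M t)" for t unfolding f_def by (rule le)
      have S: "norm (LINT t:A|lborel. f t) \<le> (LINT t|lborel. (v - u) * norm (char M t))" if [measurable]: "A \<in> sets borel" for A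
        unfolding set_lebesgue_integral_def
      proof (rule Bochner_Integration.integral_norm_bound_integral)
        have [measurable]: "char M \<in> borel_measurable borel" using borel_measurable_integrable[OF i] by simp
        have [measurable]: "f \<in> borel_measurable borel" unfolding f_def by measurable
        show ib: "integrable lborel (\<lambda>t. (v - u) * norm (char M t))" by (intro integrable_mult_right integrable_norm i)
        show le': "norm (indicator A t *\<^sub>R f t) \<le> (v - u) * norm (char M t)" for t
          using le[of t] uv by (cases "t \<in> A") simp_all
        show "integrable lborel (\<lambda>t. indicator A t *\<^sub>R f t)"
        proof (rule Bochner_Integration.integrable_bound[OF ib _ AE_I2])
          show "norm (indicator A t *\<^sub>R f t) \<le> norm ((v - u) * norm (char M t))" for t
            unfolding real_norm_def by (rule order_trans[OF le' abs_ge_self])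
        qed measurable
      qed
      have "norm (CLBINT t=-T..T. f t) \<le> (LINT t|lborel. (v - u) * norm (char M t))"
        using S[of "einterval (- T) T"] by (simp add: interval_lebesgue_integral_def)
      then show ?thesis unfolding B_def f_def by (simp add: norm_mult norm_divide divide_right_mono mult.commute)
    qed
    then have "norm (of_real (measure M {u<..v}) :: complex) \<le> B * (v - u)"
      by (intro LIMSEQ_le_const2[OF tendsto_norm[OF L]]) auto
    then show ?thesis by simp
  qed
  \<comment> \<open>The inversion formula requires end points without mass. As there are only
    countably many atoms, such points lie in every interval.\<close>
  have null_point: "\<exists>w. r < w \<and> w < s \<and> measure M {w} = 0" if "r < s" for r s
  proof (rule ccontr)
    assume "\<not> ?thesis"
    then have "{r<..<s} \<subseteq> {w. measure M {w} > 0}" by (auto simp: zero_less_measure_iff)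
    then have "countable {r<..<s}" using countable_atoms countable_subset by blast
    then show False using uncountable_open_interval[of r s] that by simp
  qed
  have lip: "measure M {u<..v} \<le> B * (v - u)" if uv: "u \<le> v" for u v
  proof (rule field_le_epsilon)
    fix e :: real assume e: "0 < e"
    \<comment> \<open>Each end point moves by less than h, which costs at most 2 B h \<le>
      e.\<close>
    define h where "h = e / (2 * B + 1)"
    have h: "0 < h" "2 * B * h \<le> e" using e B by (auto simp: h_def field_simps)
    obtain u' where u': "u - h < u'" "u' < u" "measure M {u'} = 0" using null_point[of "u - h" u] h by auto
    obtain v' where v': "v < v'" "v' < v + h" "measure M {v'} = 0" using null_point[of v "v + h"] h by auto
    have "measure M {u<..v} \<le> measure M {u'<..v'}" using u' v' by (intro finite_measure_mono) auto
    also have "\<dots> \<le> B * (v' - u')" using u' v' uv by (intro cont) auto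
    also have "\<dots> \<le> B * (v - u + 2 * h)" using u' v' B by (intro mult_left_mono) auto
    also have "\<dots> \<le> B * (v - u) + e" using h by (simp add: algebra_simps)
    finally show "measure M {u<..v} \<le> B * (v - u) + e" .
  qed
  define F where "F y = B * y - cdf M y" for y
  have cd: "cdf M v - cdf M u = measure M {u<..v}" if "u \<le> v" for u v
    using that cdf_diff_eq[of u v] by (cases "u = v") auto
  have Fm: "F u \<le> F v" if "u \<le> v" for u v
    using lip[OF that] cd[OF that] by (simp add: F_def algebra_simps)
  have Fc: "continuous (at_right y) F" for y
    unfolding F_def by (intro continuous_diff continuous_mult continuous_const continuous_ident cdf_is_right_cont)
  define N where "N = interval_measure F"
  have N: "emeasure N {u<..v} = ennreal (F v - F u)" if "u \<le> v" for u v
    unfolding N_def using that by (intro emeasure_interval_measure_Ioc Fm Fc)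
  have sN: "sets N = sets M" by (simp add: N_def)
  obtain S where S: "sets S = sets M" "\<And>A. A \<in> sets M \<Longrightarrow> emeasure S A = emeasure M A + emeasure N A"
    using sum_measure_exists[OF sN] by blast
  have "S = density lborel (\<lambda>_. ennreal B)"
  proof (rule measure_eqI_generator_eq[where \<Omega> = UNIV and E = "range (\<lambda>(u, v). {u<..v::real})" and A = "\<lambda>i. {- real i<..real i}"])
    fix X assume "X \<in> range (\<lambda>(u, v). {u<..v::real})"
    then obtain u v where X: "X = {u<..v}" by auto
    show "emeasure S X = emeasure (density lborel (\<lambda>_. ennreal B)) X"
    proof (cases "u \<le> v")
      case True
      have "emeasure S X = ennreal (measure M {u<..v}) + ennreal (F v - F u)"
        unfolding X using N[OF True] by (simp add: S emeasure_eq_measure)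
      also have "\<dots> = ennreal (B * (v - u))"
        using Fm[OF True] cd[OF True] by (subst ennreal_plus[symmetric]) (auto simp: F_def algebra_simps)
      also have "\<dots> = emeasure (density lborel (\<lambda>_. ennreal B)) X"
        unfolding X using True B by (simp add: emeasure_density nn_integral_cmult_indicator ennreal_mult')
      finally show ?thesis .
    qed (simp add: X)
  next
    show "emeasure S {- real i<..real i} \<noteq> \<infinity>" for i
      using N[of "- real i" "real i"] by (simp add: S emeasure_eq_measure)
    show "(\<Union>i. {- real i<..real i}) = UNIV" by (rule UN_Ioc_eq_UNIV)
  qed (auto simp: S borel_sigma_sets_Ioc Int_stable_def)
  then have le: "emeasure M A \<le> emeasure (density lborel (\<lambda>_. ennreal B)) A" if "A \<in> sets borel" for A
    using S(2)[of A] that by simp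
  show ?thesis
    unfolding absolutely_continuous_def
  proof
    fix A :: "real set" assume A: "A \<in> null_sets lborel"
    then have "emeasure (density lborel (\<lambda>_. ennreal B)) A = 0"
      by (simp add: emeasure_density nn_integral_cmult_indicator null_sets_def)
    then show "A \<in> null_sets M" using le[of A] A by (simp add: null_sets_def)
  qed
qed

text \<open>In the variable v = exp (- t) the assumption annihilates all monomials, hence by
  Weierstrass all continuous functions on [0, 1], and in the limit the indicators of
  half-lines.\<close>

lemma laplace_unique:
  fixes h :: "real \<Rightarrow> real"
  assumes i: "integrable lborel h" and supp: "\<And>t. t < 0 \<Longrightarrow> h t = 0"
    and zero: "\<And>n::nat. (LINT t|lborel. exp (- (real n * t)) * h t) = 0"
  shows "AE t in lborel. h t = 0"
proof -
  have [measurable]: "h \<in> borel_measurable borel" using borel_measurable_integrable[OF i] by simp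
  have ig: "integrable lborel (\<lambda>t. g (exp (- t)) * h t)" if g: "continuous_on UNIV g" and bd: "\<And>v. v \<in> {0..1} \<Longrightarrow> \<bar>g v\<bar> \<le> K" for g :: "real \<Rightarrow> real" and K
  proof (rule Bochner_Integration.integrable_bound[OF integrable_mult_right[OF integrable_norm[OF i], of K]])
    have [measurable]: "g \<in> borel_measurable borel" by (rule borel_measurable_continuous_onI[OF g])
    show "(\<lambda>t. g (exp (- t)) * h t) \<in> borel_measurable lborel" by measurable
    have K: "0 \<le> K" using bd[of 0] by simp
    show "AE t in lborel. norm (g (exp (- t)) * h t) \<le> norm (K * norm (h t))"
    proof (rule AE_I2)
      fix t :: real
      show "norm (g (exp (- t)) * h t) \<le> norm (K * norm (h t))"
      proof (cases "t < 0")
        case False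
        then have "\<bar>g (exp (- t))\<bar> \<le> K" by (intro bd) auto
        then show ?thesis using K by (simp add: abs_mult mult_right_mono)
      qed (simp add: supp)
    qed
  qed
  have ip: "integrable lborel (\<lambda>t. exp (- (real n * t)) * h t)" for n
  proof -
    have "exp (- (real n * t)) = exp (- t) ^ n" for t :: real by (simp add: exp_of_nat_mult[symmetric])
    moreover have "integrable lborel (\<lambda>t. (\<lambda>v. v ^ n) (exp (- t)) * h t)"
      by (rule ig[where K = 1]) (auto intro!: continuous_intros simp: power_le_one)
    ultimately show ?thesis by simp
  qed
  have cont: "(LINT t|lborel. g (exp (- t)) * h t) = 0" if g: "continuous_on UNIV g" for g :: "real \<Rightarrow> real"
  proof -
    have "compact (g ` {0..1})" by (intro compact_continuous_image continuous_on_subset[OF g]) auto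
    then obtain K where "\<forall>v\<in>g ` {0..1}. norm v \<le> K" using compact_imp_bounded bounded_iff by blast
    then have K: "\<And>v. v \<in> {0..1} \<Longrightarrow> \<bar>g v\<bar> \<le> K" by auto
    define H where "H = (LINT t|lborel. norm (h t))"
    have H: "0 \<le> H" by (simp add: H_def)
    have "\<bar>LINT t|lborel. g (exp (- t)) * h t\<bar> \<le> 0"
    proof (rule field_le_epsilon)
      fix e :: real assume e: "0 < e"
      define d where "d = e / (H + 1)"
      have d: "0 < d" "d * H \<le> e" using e H by (auto simp: d_def field_simps)
      obtain q where q: "real_polynomial_function q" "\<And>v. v \<in> {0..1} \<Longrightarrow> \<bar>g v - q v\<bar> < d"
        using Stone_Weierstrass_real_polynomial_function[of "{0..1}" g d] d continuous_on_subset[OF g] by auto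
      obtain c n where qc: "q = (\<lambda>v. \<Sum>k\<le>n. c k * v ^ k)" using q(1) by (auto simp: real_polynomial_function_iff_sum)
      have qe: "q (exp (- t)) * h t = (\<Sum>k\<le>n. c k * (exp (- (real k * t)) * h t))" for t
      proof -
        have "exp (- (real k * t)) = exp (- t) ^ k" for k by (simp add: exp_of_nat_mult[symmetric])
        then show ?thesis unfolding qc by (simp add: sum_distrib_right mult.assoc)
      qed
      have iq: "integrable lborel (\<lambda>t. q (exp (- t)) * h t)" unfolding qe by (intro Bochner_Integration.integrable_sum integrable_mult_right ip)
      have zq: "(LINT t|lborel. q (exp (- t)) * h t) = 0"
        unfolding qe by (subst Bochner_Integration.integral_sum) (auto intro!: integrable_mult_right ip simp: zero)
      have "(LINT t|lborel. g (exp (- t)) * h t) = (LINT t|lborel. g (exp (- t)) * h t - q (exp (- t)) * h t)"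
        using ig[OF g K] iq zq by simp
      also have "\<bar>\<dots>\<bar> \<le> (LINT t|lborel. d * norm (h t))"
        unfolding real_norm_def[symmetric]
      proof (rule Bochner_Integration.integral_norm_bound_integral)
        show "integrable lborel (\<lambda>t. g (exp (- t)) * h t - q (exp (- t)) * h t)" using ig[OF g K] iq by simp
        show "integrable lborel (\<lambda>t. d * norm (h t))" using i by simp
        show "norm (g (exp (- t)) * h t - q (exp (- t)) * h t) \<le> d * norm (h t)" for t
        proof (cases "t < 0")
          case False
          then have "\<bar>g (exp (- t)) - q (exp (- t))\<bar> \<le> d" using q(2)[of "exp (- t)"] by simp
          then show ?thesis unfolding left_diff_distrib[symmetric] by (simp add: abs_mult mult_right_mono)
        qed (simp add: supp)
      qed
      also have "\<dots> = d * H" unfolding H_def by simp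
      finally show "\<bar>LINT t|lborel. g (exp (- t)) * h t\<bar> \<le> 0 + e" using d by simp
    qed
    then show ?thesis by simp
  qed
  have tail: "(LINT t|lborel. indicator {s<..} t * h t) = 0" for s
  proof (cases "s < 0")
    case True
    have "(\<lambda>t. indicator {s<..} t * h t) = (\<lambda>t. exp (- (real 0 * t)) * h t)"
      using True supp by (auto split: split_indicator)
    then show ?thesis using zero[of 0] by (simp only:)
  next
    case False
    define g where "g k v = min 1 (max 0 (real k * (exp (- s) - v)))" for k :: nat and v :: real
    have g: "continuous_on UNIV (g k)" for k unfolding g_def by (intro continuous_intros)
    have g1: "0 \<le> g k v" "g k v \<le> 1" for k v by (auto simp: g_def)
    have "(\<lambda>k. LINT t|lborel. g k (exp (- t)) * h t) \<longlonglongrightarrow> (LINT t|lborel. indicator {s<..} t * h t)"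
    proof (rule integral_dominated_convergence[where w = "\<lambda>t. norm (h t)"])
      have [measurable]: "g k \<in> borel_measurable borel" for k by (rule borel_measurable_continuous_onI[OF g])
      show "(\<lambda>t. g k (exp (- t)) * h t) \<in> borel_measurable lborel" for k by measurable
      show "AE t in lborel. norm (g k (exp (- t)) * h t) \<le> norm (h t)" for k
        using g1 by (intro AE_I2) (simp add: abs_mult mult_left_le_one_le)
      show "AE t in lborel. (\<lambda>k. g k (exp (- t)) * h t) \<longlonglongrightarrow> indicator {s<..} t * h t"
      proof (intro AE_I2 tendsto_mult tendsto_const tendsto_eventually)
        fix t :: real
        show "\<forall>\<^sub>F k in sequentially. g k (exp (- t)) = indicator {s<..} t"
        proof (cases "s < t")
          case True
          then have pos: "0 < exp (- s) - exp (- t)" by simp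
          obtain k0 :: nat where k0: "1 / (exp (- s) - exp (- t)) \<le> real k0" using real_arch_simple by blast
          show ?thesis
            unfolding eventually_sequentially
          proof (intro exI[of _ k0] allI impI)
            fix k assume "k0 \<le> k"
            then have "1 / (exp (- s) - exp (- t)) \<le> real k" using k0 by linarith
            then have "1 \<le> real k * (exp (- s) - exp (- t))" using pos by (simp add: pos_divide_le_eq)
            then show "g k (exp (- t)) = indicator {s<..} t" using True by (simp add: g_def)
          qed
        next
          case False
          then have "real k * (exp (- s) - exp (- t)) \<le> 0" for k by (intro mult_nonneg_nonpos) auto
          then have "g k (exp (- t)) = 0" for k unfolding g_def by (simp add: max_absorb1)
          then show ?thesis using False by simp
        qed
      qed
    qed (use i in auto)
    moreover have "(LINT t|lborel. g k (exp (- t)) * h t) = 0" for k by (rule cont[OF g])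
    ultimately have "(\<lambda>k::nat. 0) \<longlonglongrightarrow> (LINT t|lborel. indicator {s<..} t * h t)" by (simp only:)
    then show ?thesis by (rule LIMSEQ_unique) (rule tendsto_const)
  qed
  let ?P = "density lborel (\<lambda>t. ennreal (h t))" and ?N = "density lborel (\<lambda>t. ennreal (- h t))"
  have "?P = ?N"
  proof (rule measure_eqI_lessThan)
    fix s :: real
    let ?k = "\<lambda>t. indicator {s<..} t * h t"
    have ik: "integrable lborel ?k"
      using integrable_mult_indicator[OF _ i, of "{s<..}"] by simp
    have P: "emeasure ?P {s<..} = (\<integral>\<^sup>+t. ennreal (?k t) \<partial>lborel)"
      by (subst emeasure_density) (auto intro!: nn_integral_cong split: split_indicator)
    have N: "emeasure ?N {s<..} = (\<integral>\<^sup>+t. ennreal (- ?k t) \<partial>lborel)"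
      by (subst emeasure_density) (auto intro!: nn_integral_cong split: split_indicator)
    have fin: "(\<integral>\<^sup>+t. ennreal (?k t) \<partial>lborel) < \<infinity>" "(\<integral>\<^sup>+t. ennreal (- ?k t) \<partial>lborel) < \<infinity>"
      using ik by (auto simp: real_integrable_def less_top)
    show "emeasure ?P {s<..} < \<infinity>" unfolding P using fin by simp
    have "enn2real (\<integral>\<^sup>+t. ennreal (?k t) \<partial>lborel) - enn2real (\<integral>\<^sup>+t. ennreal (- ?k t) \<partial>lborel) = 0"
      using tail[of s] real_lebesgue_integral_def[OF ik] by simp
    then show "emeasure ?P {s<..} = emeasure ?N {s<..}"
      unfolding P N using fin
      by (subst (1 2) ennreal_enn2real[symmetric]) (simp_all only: eq_iff_diff_eq_0[symmetric] infinity_ennreal_def)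
  qed auto
  then have "AE t in lborel. ennreal (h t) = ennreal (- h t)"
    by (intro sigma_finite_measure.density_unique[OF sigma_finite_lborel]) auto
  then show ?thesis
  proof eventually_elim
    case (elim t)
    then show ?case by (cases "0 \<le> h t") (auto simp: ennreal_neg ennreal_eq_0_iff)
  qed
qed

section \<open>The law of the last passage time\<close>

lemma measurable_powr_indicator:
  "(\<lambda>t. indicator {0<..} t *\<^sub>R (of_real t powr z :: complex)) \<in> borel_measurable borel"
proof -
  have g: "(\<lambda>t. indicator {0<..} t *\<^sub>R (of_real t powr z :: complex)) = (\<lambda>t. indicator {0<..} t *\<^sub>R exp (z * of_real (ln t)))"
  proof
    fix t :: real
    show "indicator {0<..} t *\<^sub>R (of_real t powr z :: complex) = indicator {0<..} t *\<^sub>R exp (z * of_real (ln t))"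
      by (cases "0 < t") (simp_all add: powr_def Ln_of_real)
  qed
  have "continuous_on {0<..} (\<lambda>t. exp (z * of_real (ln t)) :: complex)"
    by (intro continuous_intros) auto
  then show ?thesis unfolding g by (intro borel_measurable_continuous_on_indicator) auto
qed

context bessel_passage
begin

definition weight :: "real \<Rightarrow> real" where
  "weight t = exp (x\<^sup>2 / (2 * t)) * \<J> (c\<^sup>2 * x\<^sup>2 / 4) / \<J> (x\<^sup>2 * (a + b / t) / 4)"

definition log_time :: "real \<Rightarrow> real" where
  "log_time t = ln (1 + b / (a * t))"

definition scale :: "real \<Rightarrow> real" where
  "scale u = a / b * exp u"

definition passed :: "'w set" where "passed = {\<omega> \<in> space M. 0 < G \<omega>}"

definition log_law :: "real measure" where
  "log_law = distr (density M (\<lambda>\<omega>. ennreal (weight (G \<omega>)) * indicator passed \<omega>)) borel (\<lambda>\<omega>. log_time (G \<omega>))"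

lemma measurable_weight [measurable]: "weight \<in> borel_measurable borel"
  unfolding weight_def[abs_def] by measurable

lemma measurable_log_time [measurable]: "log_time \<in> borel_measurable borel"
  unfolding log_time_def[abs_def] by measurable

lemma measurable_scale [measurable]: "scale \<in> borel_measurable borel"
  unfolding scale_def[abs_def] by measurable

lemma sets_passed [measurable]: "passed \<in> sets M"
  unfolding passed_def by measurable

lemma sets_log_law [simp, measurable_cong]: "sets log_law = sets borel"
  and space_log_law [simp]: "space log_law = UNIV"
  by (simp_all add: log_law_def)

lemma weight_pos: "0 < t \<Longrightarrow> 0 < weight t"
  unfolding weight_def using a_pos b by (intro divide_pos_pos mult_pos_pos J_pos) simp_all

lemma scale_pos: "0 < scale u"
  using a_pos b by (simp add: scale_def)

lemma scale_log_time: "0 < t \<Longrightarrow> scale (log_time t) = a / b + 1 / t"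
proof -
  assume t: "0 < t"
  have "0 < 1 + b / (a * t)" using a_pos b t by (simp add: add_pos_pos)
  then show ?thesis using a_pos b t by (simp add: scale_def log_time_def field_simps)
qed

lemma nn_integral_log_law:
  assumes [measurable]: "F \<in> borel_measurable borel"
  shows "(\<integral>\<^sup>+u. F u \<partial>log_law) = (\<integral>\<^sup>+\<omega>. ennreal (weight (G \<omega>)) * F (log_time (G \<omega>)) * indicator passed \<omega> \<partial>M)"
  unfolding log_law_def by (simp add: nn_integral_distr nn_integral_density mult_ac)

lemma nn_integral_log_law_kernel:
  assumes eta: "0 < \<eta>"
  shows "(\<integral>\<^sup>+u. ennreal (exp (- scale u * \<eta>) * \<J> (b / 2 * scale u * \<eta>)) \<partial>log_law)
    = ennreal (exp (- (a / b) * \<eta>) * \<J> (c\<^sup>2 / 2 * \<eta>))"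
proof -
  define \<xi> where "\<xi> = sqrt (2 * \<eta>)"
  have xi: "0 < \<xi>" "\<xi>\<^sup>2 = 2 * \<eta>" using eta by (simp_all add: \<xi>_def)
  define E where "E = exp (- (a / b) * \<eta>) * \<J> (c\<^sup>2 / 2 * \<eta>)"
  have E: "0 \<le> E" unfolding E_def using eta by (intro mult_nonneg_nonneg less_imp_le[OF J_pos]) simp_all
  have "(\<integral>\<^sup>+u. ennreal (exp (- scale u * \<eta>) * \<J> (b / 2 * scale u * \<eta>)) \<partial>log_law)
    = (\<integral>\<^sup>+\<omega>. ennreal (weight (G \<omega>)) * ennreal (exp (- scale (log_time (G \<omega>)) * \<eta>) * \<J> (b / 2 * scale (log_time (G \<omega>)) * \<eta>)) * indicator passed \<omega> \<partial>M)"
    by (rule nn_integral_log_law) measurable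
  also have "\<dots> = (\<integral>\<^sup>+\<omega>. ennreal E * (ennreal (ratio \<xi> (G \<omega>) (curve (G \<omega>))) * indicator passed \<omega>) \<partial>M)"
  proof (intro nn_integral_cong)
    fix \<omega>
    have "weight t * (exp (- scale (log_time t) * \<eta>) * \<J> (b / 2 * scale (log_time t) * \<eta>)) = E * ratio \<xi> t (curve t)" if t: "0 < t" for t
    proof -
      have 1: "b / 2 * scale (log_time t) * \<eta> = \<xi>\<^sup>2 * (a + b / t) / 4"
        unfolding scale_log_time[OF t] xi(2) using b by (simp add: field_simps)
      have 2: "exp (x\<^sup>2 / (2 * t)) * exp (- scale (log_time t) * \<eta>) = exp (- (a / b) * \<eta>) * exp ((x\<^sup>2 - \<xi>\<^sup>2) / (2 * t))"
        unfolding scale_log_time[OF t] xi(2) exp_add[symmetric] using t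
        by (intro arg_cong[where f = exp]) (simp add: field_simps)
      have 3: "c\<^sup>2 * \<xi>\<^sup>2 / 4 = c\<^sup>2 / 2 * \<eta>" unfolding xi(2) by simp
      have J: "\<J> (c\<^sup>2 / 2 * \<eta>) \<noteq> 0" using J_pos[of "c\<^sup>2 / 2 * \<eta>"] eta by simp
      have "weight t * (exp (- scale (log_time t) * \<eta>) * \<J> (b / 2 * scale (log_time t) * \<eta>))
        = (exp (x\<^sup>2 / (2 * t)) * exp (- scale (log_time t) * \<eta>)) * \<J> (\<xi>\<^sup>2 * (a + b / t) / 4) * \<J> (c\<^sup>2 * x\<^sup>2 / 4) / \<J> (x\<^sup>2 * (a + b / t) / 4)"
        unfolding weight_def 1 by simp
      also have "\<dots> = E * ratio \<xi> t (curve t)"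
        unfolding 2 ratio_curve[OF t] E_def 3 using J by simp
      finally show ?thesis .
    qed
    from this[of "G \<omega>"] show "ennreal (weight (G \<omega>)) * ennreal (exp (- scale (log_time (G \<omega>)) * \<eta>) * \<J> (b / 2 * scale (log_time (G \<omega>)) * \<eta>)) * indicator passed \<omega>
      = ennreal E * (ennreal (ratio \<xi> (G \<omega>) (curve (G \<omega>))) * indicator passed \<omega>)"
      using weight_pos[of "G \<omega>"] E by (cases "\<omega> \<in> passed") (simp_all add: passed_def ennreal_mult'[symmetric])
  qed
  also have "\<dots> = ennreal E * (\<integral>\<^sup>+\<omega>. ennreal (ratio \<xi> (G \<omega>) (curve (G \<omega>))) * indicator passed \<omega> \<partial>M)"
    by (rule nn_integral_cmult) measurable
  also have "\<dots> = ennreal E"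
    using nn_integral_ratio_last_passage[OF xi(1)] by (simp add: passed_def)
  finally show ?thesis unfolding E_def .
qed

lemma log_law_kernel_tendsto:
  "(\<lambda>n. exp (- r * (1 / real (Suc n))) * \<J> (s * (1 / real (Suc n)))) \<longlonglongrightarrow> \<J> 0"
proof -
  have z: "(\<lambda>n. q * (1 / real (Suc n))) \<longlonglongrightarrow> 0" for q :: real
    using tendsto_mult[OF tendsto_const LIMSEQ_Suc[OF lim_1_over_n], of q] by simp
  have "(\<lambda>n. exp (- r * (1 / real (Suc n))) * \<J> (s * (1 / real (Suc n)))) \<longlonglongrightarrow> exp 0 * \<J> 0"
    by (intro tendsto_mult tendsto_exp z tendsto_bessel_clifford[OF nu])
  then show ?thesis by simp
qed

lemma emeasure_log_law: "emeasure log_law UNIV = 1"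
proof -
  define K where "K n u = ennreal (exp (- scale u * (1 / real (Suc n))) * \<J> (b / 2 * scale u * (1 / real (Suc n))))" for n u
  have [measurable]: "K n \<in> borel_measurable log_law" for n unfolding K_def by measurable
  have J0: "0 < \<J> 0" by (rule J_pos) simp
  have lim: "(\<lambda>n. K n u) \<longlonglongrightarrow> ennreal (\<J> 0)" for u
    unfolding K_def by (intro tendsto_ennrealI log_law_kernel_tendsto)
  have int: "(\<lambda>n. integral\<^sup>N log_law (K n)) \<longlonglongrightarrow> ennreal (\<J> 0)"
  proof -
    have "integral\<^sup>N log_law (K n) = ennreal (exp (- (a / b) * (1 / real (Suc n))) * \<J> (c\<^sup>2 / 2 * (1 / real (Suc n))))" for n
      unfolding K_def by (rule nn_integral_log_law_kernel) simp
    then show ?thesis by (simp only:) (intro tendsto_ennrealI log_law_kernel_tendsto)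
  qed
  have "(\<integral>\<^sup>+u. liminf (\<lambda>n. K n u) \<partial>log_law) \<le> liminf (\<lambda>n. integral\<^sup>N log_law (K n))"
    by (rule nn_integral_liminf) measurable
  moreover have "liminf (\<lambda>n. K n u) = ennreal (\<J> 0)" for u
    by (rule lim_imp_Liminf[OF _ lim]) simp
  moreover have "liminf (\<lambda>n. integral\<^sup>N log_law (K n)) = ennreal (\<J> 0)"
    by (rule lim_imp_Liminf[OF _ int]) simp
  ultimately have "ennreal (\<J> 0) * emeasure log_law UNIV \<le> ennreal (\<J> 0)" by simp
  then have fin: "emeasure log_law UNIV < \<infinity>"
    using J0 by (cases "emeasure log_law UNIV") (auto simp: ennreal_mult_top less_top[symmetric] top_unique)
  obtain B where B: "\<And>v. 0 \<le> v \<Longrightarrow> \<J> (b / 2 * v) \<le> B * exp v"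
    using bessel_clifford_exp_bound[OF nu, of "b / 2"] b by auto
  have "(\<lambda>n. integral\<^sup>N log_law (K n)) \<longlonglongrightarrow> (\<integral>\<^sup>+u. ennreal (\<J> 0) \<partial>log_law)"
  proof (rule nn_integral_dominated_convergence[where w = "\<lambda>_. ennreal B"])
    show "AE u in log_law. K n u \<le> ennreal B" for n
    proof (intro AE_I2)
      fix u
      let ?v = "scale u * (1 / real (Suc n))"
      have "0 \<le> ?v" using scale_pos[of u] by simp
      then have "\<J> (b / 2 * ?v) \<le> B * exp ?v" by (rule B)
      then have "exp (- ?v) * \<J> (b / 2 * ?v) \<le> exp (- ?v) * (B * exp ?v)" by (intro mult_left_mono) simp_all
      also have "exp (- ?v) * (B * exp ?v) = B" by (simp add: exp_minus)
      finally show "K n u \<le> ennreal B"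
        unfolding K_def mult_minus_left mult.assoc by (intro ennreal_leI)
    qed
    show "(\<integral>\<^sup>+u. ennreal B \<partial>log_law) < \<infinity>" using fin by (simp add: ennreal_mult_less_top)
  qed (use lim in auto)
  with int have "ennreal (\<J> 0) = (\<integral>\<^sup>+u. ennreal (\<J> 0) \<partial>log_law)" by (rule LIMSEQ_unique)
  then have eq: "ennreal (\<J> 0) = ennreal (\<J> 0) * emeasure log_law UNIV" by simp
  obtain m where m: "emeasure log_law UNIV = ennreal m" "0 \<le> m"
    using fin by (cases "emeasure log_law UNIV") auto
  have "ennreal (\<J> 0) = ennreal (\<J> 0 * m)" using eq J0 m by (simp add: ennreal_mult')
  then have "\<J> 0 = \<J> 0 * m" using J0 m by (subst (asm) ennreal_inj) auto
  then have "m = 1" using J0 by simp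
  then show ?thesis using m by simp
qed

lemma real_distribution_log_law: "real_distribution log_law"
proof -
  interpret P: prob_space log_law by (rule prob_spaceI) (simp add: emeasure_log_law)
  show ?thesis by unfold_locales simp_all
qed

sublocale L: real_distribution log_law
  by (rule real_distribution_log_law)

lemma AE_passed: "AE \<omega> in M. 0 < G \<omega>"
proof -
  have "emeasure M passed = 1"
  proof (cases "x = 0")
    case True
    have "weight t = 1" for t unfolding weight_def using True J_pos[of 0] by simp
    then have "(\<integral>\<^sup>+u. 1 \<partial>log_law) = (\<integral>\<^sup>+\<omega>. indicator passed \<omega> \<partial>M)"
      by (subst nn_integral_log_law) simp_all
    then show ?thesis by (simp add: emeasure_log_law)
  next
    case False
    then have x0: "0 < x" using x by simp
    have "ratio x t y = 1" for t y
      using J_pos[of "x\<^sup>2 * y\<^sup>2 / (4 * t\<^sup>2)"] J_pos[of "c\<^sup>2 * x\<^sup>2 / 4"] by (simp add: ratio_def)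
    then show ?thesis using nn_integral_ratio_last_passage[OF x0] by (simp add: passed_def[symmetric])
  qed
  then have "AE \<omega> in M. \<omega> \<in> passed" by (intro prob_eq_1[THEN iffD1]) (simp_all add: emeasure_eq_measure)
  then show ?thesis by eventually_elim (simp add: passed_def)
qed

lemma has_bochner_integral_log_law_kernel:
  assumes "0 < \<eta>"
  shows "has_bochner_integral log_law (\<lambda>u. exp (- scale u * \<eta>) * \<J> (b / 2 * scale u * \<eta>)) (exp (- (a / b) * \<eta>) * \<J> (c\<^sup>2 / 2 * \<eta>))"
proof (rule has_bochner_integral_nn_integral)
  show "AE u in log_law. 0 \<le> exp (- scale u * \<eta>) * \<J> (b / 2 * scale u * \<eta>)"
    using assms b scale_pos by (intro AE_I2 mult_nonneg_nonneg less_imp_le[OF J_pos]) (auto simp: less_imp_le)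
  show "0 \<le> exp (- (a / b) * \<eta>) * \<J> (c\<^sup>2 / 2 * \<eta>)"
    using assms by (intro mult_nonneg_nonneg less_imp_le[OF J_pos]) simp_all
qed (use nn_integral_log_law_kernel[OF assms] in simp_all)

lemma log_law_laplace:
  assumes re: "0 < Re \<alpha>"
  shows "(LINT u|log_law. exp (- \<alpha> * of_real u)) = kummer_c \<alpha> (\<nu> + 1) (of_real (c\<^sup>2 * b / (2 * a))) / kummer_c \<alpha> (\<nu> + 1) (of_real (b / 2))"
proof -
  interpret P: pair_sigma_finite lborel log_law ..
  have nu1: "0 < \<nu> + 1" using nu by simp
  define D where "D = Gamma \<alpha> / of_real (Gamma (\<nu> + 1))"
  have "\<alpha> \<notin> \<int>\<^sub>\<le>\<^sub>0" using re by (auto elim!: nonpos_Ints_cases)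
  then have "Gamma \<alpha> \<noteq> 0" by (rule Gamma_nonzero)
  moreover have "Gamma (\<nu> + 1) \<noteq> 0" using Gamma_shift_pos[OF nu, of 0] by simp
  ultimately have D: "D \<noteq> 0" unfolding D_def by simp
  define Pw where "Pw t = indicator {0<..} t *\<^sub>R (of_real t powr (\<alpha> - 1) :: complex)" for t :: real
  have Pw[measurable]: "Pw \<in> borel_measurable borel" unfolding Pw_def[abs_def] by (rule measurable_powr_indicator)
  define k where "k t u = exp (- scale u * t) * \<J> (b / 2 * scale u * t)" for t u
  define k0 where "k0 t = exp (- (a / b) * t) * \<J> (c\<^sup>2 / 2 * t)" for t
  have km: "(\<lambda>(t, u). k t u) \<in> borel_measurable (lborel \<Otimes>\<^sub>M log_law)" unfolding k_def by measurable
  have kpos: "0 \<le> k t u" if "0 < t" for t u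
    unfolding k_def using that b scale_pos[of u] by (intro mult_nonneg_nonneg less_imp_le[OF J_pos]) auto
  have k0pos: "0 \<le> k0 t" if "0 < t" for t
    unfolding k0_def using that by (intro mult_nonneg_nonneg less_imp_le[OF J_pos]) auto
  have hk: "has_bochner_integral log_law (k t) (k0 t)" if "0 < t" for t
    unfolding k_def k0_def by (rule has_bochner_integral_log_law_kernel[OF that])
  have M1: "has_bochner_integral lborel (\<lambda>t. Pw t * of_real (k t u)) (D * of_real (scale u) powr (- \<alpha>) * kummer_c \<alpha> (\<nu> + 1) (of_real (b / 2)))" for u
  proof -
    have e: "b / 2 * scale u / scale u = b / 2" using scale_pos[of u] by simp
    have "has_bochner_integral lborel (\<lambda>t. indicator {0<..} t *\<^sub>R (of_real t powr (\<alpha> - 1) * of_real (exp (- scale u * t) * \<J> (b / 2 * scale u * t))) :: complex)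
      (D * of_real (scale u) powr (- \<alpha>) * kummer_c \<alpha> (\<nu> + 1) (of_real (b / 2 * scale u / scale u)))"
      unfolding D_def using scale_pos[of u] b by (intro mellin_bessel_clifford nu re) auto
    then show ?thesis unfolding e Pw_def k_def by simp
  qed
  have M2: "has_bochner_integral lborel (\<lambda>t. Pw t * of_real (k0 t)) (D * of_real (a / b) powr (- \<alpha>) * kummer_c \<alpha> (\<nu> + 1) (of_real (c\<^sup>2 * b / (2 * a))))"
  proof -
    have e: "c\<^sup>2 / 2 / (a / b) = c\<^sup>2 * b / (2 * a)" by simp
    have "has_bochner_integral lborel (\<lambda>t. indicator {0<..} t *\<^sub>R (of_real t powr (\<alpha> - 1) * of_real (exp (- (a / b) * t) * \<J> (c\<^sup>2 / 2 * t))) :: complex)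
      (D * of_real (a / b) powr (- \<alpha>) * kummer_c \<alpha> (\<nu> + 1) (of_real (c\<^sup>2 / 2 / (a / b))))"
      unfolding D_def using a_pos b by (intro mellin_bessel_clifford nu re) auto
    then show ?thesis unfolding e Pw_def k0_def by simp
  qed
  have fm: "(\<lambda>(t, u). Pw t * of_real (k t u)) \<in> borel_measurable (lborel \<Otimes>\<^sub>M log_law)"
  proof -
    have [measurable]: "(\<lambda>z. k (fst z) (snd z)) \<in> borel_measurable (lborel \<Otimes>\<^sub>M log_law)" using km by (simp add: split_beta')
    have [measurable]: "(\<lambda>z. Pw (fst z)) \<in> borel_measurable (lborel \<Otimes>\<^sub>M log_law)" by measurable
    show ?thesis unfolding split_beta' by (intro borel_measurable_times borel_measurable_of_real) measurable
  qed
  have in2: "has_bochner_integral log_law (\<lambda>u. Pw t * of_real (k t u)) (Pw t * of_real (k0 t))" for t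
  proof (cases "0 < t")
    case True
    then show ?thesis by (intro has_bochner_integral_mult_right has_bochner_integral_of_real hk)
  qed (simp add: Pw_def has_bochner_integral_zero)
  have nrm: "(LINT u|log_law. norm (Pw t * of_real (k t u))) = norm (Pw t * of_real (k0 t))" for t
  proof (cases "0 < t")
    case True
    have "(LINT u|log_law. norm (Pw t * of_real (k t u))) = (LINT u|log_law. norm (Pw t) * k t u)"
      using kpos[OF True] by (simp add: norm_mult)
    also have "\<dots> = norm (Pw t) * k0 t" using hk[OF True] by (simp add: has_bochner_integral_iff)
    finally show ?thesis using k0pos[OF True] by (simp add: norm_mult)
  qed (simp add: Pw_def)
  have int: "integrable (lborel \<Otimes>\<^sub>M log_law) (\<lambda>(t, u). Pw t * of_real (k t u))"
  proof (rule P.Fubini_integrable[OF fm])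
    show "integrable lborel (\<lambda>t. LINT u|log_law. norm (case (t, u) of (t, u) \<Rightarrow> Pw t * of_real (k t u)))"
      using integrable_norm[of lborel "\<lambda>t. Pw t * of_real (k0 t)"] M2 by (simp add: nrm has_bochner_integral_iff)
    show "AE t in lborel. integrable log_law (\<lambda>u. case (t, u) of (t, u) \<Rightarrow> Pw t * of_real (k t u))"
      using in2 by (simp add: has_bochner_integral_iff)
  qed
  have "(LINT u|log_law. LINT t|lborel. Pw t * of_real (k t u)) = (LINT t|lborel. LINT u|log_law. Pw t * of_real (k t u))"
    by (rule P.Fubini_integral[OF int])
  moreover have "(LINT t|lborel. Pw t * of_real (k t u)) = D * of_real (scale u) powr (- \<alpha>) * kummer_c \<alpha> (\<nu> + 1) (of_real (b / 2))" for u
    using M1[of u] by (simp add: has_bochner_integral_iff)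
  moreover have "(LINT u|log_law. Pw t * of_real (k t u)) = Pw t * of_real (k0 t)" for t
    using in2[of t] by (simp add: has_bochner_integral_iff)
  moreover have "(LINT t|lborel. Pw t * of_real (k0 t)) = D * of_real (a / b) powr (- \<alpha>) * kummer_c \<alpha> (\<nu> + 1) (of_real (c\<^sup>2 * b / (2 * a)))"
    using M2 by (simp add: has_bochner_integral_iff)
  ultimately have eq: "(LINT u|log_law. D * of_real (scale u) powr (- \<alpha>) * kummer_c \<alpha> (\<nu> + 1) (of_real (b / 2)))
    = D * of_real (a / b) powr (- \<alpha>) * kummer_c \<alpha> (\<nu> + 1) (of_real (c\<^sup>2 * b / (2 * a)))"
    by (simp only:)
  have sc: "of_real (scale u) powr (- \<alpha>) = of_real (a / b) powr (- \<alpha>) * exp (- \<alpha> * of_real u)" for u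
  proof -
    have "of_real (scale u) powr (- \<alpha>) = (of_real (a / b) * of_real (exp u)) powr (- \<alpha>)" by (simp add: scale_def)
    also have "\<dots> = of_real (a / b) powr (- \<alpha>) * of_real (exp u) powr (- \<alpha>)"
      using a_pos b by (intro powr_times_real) auto
    also have "of_real (exp u) powr (- \<alpha>) = exp (- \<alpha> * of_real u)"
    proof -
      have "Ln (of_real (exp u)) = of_real u" by (subst Ln_of_real) simp_all
      then show ?thesis unfolding powr_def by simp
    qed
    finally show ?thesis .
  qed
  define E where "E = D * (of_real (a / b) powr (- \<alpha>) :: complex)"
  have E: "E \<noteq> 0" unfolding E_def using D a_pos b by (simp add: powr_def)
  define k1 where "k1 = kummer_c \<alpha> (\<nu> + 1) (of_real (b / 2))"
  have k1: "k1 \<noteq> 0"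
  proof -
    have "1 \<le> norm k1" unfolding k1_def using re b by (intro norm_kummer_c_ge_1[OF nu1]) auto
    then show ?thesis by auto
  qed
  have "(LINT u|log_law. D * of_real (scale u) powr (- \<alpha>) * k1) = (LINT u|log_law. (E * k1) * exp (- \<alpha> * of_real u))"
    unfolding sc E_def by (intro Bochner_Integration.integral_cong refl) (simp add: mult_ac)
  also have "\<dots> = E * k1 * (LINT u|log_law. exp (- \<alpha> * of_real u))" by simp
  finally have "E * k1 * (LINT u|log_law. exp (- \<alpha> * of_real u)) = E * kummer_c \<alpha> (\<nu> + 1) (of_real (c\<^sup>2 * b / (2 * a)))"
    using eq unfolding k1_def[symmetric] E_def[symmetric] by (simp only:)
  then have "k1 * (LINT u|log_law. exp (- \<alpha> * of_real u)) = kummer_c \<alpha> (\<nu> + 1) (of_real (c\<^sup>2 * b / (2 * a)))"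
    using E by (simp add: mult.assoc)
  then show ?thesis unfolding k1_def[symmetric] using k1 by (simp add: eq_divide_eq mult.commute)
qed

end

lemma kummer_M_eq_kummer_c:
  assumes "0 < \<beta>"
  shows "kummer_c (of_real \<alpha>) \<beta> (of_real z) = of_real (kummer_M \<alpha> \<beta> z)"
proof -
  have e: "pochhammer (of_real \<alpha>) k / (of_real (pochhammer \<beta> k) * fact k) * of_real z ^ k
    = (of_real (pochhammer \<alpha> k / (pochhammer \<beta> k * fact k) * z ^ k) :: complex)" for k
    by (simp add: pochhammer_of_real)
  have "summable (\<lambda>k. norm (pochhammer \<alpha> k / (pochhammer \<beta> k * fact k) * z ^ k))"
    using summable_kummer_c[OF assms, of "of_real \<alpha>" "of_real z"] unfolding e norm_of_real by simp
  then have "summable (\<lambda>k. pochhammer \<alpha> k / (pochhammer \<beta> k * fact k) * z ^ k)"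
    by (rule summable_norm_cancel)
  then show ?thesis unfolding kummer_c_def kummer_M_def e by (rule suminf_of_real[symmetric])
qed

lemma integrable_inverse_1_plus_square: "integrable lborel (\<lambda>x::real. inverse (1 + x\<^sup>2))"
proof -
  have "(\<lambda>x::real. indicator (einterval (-\<infinity>) \<infinity>) x *\<^sub>R inverse (1 + x\<^sup>2)) = (\<lambda>x. inverse (1 + x\<^sup>2))"
    by (auto simp: einterval_def)
  then show ?thesis using Sinc_Integral.integrable_inverse_1_plus_square by (simp add: set_integrable_def)
qed

context bessel_passage
begin

abbreviation kummer_ratio :: "real \<Rightarrow> real" where
  "kummer_ratio l \<equiv> kummer_M l (\<nu> + 1) (c\<^sup>2 * b / (2 * a)) / kummer_M l (\<nu> + 1) (b / 2)"

abbreviation half_index :: real where "half_index \<equiv> (\<nu> + 1) / 2"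

lemma log_law_pos: "AE u in log_law. 0 < u"
proof -
  have "0 < log_time t" if "0 < t" for t
    unfolding log_time_def using that a_pos b by (intro ln_gt_zero) simp
  then have "AE \<omega> in density M (\<lambda>\<omega>. ennreal (weight (G \<omega>)) * indicator passed \<omega>). 0 < log_time (G \<omega>)"
    by (subst AE_density) (auto simp: passed_def split: split_indicator intro!: AE_I2)
  then show ?thesis unfolding log_law_def by (subst AE_distr_iff) simp_all
qed

lemma integrable_log_law_exp:
  assumes "0 \<le> l" shows "integrable log_law (\<lambda>u. exp (- l * u))"
proof (rule L.integrable_const_bound[where B = 1])
  show "AE u in log_law. norm (exp (- l * u)) \<le> 1"
    using log_law_pos by eventually_elim (use assms in simp)
qed measurable

lemma log_law_laplace_real:
  assumes l: "0 < l"
  shows "(LINT u|log_law. exp (- l * u)) = kummer_ratio l"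
proof -
  have nu1: "0 < \<nu> + 1" using nu by simp
  have "complex_of_real (LINT u|log_law. exp (- l * u)) = (LINT u|log_law. exp (- of_real l * of_real u))"
    by (simp add: integral_complex_of_real[symmetric] exp_of_real[symmetric])
  also have "\<dots> = kummer_c (of_real l) (\<nu> + 1) (of_real (c\<^sup>2 * b / (2 * a))) / kummer_c (of_real l) (\<nu> + 1) (of_real (b / 2))"
    using l by (intro log_law_laplace) simp
  also have "\<dots> = of_real (kummer_ratio l)"
    unfolding kummer_M_eq_kummer_c[OF nu1] by (rule of_real_divide[symmetric])
  finally show ?thesis by (simp only: of_real_eq_iff)
qed

lemma absolutely_continuous_log_law: "absolutely_continuous lborel log_law"
proof -
  have nu1: "0 < \<nu> + 1" and l0: "0 < half_index" using nu by simp_all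
  define m where "m = (LINT u|log_law. exp (- half_index * u))"
  have ie: "integrable log_law (\<lambda>u. exp (- half_index * u))" using l0 by (intro integrable_log_law_exp) simp
  have m: "0 < m"
  proof -
    have "m \<noteq> 0"
    proof
      assume "m = 0"
      then have "AE u in log_law. exp (- half_index * u) = 0"
        unfolding m_def using integral_nonneg_eq_0_iff_AE[OF ie] by simp
      then show False using L.AE_False by simp
    qed
    moreover have "0 \<le> m" unfolding m_def by (intro Bochner_Integration.integral_nonneg) simp
    ultimately show ?thesis by simp
  qed
  define T where "T = density log_law (\<lambda>u. ennreal (exp (- half_index * u) / m))"
  have "(\<integral>\<^sup>+u. ennreal (exp (- half_index * u) / m) \<partial>log_law) = ennreal (LINT u|log_law. exp (- half_index * u) / m)"
    using ie m by (intro nn_integral_eq_integral) simp_all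
  also have "(LINT u|log_law. exp (- half_index * u) / m) = (LINT u|log_law. exp (- half_index * u)) / m"
    by (rule Bochner_Integration.integral_divide_zero)
  also have "\<dots> = 1" unfolding m_def[symmetric] using m by simp
  finally have "emeasure T UNIV = 1" unfolding T_def by (subst emeasure_density) simp_all
  then interpret T: prob_space T by (intro prob_spaceI) (simp add: T_def)
  interpret T: real_distribution T by unfold_locales (simp add: T_def)
  have z: "0 \<le> c\<^sup>2 * b / (2 * a)" "c\<^sup>2 * b / (2 * a) < b / 2"
    using a_pos b c_square_less by (auto simp: field_simps)
  obtain K where K: "\<And>\<alpha>. 0 \<le> Re \<alpha> \<Longrightarrow> norm (kummer_c \<alpha> (\<nu> + 1) (of_real (c\<^sup>2 * b / (2 * a))) / kummer_c \<alpha> (\<nu> + 1) (of_real (b / 2))) * (1 + (Im \<alpha>)\<^sup>2) \<le> K"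
    using kummer_c_ratio_decay[OF nu1 z] by blast
  have ch: "char T \<theta> = kummer_c (Complex half_index (- \<theta>)) (\<nu> + 1) (of_real (c\<^sup>2 * b / (2 * a))) / kummer_c (Complex half_index (- \<theta>)) (\<nu> + 1) (of_real (b / 2)) / of_real m" for \<theta>
  proof -
    have "char T \<theta> = (CLINT u|log_law. (exp (- half_index * u) / m) *\<^sub>R iexp (\<theta> * u))"
      unfolding char_def T_def using m by (subst integral_density) simp_all
    also have "\<dots> = (CLINT u|log_law. exp (- Complex half_index (- \<theta>) * of_real u) / of_real m)"
    proof (intro Bochner_Integration.integral_cong refl)
      fix u
      have "- Complex half_index (- \<theta>) * of_real u = of_real (- half_index * u) + \<i> * of_real (\<theta> * u)"
        by (simp add: complex_eq_iff)
      then have "exp (- Complex half_index (- \<theta>) * of_real u) = exp (of_real (- half_index * u) + \<i> * of_real (\<theta> * u))"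
        by (simp only:)
      also have "\<dots> = of_real (exp (- half_index * u)) * iexp (\<theta> * u)"
        unfolding exp_add exp_of_real[symmetric] ..
      finally show "(exp (- half_index * u) / m) *\<^sub>R iexp (\<theta> * u) = exp (- Complex half_index (- \<theta>) * of_real u) / of_real m"
        by (simp add: scaleR_conv_of_real)
    qed
    also have "\<dots> = (CLINT u|log_law. exp (- Complex half_index (- \<theta>) * of_real u)) / of_real m" by simp
    also have "(CLINT u|log_law. exp (- Complex half_index (- \<theta>) * of_real u)) = kummer_c (Complex half_index (- \<theta>)) (\<nu> + 1) (of_real (c\<^sup>2 * b / (2 * a))) / kummer_c (Complex half_index (- \<theta>)) (\<nu> + 1) (of_real (b / 2))"
      using l0 by (intro log_law_laplace) simp
    finally show ?thesis .
  qed
  have "integrable lborel (char T)"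
  proof (rule Bochner_Integration.integrable_bound)
    show "integrable lborel (\<lambda>\<theta>::real. K / m * inverse (1 + \<theta>\<^sup>2))"
      by (intro integrable_mult_right integrable_inverse_1_plus_square)
    show "char T \<in> borel_measurable lborel" using T.char_measurable by simp
    show "AE \<theta> in lborel. norm (char T \<theta>) \<le> norm (K / m * inverse (1 + \<theta>\<^sup>2))"
    proof (rule AE_I2)
      fix \<theta> :: real
      have p: "0 < 1 + \<theta>\<^sup>2" by (intro add_pos_nonneg) simp_all
      let ?A = "kummer_c (Complex half_index (- \<theta>)) (\<nu> + 1) (of_real (c\<^sup>2 * b / (2 * a)))"
      let ?B = "kummer_c (Complex half_index (- \<theta>)) (\<nu> + 1) (of_real (b / 2))"
      have "norm ?A * (1 + \<theta>\<^sup>2) / norm ?B \<le> K"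
        using K[of "Complex half_index (- \<theta>)"] l0 by (simp add: norm_divide)
      moreover have "norm (char T \<theta>) = norm ?A / norm ?B / m"
        unfolding ch using m by (simp only: norm_divide norm_of_real abs_of_pos)
      moreover have "X / Y / m * m * Z = X * Z / Y" for X Y Z :: real using m by simp
      ultimately have "norm (char T \<theta>) * m * (1 + \<theta>\<^sup>2) \<le> K" by (simp only:)
      then have "norm (char T \<theta>) \<le> K / m * inverse (1 + \<theta>\<^sup>2)"
        using p m by (simp add: divide_inverse[symmetric] pos_le_divide_eq mult_ac)
      then show "norm (char T \<theta>) \<le> norm (K / m * inverse (1 + \<theta>\<^sup>2))"
        unfolding real_norm_def by (rule order_trans[OF _ abs_ge_self])
    qed
  qed
  then have ac: "absolutely_continuous lborel T" by (rule T.absolutely_continuous_of_integrable_char)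
  show ?thesis
    unfolding absolutely_continuous_def
  proof
    fix A :: "real set" assume A: "A \<in> null_sets lborel"
    then have A': "A \<in> sets borel" "A \<in> null_sets T" using ac by (auto simp: absolutely_continuous_def)
    then have "(\<integral>\<^sup>+u. ennreal (exp (- half_index * u) / m) * indicator A u \<partial>log_law) = 0"
      unfolding T_def by (auto simp: null_sets_def emeasure_density)
    then have "AE u in log_law. ennreal (exp (- half_index * u) / m) * indicator A u = 0"
      using A' by (subst (asm) nn_integral_0_iff_AE) auto
    then have "AE u in log_law. u \<notin> A"
      by eventually_elim (use m in \<open>auto split: split_indicator_asm\<close>)
    then show "A \<in> null_sets log_law" using A' by (subst AE_iff_null_sets) simp_all
  qed
qed

lemma log_law_density:
  obtains \<rho> :: "real \<Rightarrow> real" where "\<rho> \<in> borel_measurable borel" "\<And>u. 0 \<le> \<rho> u" "\<And>u. u \<le> 0 \<Longrightarrow> \<rho> u = 0"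
    "log_law = density lborel (\<lambda>u. ennreal (\<rho> u))"
proof -
  obtain r where r[measurable]: "r \<in> borel_measurable lborel" and d: "density lborel r = log_law"
    using sigma_finite_measure.Radon_Nikodym[OF sigma_finite_lborel absolutely_continuous_log_law] by auto
  define \<rho> where "\<rho> u = indicator {0<..} u * enn2real (r u)" for u
  have [measurable]: "r \<in> borel_measurable borel" using r by simp
  have "(\<integral>\<^sup>+u. r u \<partial>lborel) = 1"
    using emeasure_log_law unfolding d[symmetric] by (subst (asm) emeasure_density) simp_all
  then have f: "AE u in lborel. r u \<noteq> \<infinity>" by (intro nn_integral_PInf_AE) simp_all
  have p: "AE u in lborel. 0 < r u \<longrightarrow> 0 < u"
    using log_law_pos unfolding d[symmetric] by (subst (asm) AE_density) simp_all
  have "AE u in lborel. r u = ennreal (\<rho> u)"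
    using f p
  proof eventually_elim
    case (elim u)
    show ?case
    proof (cases "0 < u")
      case True
      then show ?thesis using elim(1) by (simp add: \<rho>_def less_top[symmetric])
    next
      case False
      then have "r u = 0" using elim(2) by (auto simp: zero_less_iff_neq_zero)
      then show ?thesis using False by (simp add: \<rho>_def)
    qed
  qed
  then have "density lborel r = density lborel (\<lambda>u. ennreal (\<rho> u))"
    by (intro density_cong) (simp_all add: \<rho>_def)
  then have "log_law = density lborel (\<lambda>u. ennreal (\<rho> u))" unfolding d .
  moreover have "\<rho> \<in> borel_measurable borel" unfolding \<rho>_def by measurable
  moreover have "0 \<le> \<rho> u" for u unfolding \<rho>_def by simp
  moreover have "\<rho> u = 0" if "u \<le> 0" for u unfolding \<rho>_def using that by simp
  ultimately show thesis by (intro that[of \<rho>])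
qed

lemma log_law_density_laplace:
  assumes [measurable]: "\<rho> \<in> borel_measurable borel" and \<rho>: "\<And>u. 0 \<le> \<rho> u"
    and d: "log_law = density lborel (\<lambda>u. ennreal (\<rho> u))" and l: "0 < l"
  shows "has_bochner_integral lborel (\<lambda>u. exp (- l * u) * \<rho> u) (kummer_ratio l)"
proof -
  have "integrable (density lborel (\<lambda>u. ennreal (\<rho> u))) (\<lambda>u. exp (- l * u))"
    using integrable_log_law_exp[of l] l by (simp add: d[symmetric])
  then have "integrable lborel (\<lambda>u. \<rho> u *\<^sub>R exp (- l * u))"
    using \<rho> by (subst (asm) integrable_density) simp_all
  moreover have "(LINT u|lborel. \<rho> u *\<^sub>R exp (- l * u)) = kummer_ratio l"
    unfolding log_law_laplace_real[OF l, symmetric] d using \<rho> by (subst integral_density) simp_all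
  ultimately show ?thesis by (simp add: has_bochner_integral_iff mult.commute)
qed

definition tail_density :: "real \<Rightarrow> real" where
  "tail_density t = b / t\<^sup>2 * (a + b / t) powr ((\<nu> - 1) / 2) * exp (- x\<^sup>2 / (2 * t)) * \<J> (x\<^sup>2 * (a + b / t) / 4) / \<J> (c\<^sup>2 * x\<^sup>2 / 4)"

lemma measurable_tail_density [measurable]: "tail_density \<in> borel_measurable borel"
  unfolding tail_density_def[abs_def] by measurable

lemma exp_log_time: "0 < t \<Longrightarrow> exp (half_index * log_time t) * a powr half_index = (a + b / t) powr half_index"
proof -
  assume t: "0 < t"
  have p: "0 < 1 + b / (a * t)" using a_pos b t by (simp add: add_pos_pos)
  have "exp (half_index * log_time t) = (1 + b / (a * t)) powr half_index"
    using p by (simp add: log_time_def powr_def)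
  then have "exp (half_index * log_time t) * a powr half_index = ((1 + b / (a * t)) * a) powr half_index"
    by (simp only: powr_mult)
  also have "(1 + b / (a * t)) * a = a + b / t" using a_pos by (simp add: distrib_right)
  finally show ?thesis .
qed

lemma tail_density_eq:
  assumes t: "0 < t"
  shows "b / (t\<^sup>2 * (a + b / t)) * (a + b / t) powr half_index / weight t = tail_density t"
proof -
  have p: "0 < a + b / t" by (rule add_pos_pos[OF a_pos divide_pos_pos[OF b t]])
  have h: "half_index = 1 + (\<nu> - 1) / 2" by (simp add: add_divide_distrib diff_divide_distrib)
  have 1: "(a + b / t) powr half_index = (a + b / t) * (a + b / t) powr ((\<nu> - 1) / 2)"
    unfolding h by (rule powr_mult_base[symmetric]) (rule less_imp_le[OF p])
  have 2: "exp (- x\<^sup>2 / (2 * t)) = inverse (exp (x\<^sup>2 / (2 * t)))" by (simp only: minus_divide_left[symmetric] exp_minus)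
  have alg: "B / (T * p) * (p * q) / (E * J / K) = B / T * q * inverse E * K / J" if "p \<noteq> 0" for B T p q E J K :: real
    using that by (simp add: divide_inverse inverse_mult_distrib)
  show ?thesis unfolding weight_def tail_density_def 1 2 by (rule alg) (use p in linarith)
qed

lemma log_time_derivative:
  assumes t: "0 < t"
  shows "(log_time has_real_derivative - (b / (t\<^sup>2 * (a + b / t)))) (at t within S)"
proof -
  have p: "0 < 1 + b / (a * t)" by (rule add_pos_pos[OF zero_less_one divide_pos_pos[OF b mult_pos_pos[OF a_pos t]]])
  have "((\<lambda>t. 1 + b / a * inverse t) has_real_derivative 0 + b / a * (- (inverse t ^ Suc (Suc 0)))) (at t within S)"
    by (intro DERIV_add DERIV_const DERIV_cmult DERIV_inverse) (use t in simp)
  then have "((\<lambda>t. 1 + b / (a * t)) has_real_derivative - (b / (a * t\<^sup>2))) (at t within S)"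
    by (simp add: divide_inverse power2_eq_square mult.assoc inverse_mult_distrib)
  from DERIV_chain2[OF DERIV_ln[OF p] this]
  have "(log_time has_real_derivative inverse (1 + b / (a * t)) * - (b / (a * t\<^sup>2))) (at t within S)"
    unfolding log_time_def[abs_def] .
  also have "inverse (1 + b / (a * t)) * - (b / (a * t\<^sup>2)) = - (b / (a * t\<^sup>2 * (1 + b / (a * t))))"
    by (simp add: divide_inverse inverse_mult_distrib mult.commute)
  also have "a * t\<^sup>2 * (1 + b / (a * t)) = t\<^sup>2 * (a * (1 + b / (a * t)))" by (simp only: mult.assoc mult.left_commute)
  also have "a * (1 + b / (a * t)) = a + b / t" using a_pos by (simp add: distrib_left)
  finally show ?thesis .
qed

lemma log_time_bij: "log_time ` {0<..} = {0<..}" "inj_on log_time {0<..}"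
proof -
  show "inj_on log_time {0<..}"
  proof (rule inj_onI)
    fix s t :: real assume st: "s \<in> {0<..}" "t \<in> {0<..}" and e: "log_time s = log_time t"
    have "a / b + 1 / s = a / b + 1 / t"
      using scale_log_time[of s] scale_log_time[of t] st unfolding e by (simp only: greaterThan_iff)
    then show "s = t" by simp
  qed
  show "log_time ` {0<..} = {0<..}"
  proof (intro equalityI subsetI)
    fix u assume "u \<in> log_time ` {0<..}"
    then obtain t where u: "u = log_time t" and t: "0 < t" by blast
    have "0 < b / (a * t)" by (rule divide_pos_pos[OF b mult_pos_pos[OF a_pos t]])
    then have "0 < log_time t" unfolding log_time_def by (intro ln_gt_zero) linarith
    then show "u \<in> {0<..}" unfolding u by simp
  next
    fix u :: real assume "u \<in> {0<..}"
    then have u: "0 < exp u - 1" by simp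
    define t where "t = b / (a * (exp u - 1))"
    have t: "0 < t" unfolding t_def by (rule divide_pos_pos[OF b mult_pos_pos[OF a_pos u]])
    have "b / (a * t) = exp u - 1" unfolding t_def using a_pos b u by simp
    then have "log_time t = u" by (simp add: log_time_def)
    then show "u \<in> log_time ` {0<..}" using t by (intro image_eqI[of u log_time t]) simp_all
  qed
qed

theorem last_passage_distributed:
  assumes cc: "0 < cc" and phi: "has_laplace_transform \<phi> L"
    and L: "\<And>l. 0 \<le> l \<Longrightarrow> L l = cc * a powr (- half_index) * kummer_ratio (l + half_index)"
  shows "distributed M lborel G (\<lambda>t. ennreal (indicator {0<..} t * (\<phi> (log_time t) * tail_density t / cc)))"
proof -
  have l0: "0 < half_index" using nu by simp
  obtain \<rho> where \<rho>[measurable]: "\<rho> \<in> borel_measurable borel" and \<rho>0: "\<And>u. 0 \<le> \<rho> u" "\<And>u. u \<le> 0 \<Longrightarrow> \<rho> u = 0"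
    and d: "log_law = density lborel (\<lambda>u. ennreal (\<rho> u))" using log_law_density by blast
  define \<phi>' where "\<phi>' u = indicator {0..} u * \<phi> u" for u
  have int: "has_bochner_integral lborel (\<lambda>u. exp (- l * u) * \<phi>' u) (L l)" if "0 \<le> l" for l
  proof -
    have e: "(\<lambda>u. exp (- l * u) * \<phi>' u) = (\<lambda>u. indicator {0..} u *\<^sub>R (exp (- l * u) * \<phi> u))"
      by (auto simp: \<phi>'_def)
    show ?thesis using phi that unfolding has_laplace_transform_def e
      by (simp add: has_bochner_integral_iff set_integrable_def set_lebesgue_integral_def)
  qed
  have i\<phi>: "integrable lborel \<phi>'" using int[of 0] by (simp add: has_bochner_integral_iff)
  have [measurable]: "\<phi>' \<in> borel_measurable borel" using borel_measurable_integrable[OF i\<phi>] by simp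
  define \<kappa> where "\<kappa> = cc * a powr (- half_index)"
  have kappa: "0 < \<kappa>" using cc a_pos by (simp add: \<kappa>_def)
  define h where "h u = \<phi>' u - \<kappa> * (exp (- half_index * u) * \<rho> u)" for u
  have hint: "has_bochner_integral lborel (\<lambda>u. exp (- l * u) * h u) 0" if l: "0 \<le> l" for l
  proof -
    have "has_bochner_integral lborel (\<lambda>u. exp (- l * u) * \<phi>' u - \<kappa> * (exp (- (l + half_index) * u) * \<rho> u)) (L l - \<kappa> * kummer_ratio (l + half_index))"
      using l l0 by (intro has_bochner_integral_diff has_bochner_integral_mult_right int log_law_density_laplace \<rho> \<rho>0 d add_nonneg_pos[OF l l0])
    moreover have "exp (- l * u) * \<phi>' u - \<kappa> * (exp (- (l + half_index) * u) * \<rho> u) = exp (- l * u) * h u" for u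
    proof -
      have "exp (- (l + half_index) * u) = exp (- l * u) * exp (- half_index * u)"
        unfolding exp_add[symmetric] by (intro arg_cong[where f = exp]) (simp add: algebra_simps)
      then show ?thesis unfolding h_def by (simp add: algebra_simps)
    qed
    moreover have "L l - \<kappa> * kummer_ratio (l + half_index) = 0" unfolding L[OF l] \<kappa>_def by simp
    ultimately show ?thesis by (simp only:)
  qed
  have h0: "AE u in lborel. h u = 0"
  proof (rule laplace_unique)
    show "integrable lborel h" using hint[of 0] by (simp add: has_bochner_integral_iff)
    show "h u = 0" if "u < 0" for u using that \<rho>0(2)[of u] by (simp add: h_def \<phi>'_def)
    show "(LINT u|lborel. exp (- (real n * u)) * h u) = 0" for n
      using hint[of "real n"] by (simp add: has_bochner_integral_iff)
  qed
  define q where "q u = exp (half_index * u) * a powr half_index * \<phi>' u / cc" for u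
  have [measurable]: "q \<in> borel_measurable borel" unfolding q_def by measurable
  have q\<rho>: "AE u in lborel. \<rho> u = q u"
    using h0
  proof eventually_elim
    case (elim u)
    then have "\<phi>' u = \<kappa> * (exp (- half_index * u) * \<rho> u)" by (simp add: h_def)
    then have "q u = (exp (half_index * u) * exp (- half_index * u)) * (a powr half_index * a powr (- half_index)) * \<rho> u"
      using cc by (simp add: q_def \<kappa>_def)
    also have "exp (half_index * u) * exp (- half_index * u) = 1" by (simp add: exp_add[symmetric])
    also have "a powr half_index * a powr (- half_index) = 1" using a_pos by (simp add: powr_add[symmetric])
    finally show ?case by simp
  qed
  let ?f = "\<lambda>t. ennreal (indicator {0<..} t * (\<phi> (log_time t) * tail_density t / cc))"
  have lt: "0 < log_time t" if "0 < t" for t using log_time_bij(1) that by auto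
  have f: "?f = (\<lambda>t. ennreal (indicator {0<..} t * (\<phi>' (log_time t) * tail_density t / cc)))"
    using lt by (auto simp: \<phi>'_def split: split_indicator intro!: ext arg_cong[where f = ennreal] less_imp_le)
  have fm[measurable]: "?f \<in> borel_measurable borel" unfolding f by measurable
  define g where "g u = 1 / (scale u - a / b)" for u
  have [measurable]: "g \<in> borel_measurable borel" unfolding g_def by measurable
  have g: "g (log_time t) = t" if "0 < t" for t unfolding g_def scale_log_time[OF that] using that by simp
  have "distr M lborel G = density lborel ?f"
  proof (rule measure_eqI)
    fix A assume "A \<in> sets (distr M lborel G)"
    then have A[measurable]: "A \<in> sets borel" by simp
    define F where "F u = ennreal (1 / weight (g u)) * indicator A (g u)" for u
    have [measurable]: "F \<in> borel_measurable borel" unfolding F_def by measurable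
    have "emeasure (distr M lborel G) A = (\<integral>\<^sup>+\<omega>. indicator A (G \<omega>) \<partial>M)"
      by (subst nn_integral_indicator[symmetric], simp, subst nn_integral_distr) simp_all
    also have "\<dots> = (\<integral>\<^sup>+\<omega>. ennreal (weight (G \<omega>)) * F (log_time (G \<omega>)) * indicator passed \<omega> \<partial>M)"
    proof (rule nn_integral_cong_AE)
      show "AE \<omega> in M. indicator A (G \<omega>) = ennreal (weight (G \<omega>)) * F (log_time (G \<omega>)) * indicator passed \<omega>"
        using AE_passed AE_space
      proof eventually_elim
        case (elim \<omega>)
        have w: "0 < weight (G \<omega>)" by (rule weight_pos[OF elim(1)])
        have "ennreal (weight (G \<omega>)) * ennreal (1 / weight (G \<omega>)) = 1"
          using w by (subst ennreal_mult[symmetric]) simp_all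
        then have "ennreal (weight (G \<omega>)) * (ennreal (1 / weight (G \<omega>)) * indicator A (G \<omega>)) = indicator A (G \<omega>)"
          by (simp only: mult.assoc[symmetric] mult_1)
        then show ?case using elim by (simp add: F_def g passed_def)
      qed
    qed
    also have "\<dots> = (\<integral>\<^sup>+u. F u \<partial>log_law)" by (rule nn_integral_log_law[symmetric]) measurable
    also have "\<dots> = (\<integral>\<^sup>+u. ennreal (\<rho> u) * F u \<partial>lborel)"
      unfolding d by (subst nn_integral_density) simp_all
    also have "\<dots> = (\<integral>\<^sup>+u. (ennreal (q u) * F u) * indicator (log_time ` {0<..}) u \<partial>lborel)"
    proof (rule nn_integral_cong_AE)
      show "AE u in lborel. ennreal (\<rho> u) * F u = (ennreal (q u) * F u) * indicator (log_time ` {0<..}) u"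
        using q\<rho>
      proof eventually_elim
        case (elim u)
        then show ?case using \<rho>0(2)[of u] by (cases "0 < u") (simp_all add: log_time_bij(1))
      qed
    qed
    also have "\<dots> = (\<integral>\<^sup>+t. ennreal \<bar>- (b / (t\<^sup>2 * (a + b / t)))\<bar> * (ennreal (q (log_time t)) * F (log_time t)) * indicator {0<..} t \<partial>lborel)"
    proof (rule nn_integral_change_of_variables)
      show "log_time ` {0<..} \<in> sets borel" unfolding log_time_bij(1) by simp
    qed (auto intro: log_time_derivative log_time_bij(2))
    also have "\<dots> = (\<integral>\<^sup>+t. ?f t * indicator A t \<partial>lborel)"
    proof (intro nn_integral_cong)
      fix t :: real
      show "ennreal \<bar>- (b / (t\<^sup>2 * (a + b / t)))\<bar> * (ennreal (q (log_time t)) * F (log_time t)) * indicator {0<..} t = ?f t * indicator A t"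
      proof (cases "0 < t")
        case True
        define B where "B = b / (t\<^sup>2 * (a + b / t))"
        have B: "0 < B" unfolding B_def using True a_pos b by (simp add: add_pos_pos)
        have w: "0 < weight t" by (rule weight_pos[OF True])
        have "B * q (log_time t) * (1 / weight t) = \<phi>' (log_time t) * (B * (exp (half_index * log_time t) * a powr half_index) / weight t) / cc"
          unfolding q_def by (simp only: divide_inverse mult_ac mult_1_left inverse_mult_distrib)
        also have "B * (exp (half_index * log_time t) * a powr half_index) / weight t = tail_density t"
          unfolding exp_log_time[OF True] B_def by (rule tail_density_eq[OF True])
        finally have eq: "B * q (log_time t) * (1 / weight t) = \<phi>' (log_time t) * tail_density t / cc" .
        have "ennreal B * (ennreal (q (log_time t)) * ennreal (1 / weight t)) = ennreal (B * q (log_time t) * (1 / weight t))"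
          using B w by (simp add: ennreal_mult'[symmetric] ennreal_mult''[symmetric] mult.assoc)
        also have "\<dots> = ?f t"
        proof -
          have "log_time t \<in> {0<..}" using log_time_bij(1) True by blast
          then have "\<phi>' (log_time t) = \<phi> (log_time t)" by (simp add: \<phi>'_def)
          then show ?thesis unfolding eq f using True by simp
        qed
        finally have "ennreal B * (ennreal (q (log_time t)) * (ennreal (1 / weight t) * indicator A t)) = ?f t * indicator A t"
          by (simp only: mult.assoc[symmetric])
        then show ?thesis using True B unfolding F_def g[OF True] B_def[symmetric] by simp
      qed simp
    qed
    also have "\<dots> = emeasure (density lborel ?f) A"
      using fm by (subst emeasure_density) simp_all
    finally show "emeasure (distr M lborel G) A = emeasure (density lborel ?f) A" .
  qed simp
  then show ?thesis using fm by (simp add: distributed_def)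
qed

theorem laplace_exists:
  assumes cc: "0 < cc" and L: "\<And>l. 0 \<le> l \<Longrightarrow> L l = cc * a powr (- half_index) * kummer_ratio (l + half_index)"
  shows "\<exists>\<phi>. has_laplace_transform \<phi> L"
proof -
  have l0: "0 < half_index" using nu by simp
  obtain \<rho> where \<rho>: "\<rho> \<in> borel_measurable borel" "\<And>u. 0 \<le> \<rho> u" "\<And>u. u \<le> 0 \<Longrightarrow> \<rho> u = 0"
    and d: "log_law = density lborel (\<lambda>u. ennreal (\<rho> u))" using log_law_density by blast
  define \<kappa> where "\<kappa> = cc * a powr (- half_index)"
  have "has_laplace_transform (\<lambda>u. \<kappa> * (exp (- half_index * u) * \<rho> u)) L"
    unfolding has_laplace_transform_def
  proof (intro allI impI)
    fix l :: real assume l: "0 \<le> l"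
    have e: "indicator {0..} u *\<^sub>R (exp (- l * u) * (\<kappa> * (exp (- half_index * u) * \<rho> u))) = \<kappa> * (exp (- (l + half_index) * u) * \<rho> u)" for u
    proof (cases "0 \<le> u")
      case True
      have "exp (- (l + half_index) * u) = exp (- l * u) * exp (- half_index * u)"
        unfolding exp_add[symmetric] by (intro arg_cong[where f = exp]) (simp add: algebra_simps)
      then show ?thesis using True by simp
    qed (use \<rho>(3)[of u] in simp)
    have "has_bochner_integral lborel (\<lambda>u. \<kappa> * (exp (- (l + half_index) * u) * \<rho> u)) (\<kappa> * kummer_ratio (l + half_index))"
      by (intro has_bochner_integral_mult_right log_law_density_laplace \<rho>(1,2) d add_nonneg_pos[OF l l0])
    then show "set_integrable lborel {0..} (\<lambda>u. exp (- l * u) * (\<kappa> * (exp (- half_index * u) * \<rho> u))) \<and>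
      (LBINT u:{0..}. exp (- l * u) * (\<kappa> * (exp (- half_index * u) * \<rho> u))) = L l"
      unfolding set_integrable_def set_lebesgue_integral_def e L[OF l] \<kappa>_def[symmetric] has_bochner_integral_iff .
  qed
  then show ?thesis by blast
qed

end

section \<open>The limiting cases of the formula\<close>

lemma tendsto_kummer_M:
  assumes \<beta>: "0 < \<beta>" and z: "(z \<longlongrightarrow> 0) F"
  shows "((\<lambda>s. kummer_M \<alpha> \<beta> (z s)) \<longlongrightarrow> 1) F"
proof -
  obtain w' where "\<And>z. (kummer_c (of_real \<alpha>) \<beta> has_field_derivative w' z) (at z)"
    using kummer_c_ode[OF \<beta>, of "of_real \<alpha>"] by metis
  then have c: "isCont (kummer_c (of_real \<alpha>) \<beta>) 0" by (rule DERIV_isCont)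
  have "((\<lambda>s. of_real (z s)) \<longlongrightarrow> (0::complex)) F" using tendsto_of_real[OF z] by simp
  then have "((\<lambda>s. kummer_c (of_real \<alpha>) \<beta> (of_real (z s))) \<longlongrightarrow> 1) F"
    by (rule isCont_tendsto_compose[OF c, unfolded kummer_c_0[OF \<beta>]])
  from tendsto_Re[OF this] show ?thesis unfolding kummer_M_eq_kummer_c[OF \<beta>] by simp
qed

lemma kummer_M_0: "kummer_M \<alpha> \<beta> 0 = 1"
  unfolding kummer_M_def by (subst powser_zero) simp

definition passage_factor :: "real \<Rightarrow> real \<Rightarrow> real \<Rightarrow> real \<Rightarrow> real \<Rightarrow> real \<Rightarrow> real" where
  "passage_factor \<nu> a b c x t = b / t\<^sup>2 * (a + b / t) powr ((\<nu> - 1) / 2) * exp (- x\<^sup>2 / (2 * t))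
     * bessel_clifford \<nu> (x\<^sup>2 * (a + b / t) / 4) / bessel_clifford \<nu> (c\<^sup>2 * x\<^sup>2 / 4)"

context
  fixes \<nu> a b :: real
  assumes nu: "-1 < \<nu>" and a: "0 < a" and b: "0 < b"
begin

lemma tendsto_passage_factor:
  assumes t: "0 < t" and c: "(c \<longlongrightarrow> c0) F" and x: "(x \<longlongrightarrow> x0) F"
  shows "((\<lambda>s. passage_factor \<nu> a b (c s) (x s) t) \<longlongrightarrow> passage_factor \<nu> a b c0 x0 t) F"
proof -
  have "0 < bessel_clifford \<nu> (c0\<^sup>2 * x0\<^sup>2 / 4)" by (intro bessel_clifford_pos nu) simp
  moreover have "2 * t \<noteq> 0" using t by simp
  ultimately show ?thesis unfolding passage_factor_def
    by (intro tendsto_divide tendsto_mult tendsto_const tendsto_exp tendsto_minus tendsto_power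
      tendsto_bessel_clifford[OF nu] c x) simp_all
qed

lemma passage_density_interior_eq:
  assumes c: "0 < c" and x: "0 < x" and t: "0 < t"
  shows "passage_density_interior \<nu> a b c \<phi> x t = \<phi> (ln (1 + b / (a * t))) * passage_factor \<nu> a b c x t / c powr (\<nu> + 1)"
proof -
  define y where "y = sqrt (a + b / t)"
  have p: "0 < a + b / t" by (rule add_pos_pos[OF a divide_pos_pos[OF b t]])
  have y: "0 < y" unfolding y_def using p by simp
  have y2: "y\<^sup>2 = a + b / t" unfolding y_def using p by simp
  have "a * t\<^sup>2 + b * t = t\<^sup>2 * (a + b / t)" using t by (simp add: power2_eq_square distrib_left)
  then have f: "sqrt (a * t\<^sup>2 + b * t) = t * y" unfolding y_def using t by (simp add: real_sqrt_mult)
  have q: "(a + b / t) powr ((\<nu> - 1) / 2) = y powr (\<nu> - 1)"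
    unfolding y_def using p by (simp add: powr_half_sqrt[symmetric] powr_powr)
  have xy: "x * (t * y) / t = x * y" using t by simp
  have 1: "bessel_I \<nu> (x * y) = (x / 2) powr \<nu> * y powr \<nu> * bessel_clifford \<nu> (x\<^sup>2 * (a + b / t) / 4)"
    using bessel_I_eq_clifford[OF nu mult_pos_pos[OF x y]] x y
    by (simp add: powr_mult[symmetric] power_mult_distrib y2)
  have 2: "bessel_I \<nu> (c * x) = (x / 2) powr \<nu> * c powr \<nu> * bessel_clifford \<nu> (c\<^sup>2 * x\<^sup>2 / 4)"
    using bessel_I_eq_clifford[OF nu mult_pos_pos[OF c x]] x c
    by (simp add: powr_mult[symmetric] power_mult_distrib mult.commute)
  have 3: "c powr (\<nu> + 1) = c * c powr \<nu>" using c by (simp add: powr_add)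
  have 4: "y powr \<nu> = y * y powr (\<nu> - 1)" using y by (simp add: powr_mult_base)
  have alg: "P * (b / (c * t)) * (1 / (t * y)) * (E / (X * C * J)) * (X * (y * Y) * K)
    = P * (b / t\<^sup>2 * Y * E * K / J) / (c * C)" if "X \<noteq> 0" for P E X C J Y K
    using that y by (simp add: power2_eq_square divide_inverse mult_ac)
  show ?thesis
    unfolding passage_density_interior_def passage_factor_def f xy 1 2 3 4 q by (rule alg) (use x in simp)
qed

lemma passage_density_eq:
  assumes c: "0 < c" and x: "0 \<le> x" and t: "0 < t"
  shows "passage_density \<nu> a b c \<phi> x t = \<phi> (ln (1 + b / (a * t))) * passage_factor \<nu> a b c x t / c powr (\<nu> + 1)"
proof (cases "x = 0")
  case True
  have "((\<lambda>x'. \<phi> (ln (1 + b / (a * t))) * passage_factor \<nu> a b c x' t / c powr (\<nu> + 1)) \<longlongrightarrow>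
    \<phi> (ln (1 + b / (a * t))) * passage_factor \<nu> a b c 0 t / c powr (\<nu> + 1)) (at_right 0)"
    by (intro tendsto_divide tendsto_mult tendsto_const tendsto_passage_factor[OF t] tendsto_ident_at) (use c in simp)
  then have "((\<lambda>x'. passage_density_interior \<nu> a b c \<phi> x' t) \<longlongrightarrow>
    \<phi> (ln (1 + b / (a * t))) * passage_factor \<nu> a b c 0 t / c powr (\<nu> + 1)) (at_right 0)"
  proof (rule Lim_transform_eventually)
    show "\<forall>\<^sub>F x' in at_right 0. \<phi> (ln (1 + b / (a * t))) * passage_factor \<nu> a b c x' t / c powr (\<nu> + 1)
      = passage_density_interior \<nu> a b c \<phi> x' t"
      using eventually_at_right_less by (rule eventually_mono) (rule passage_density_interior_eq[OF c _ t, symmetric])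
  qed
  then show ?thesis unfolding passage_density_def True by (simp add: tendsto_Lim)
qed (use passage_density_interior_eq[OF c _ t] x in \<open>simp add: passage_density_def\<close>)

lemma passage_density_driftless_eq:
  assumes x: "0 \<le> x" and t: "0 < t"
  shows "passage_density_driftless \<nu> a b \<phi> x t = \<phi> (ln (1 + b / (a * t))) * passage_factor \<nu> a b 0 x t"
proof -
  have "((\<lambda>c. \<phi> (ln (1 + b / (a * t))) * passage_factor \<nu> a b c x t) \<longlongrightarrow>
    \<phi> (ln (1 + b / (a * t))) * passage_factor \<nu> a b 0 x t) (at_right 0)"
    by (intro tendsto_mult tendsto_const tendsto_passage_factor[OF t] tendsto_ident_at)
  then have "((\<lambda>c. passage_density \<nu> a b c (\<lambda>u. c powr (\<nu> + 1) * \<phi> u) x t) \<longlongrightarrow>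
    \<phi> (ln (1 + b / (a * t))) * passage_factor \<nu> a b 0 x t) (at_right 0)"
  proof (rule Lim_transform_eventually)
    show "\<forall>\<^sub>F c in at_right 0. \<phi> (ln (1 + b / (a * t))) * passage_factor \<nu> a b c x t
      = passage_density \<nu> a b c (\<lambda>u. c powr (\<nu> + 1) * \<phi> u) x t"
      using eventually_at_right_less
    proof (rule eventually_mono)
      fix c :: real assume c: "0 < c"
      then show "\<phi> (ln (1 + b / (a * t))) * passage_factor \<nu> a b c x t
          = passage_density \<nu> a b c (\<lambda>u. c powr (\<nu> + 1) * \<phi> u) x t"
        unfolding passage_density_eq[OF c x t] by simp
    qed
  qed
  then show ?thesis unfolding passage_density_driftless_def by (simp add: tendsto_Lim)
qed

lemma phi_laplace_eq:
  assumes c: "0 < c"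
  shows "phi_laplace \<nu> a b c l = c powr (\<nu> + 1) * a powr (- ((\<nu> + 1) / 2)) *
    (kummer_M (l + (\<nu> + 1) / 2) (\<nu> + 1) (c\<^sup>2 * b / (2 * a)) / kummer_M (l + (\<nu> + 1) / 2) (\<nu> + 1) (b / 2))"
proof -
  have k: "\<nu> / 2 - - l + 1 / 2 = l + (\<nu> + 1) / 2" "1 + 2 * (\<nu> / 2) = \<nu> + 1" by (simp_all add: add_divide_distrib)
  have h: "\<nu> / 2 + 1 / 2 = (\<nu> + 1) / 2" by (simp add: add_divide_distrib)
  have w: "exp (z / 2) * whittaker_M (- l) (\<nu> / 2) z = z powr ((\<nu> + 1) / 2) * kummer_M (l + (\<nu> + 1) / 2) (\<nu> + 1) z" for z
  proof -
    have "exp (z / 2) * exp (- z / 2) = 1" by (simp only: exp_add[symmetric] minus_divide_left[symmetric]) simp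
    then show ?thesis unfolding whittaker_M_def k h mult.assoc[symmetric] by (simp only: mult_1_left)
  qed
  have "c\<^sup>2 * b / (2 * a) = c\<^sup>2 * (b / 2) * inverse a" by (simp add: inverse_eq_divide)
  then have "(c\<^sup>2 * b / (2 * a)) powr ((\<nu> + 1) / 2) = (c\<^sup>2 * (b / 2) * inverse a) powr ((\<nu> + 1) / 2)"
    by (rule arg_cong)
  also have "\<dots> = (c\<^sup>2) powr ((\<nu> + 1) / 2) * (b / 2) powr ((\<nu> + 1) / 2) * inverse a powr ((\<nu> + 1) / 2)"
    unfolding powr_mult ..
  also have "(c\<^sup>2) powr ((\<nu> + 1) / 2) = c powr (\<nu> + 1)"
    unfolding power2_eq_square powr_mult powr_add[symmetric] field_sum_of_halves ..
  also have "inverse a powr ((\<nu> + 1) / 2) = a powr (- ((\<nu> + 1) / 2))"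
    unfolding powr_minus inverse_powr ..
  finally have p: "(c\<^sup>2 * b / (2 * a)) powr ((\<nu> + 1) / 2) = c powr (\<nu> + 1) * (b / 2) powr ((\<nu> + 1) / 2) * a powr (- ((\<nu> + 1) / 2))" .
  have e: "exp (c\<^sup>2 * b / (4 * a)) = exp (c\<^sup>2 * b / (2 * a) / 2)" "exp (b / 4) = exp (b / 2 / 2)" by simp_all
  have alg: "(C * B * A * K) / (B * L) = C * A * (K / L)" if "B \<noteq> 0" for A B C K L :: real
    using that by (simp add: divide_inverse)
  show ?thesis unfolding phi_laplace_def e w p by (rule alg) (use b in simp)
qed

lemma phi_laplace_driftless_eq:
  "phi_laplace_driftless \<nu> a b l = a powr (- ((\<nu> + 1) / 2)) * (1 / kummer_M (l + (\<nu> + 1) / 2) (\<nu> + 1) (b / 2))"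
proof -
  have nu1: "0 < \<nu> + 1" using nu by simp
  let ?K = "\<lambda>c. kummer_M (l + (\<nu> + 1) / 2) (\<nu> + 1) (c\<^sup>2 * b / (2 * a))"
  have "((\<lambda>c. c\<^sup>2 * b / (2 * a)) \<longlongrightarrow> 0\<^sup>2 * b / (2 * a)) (at_right 0)"
    by (intro tendsto_divide tendsto_mult tendsto_power tendsto_const tendsto_ident_at) (use a in simp)
  then have K: "(?K \<longlongrightarrow> 1) (at_right 0)" by (intro tendsto_kummer_M[OF nu1]) simp
  have "((\<lambda>c. a powr (- ((\<nu> + 1) / 2)) * (?K c * inverse (kummer_M (l + (\<nu> + 1) / 2) (\<nu> + 1) (b / 2)))) \<longlongrightarrow>
      a powr (- ((\<nu> + 1) / 2)) * (1 * inverse (kummer_M (l + (\<nu> + 1) / 2) (\<nu> + 1) (b / 2)))) (at_right 0)"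
    by (intro tendsto_mult tendsto_const K)
  then have "((\<lambda>c. phi_laplace \<nu> a b c l / c powr (\<nu> + 1)) \<longlongrightarrow>
      a powr (- ((\<nu> + 1) / 2)) * (1 * inverse (kummer_M (l + (\<nu> + 1) / 2) (\<nu> + 1) (b / 2)))) (at_right 0)"
  proof (rule Lim_transform_eventually)
    show "\<forall>\<^sub>F c in at_right 0.
        a powr (- ((\<nu> + 1) / 2)) * (?K c * inverse (kummer_M (l + (\<nu> + 1) / 2) (\<nu> + 1) (b / 2)))
      = phi_laplace \<nu> a b c l / c powr (\<nu> + 1)"
      using eventually_at_right_less
    proof (rule eventually_mono)
      fix c :: real assume c: "0 < c"
      have alg: "A * (K * inverse L) = C * A * (K / L) / C" if "C \<noteq> 0" for A C K L :: real
        using that by (simp add: divide_inverse)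
      show "a powr (- ((\<nu> + 1) / 2)) * (?K c * inverse (kummer_M (l + (\<nu> + 1) / 2) (\<nu> + 1) (b / 2)))
          = phi_laplace \<nu> a b c l / c powr (\<nu> + 1)"
        unfolding phi_laplace_eq[OF c] by (rule alg) (use c in simp)
    qed
  qed
  from tendsto_Lim[OF trivial_limit_at_right_real this] show ?thesis
    unfolding phi_laplace_driftless_def by (simp only: mult_1_left inverse_eq_divide)
qed

end

theorem proposition26:
  fixes M :: "'w measure" and R :: "real \<Rightarrow> 'w \<Rightarrow> real" and \<nu> a b c x :: real
  assumes "\<nu> > -1" and "c \<ge> 0" and "b > 0" and "sqrt a > c" and "x \<ge> 0"
    and "bessel_process M R \<nu> c x"
  shows
    "(c > 0 \<longrightarrow>
       (\<exists>\<phi>. has_laplace_transform \<phi> (phi_laplace \<nu> a b c)) \<and>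
       (\<forall>\<phi>. has_laplace_transform \<phi> (phi_laplace \<nu> a b c) \<longrightarrow>
          distributed M lborel (last_passage_time R (\<lambda>t. sqrt (a * t\<^sup>2 + b * t)))
            (\<lambda>t. ennreal (indicator {0<..} t * passage_density \<nu> a b c \<phi> x t)))) \<and>
     (c = 0 \<longrightarrow>
       (\<exists>\<phi>. has_laplace_transform \<phi> (phi_laplace_driftless \<nu> a b)) \<and>
       (\<forall>\<phi>. has_laplace_transform \<phi> (phi_laplace_driftless \<nu> a b) \<longrightarrow>
          distributed M lborel (last_passage_time R (\<lambda>t. sqrt (a * t\<^sup>2 + b * t)))
            (\<lambda>t. ennreal (indicator {0<..} t * passage_density_driftless \<nu> a b \<phi> x t))))"
proof -
  interpret bessel_process M R \<nu> c x by fact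
  interpret bessel_passage M R \<nu> c x a b by unfold_locales (use assms in simp_all)
  have G: "last_passage_time R (\<lambda>t. sqrt (a * t\<^sup>2 + b * t)) = last_passage_time R curve"
    by (simp add: curve_def[abs_def])
  have tail: "tail_density t = passage_factor \<nu> a b c x t" for t
    unfolding tail_density_def passage_factor_def ..
  show ?thesis
  proof (intro conjI impI allI)
    assume "c > 0"
    note L = phi_laplace_eq[OF nu a_pos b this] and cc = powr_gt_zero[THEN iffD2, OF less_imp_neq[OF this, symmetric], of "\<nu> + 1"]
    show "\<exists>\<phi>. has_laplace_transform \<phi> (phi_laplace \<nu> a b c)" by (rule laplace_exists[OF cc L])
    fix \<phi> assume \<phi>: "has_laplace_transform \<phi> (phi_laplace \<nu> a b c)"
    have "indicator {0<..} t * passage_density \<nu> a b c \<phi> x t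
      = indicator {0<..} t * (\<phi> (log_time t) * tail_density t / c powr (\<nu> + 1))" for t
      using passage_density_eq[OF nu a_pos b \<open>c > 0\<close> x, of t \<phi>]
      by (simp add: log_time_def tail split: split_indicator)
    then have eq: "(\<lambda>t. ennreal (indicator {0<..} t * passage_density \<nu> a b c \<phi> x t))
      = (\<lambda>t. ennreal (indicator {0<..} t * (\<phi> (log_time t) * tail_density t / c powr (\<nu> + 1))))"
      by (simp only:)
    show "distributed M lborel (last_passage_time R (\<lambda>t. sqrt (a * t\<^sup>2 + b * t)))
        (\<lambda>t. ennreal (indicator {0<..} t * passage_density \<nu> a b c \<phi> x t))"
      unfolding G eq by (rule last_passage_distributed[OF cc \<phi> L])
  next
    assume c0: "c = 0"
    have L: "phi_laplace_driftless \<nu> a b l = 1 * a powr (- half_index) * kummer_ratio (l + half_index)" for l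
      unfolding phi_laplace_driftless_eq[OF nu a_pos b] c0 by (simp add: kummer_M_0)
    have tail0: "tail_density t = passage_factor \<nu> a b 0 x t" for t using tail[of t] by (simp only: c0)
    show "\<exists>\<phi>. has_laplace_transform \<phi> (phi_laplace_driftless \<nu> a b)" by (rule laplace_exists[OF zero_less_one L])
    fix \<phi> assume \<phi>: "has_laplace_transform \<phi> (phi_laplace_driftless \<nu> a b)"
    have "indicator {0<..} t * passage_density_driftless \<nu> a b \<phi> x t
      = indicator {0<..} t * (\<phi> (log_time t) * tail_density t / 1)" for t
      using passage_density_driftless_eq[OF nu a_pos b x, of t \<phi>]
      by (simp add: log_time_def tail0 split: split_indicator)
    then have eq: "(\<lambda>t. ennreal (indicator {0<..} t * passage_density_driftless \<nu> a b \<phi> x t))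
      = (\<lambda>t. ennreal (indicator {0<..} t * (\<phi> (log_time t) * tail_density t / 1)))"
      by (simp only:)
    show "distributed M lborel (last_passage_time R (\<lambda>t. sqrt (a * t\<^sup>2 + b * t)))
        (\<lambda>t. ennreal (indicator {0<..} t * passage_density_driftless \<nu> a b \<phi> x t))"
      unfolding G eq by (rule last_passage_distributed[OF zero_less_one \<phi> L])
  qed
qed

end
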